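(* Equip $\mathcal{P}(D_n)$ with the pointwise operations and the locally convex topology defined by the norms $\|\cdot\|_{D_n,\rho}$ for all $\rho>0$. Then the Fréchet $*$-algebra $\mathcal{A}(D_n)$ (pointwise operations, seminorms $\|\cdot\|_{D_n,K}$) is the completion of $\mathcal{P}(D_n)$: the subspace topology that $\mathcal{P}(D_n)$ inherits from $\mathcal{A}(D_n)$ is the topology of the norms $\|\cdot\|_{D_n,\rho}$, $\rho>0$, and $\mathcal{P}(D_n)$ is dense in $\mathcal{A}(D_n)$. Moreover, the functions $f_{r,P,Q}$, $P,Q\in\mathbb{N}_0^n$, form an absolute Schauder basis of $\mathcal{A}(D_n)$: every $a\in\mathcal{A}(D_n)$ equals the absolutely convergent series $$a=\sum_{P,Q\in\mathbb{N}_0^n} c_{P,Q}(a)\, f_{r,P,Q},\qquad c_{P,Q}(a)=\frac{1}{(2\pi i)^{2n}}\oint_{|x^1|=r}\!\!\cdots\oint_{|x^n|=r}\oint_{|y^1|=r}\!\!\cdots\oint_{|y^n|=r}\frac{\hat a\big((\hat\phi^{\mathrm{std}})^{-1}(x,y)\big)\,(1-x\cdot y)^{\max\{|P|,|Q|\}-1}}{x^{P+1}\,y^{Q+1}}\,dx^1\cdots dx^n\,dy^1\cdots dy^n,$$ where $r\in\,]0,1/\sqrt n[$ is arbitrary, the circles are positively oriented, $x^{P+1}=\prod_{i=1}^n (x^i)^{P_i+1}$, $y^{Q+1}=\prod_{i=1}^n(y^i)^{Q_i+1}$, and the coefficients in such an expansion are unique.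
   Context: Fix an integer $n\ge1$. Indices $\mu,\nu$ run over $\{0,\dots,n\}$; $h_{\mu\nu}$ is diagonal with $h_{00}=-1$, $h_{ii}=1$ for $i\ge1$. For a multi-index $P$, $|P|=\sum_i P_i$. For $P\in\mathbb{N}_0^{1+n}$ write $P'=(P_1,\dots,P_n)$. Let $Z=\{r\in\mathbb{C}^{1+n}: -|r^0|^2+\sum_{i=1}^n|r^i|^2=-1\}$, let $U(1)$ act by scalar multiplication, and $D_n=Z/U(1)$; via $[r]\mapsto w=(r^1/r^0,\dots,r^n/r^0)$, $D_n$ is identified with the open unit ball $\{w\in\mathbb{C}^n:\ w\cdot\bar w:=\sum_i|w^i|^2<1\}$. Let $\hat Z=\{(p,q)\in\mathbb{C}^{1+n}\times\mathbb{C}^{1+n}: -p^0q^0+\sum_{i=1}^n p^iq^i=-1\}$ with the free proper holomorphic $\mathbb{C}^*$-action $z\cdot(p,q)=(zp,q/z)$, and $\hat D_n=\hat Z/\mathbb{C}^*$ (a complex manifold of dimension $2n$). Let $\Delta_D:D_n\to\hat D_n$, $[r]\mapsto[r,\bar r]$. The standard chart $\hat\phi^{\mathrm{std}}=(u^1,\dots,u^n,v^1,\dots,v^n)$ of $\hat D_n$ is defined on $\{[p,q]: p^0\neq0,\ q^0\neq0\}$ by $u^i=p^i/p^0$, $v^i=q^i/q^0$; it is biholomorphic onto $\{(x,y)\in\mathbb{C}^n\times\mathbb{C}^n: x\cdot y:=\sum_i x^iy^i\neq1\}$. $\mathcal{A}(D_n)=\{\hat a\circ\Delta_D:\hat a\in\mathcal{O}(\hat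 D_n)\}$; for each $a\in\mathcal{A}(D_n)$ the holomorphic $\hat a$ with $a=\hat a\circ\Delta_D$ is unique. It is a $*$-algebra under pointwise operations and pointwise complex conjugation, and a Fréchet space with seminorms $\|a\|_{D_n,K}=\sup_{x\in K}|\hat a(x)|$, $K\subseteq\hat D_n$ compact. For $P,Q\in\mathbb{N}_0^{1+n}$ with $|P|=|Q|$, $f_{P,Q}\in\mathcal{A}(D_n)$ is $f_{P,Q}([r])=r^P\bar r^Q$, i.e. $f_{P,Q}=w^{P'}\bar w^{Q'}/(1-w\cdot\bar w)^{|P|}$; $\mathcal{P}(D_n)$ is their linear span. For $P,Q\in\mathbb{N}_0^n$ the fundamental monomial is $f_{r,P,Q}=w^P\bar w^Q/(1-w\cdot\bar w)^{\max\{|P|,|Q|\}}\in\mathcal{P}(D_n)$; these form a basis of $\mathcal{P}(D_n)$. For $\rho>0$ the norm $\|\cdot\|_{D_n,\rho}$ on $\mathcal{P}(D_n)$ is $\|\sum_{P,Q}a_{P,Q}f_{r,P,Q}\|_{D_n,\rho}=\sum_{P,Q}|a_{P,Q}|\rho^{|P+Q|}$. "Absolutely convergent" means that for every continuous seminorm $p$ on $\mathcal{A}(D_n)$, $\sum_{P,Q}|c_{P,Q}(a)|\,p(f_{r,P,Q})<\infty$. *)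

theory Defs
  imports "HOL-Complex_Analysis.Complex_Analysis"
begin

text \<open>The dimension n is CARD('n) for a finite index type 'n (so n >= 1).
  A point of C^(1+n) is a pair (r0, r') with r' :: complex^'n.
  Multi-indices in N_0^n are functions 'n => nat.\<close>

type_synonym 'n pt = "complex \<times> (complex^'n)"
type_synonym 'n hpt = "'n pt \<times> 'n pt"

definition mabs :: "('n::finite \<Rightarrow> nat) \<Rightarrow> nat" where
  "mabs P = (\<Sum>i\<in>UNIV. P i)"

definition xpow :: "complex^'n::finite \<Rightarrow> ('n \<Rightarrow> nat) \<Rightarrow> complex" where
  "xpow x P = (\<Prod>i\<in>UNIV. (x$i) ^ (P i))"

definition vconj :: "complex^'n \<Rightarrow> complex^'n" where
  "vconj w = (\<chi> i. cnj (w$i))"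

definition dotp :: "complex^'n::finite \<Rightarrow> complex^'n \<Rightarrow> complex" where
  "dotp x y = (\<Sum>i\<in>UNIV. x$i * y$i)"

definition wnorm2 :: "complex^'n::finite \<Rightarrow> real" where
  "wnorm2 w = (\<Sum>i\<in>UNIV. (cmod (w$i))^2)"

definition Dn :: "(complex^'n::finite) set" where
  "Dn = {w. wnorm2 w < 1}"

definition Zhat :: "('n::finite) hpt set" where
  "Zhat = {((p0,p),(q0,q)). - p0 * q0 + dotp p q = -1}"

definition act :: "complex \<Rightarrow> ('n::finite) hpt \<Rightarrow> 'n hpt" where
  "act z = (\<lambda>((p0,p),(q0,q)). ((z*p0, z *s p), (q0 / z, (1/z) *s q)))"

definition cscale :: "complex \<Rightarrow> ('n::finite) hpt \<Rightarrow> 'n hpt" where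
  "cscale c = (\<lambda>((p0,p),(q0,q)). ((c*p0, c *s p), (c*q0, c *s q)))"

definition holo_amb :: "(('n::finite) hpt \<Rightarrow> complex) \<Rightarrow> 'n hpt set \<Rightarrow> bool" where
  "holo_amb G U \<longleftrightarrow> open U \<and>
     (\<forall>z\<in>U. \<exists>L. (G has_derivative L) (at z) \<and> (\<forall>v. L (cscale \<i> v) = \<i> * L v))"

text \<open>Holomorphic functions on hat D_n = hat Z / C^*: C^*-invariant functions on hat Z that
  are holomorphic on the complex submanifold hat Z (locally restrictions of ambient
  holomorphic functions).\<close>
definition Ohat :: "(('n::finite) hpt \<Rightarrow> complex) set" where
  "Ohat = {F. (\<forall>x\<in>Zhat. \<forall>z. z \<noteq> 0 \<longrightarrow> F (act z x) = F x) \<and>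
              (\<forall>x\<in>Zhat. \<exists>U G. x \<in> U \<and> holo_amb G U \<and> (\<forall>y\<in>U \<inter> Zhat. F y = G y))}"

definition rep :: "complex^'n::finite \<Rightarrow> 'n pt" where
  "rep w = (let s = complex_of_real (1 / sqrt (1 - wnorm2 w)) in (s, s *s w))"

definition DeltaD :: "complex^'n::finite \<Rightarrow> 'n hpt" where
  "DeltaD w = (let (r0, r) = rep w in ((r0, r), (cnj r0, vconj r)))"

definition Aset :: "(complex^'n::finite \<Rightarrow> complex) set" where
  "Aset = {a. \<exists>F\<in>Ohat. (\<forall>w\<in>Dn. a w = F (DeltaD w)) \<and> (\<forall>w. w \<notin> Dn \<longrightarrow> a w = 0)}"

definition hat :: "(complex^'n::finite \<Rightarrow> complex) \<Rightarrow> 'n hpt \<Rightarrow> complex" where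
  "hat a = (SOME F. F \<in> Ohat \<and> (\<forall>w\<in>Dn. a w = F (DeltaD w)))"

text \<open>seminorm || a ||_{D_n,K}; compact subsets of hat D_n are represented by
  nonempty compact subsets K of hat Z (their images)\<close>
definition semiK :: "('n::finite) hpt set \<Rightarrow> (complex^'n \<Rightarrow> complex) \<Rightarrow> real" where
  "semiK K a = (SUP z\<in>K. cmod (hat a z))"

definition compacts :: "('n::finite) hpt set set" where
  "compacts = {K. compact K \<and> K \<noteq> {} \<and> K \<subseteq> Zhat}"

definition seminorm_topology ::
  "'i set \<Rightarrow> ('i \<Rightarrow> ('a \<Rightarrow> complex) \<Rightarrow> real) \<Rightarrow> ('a \<Rightarrow> complex) set \<Rightarrow> ('a \<Rightarrow> complex) topology" where
  "seminorm_topology I p S = topology (\<lambda>U. U \<subseteq> S \<and>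
     (\<forall>x\<in>U. \<exists>F e. finite F \<and> F \<subseteq> I \<and> e > 0 \<and>
        {y\<in>S. \<forall>i\<in>F. p i (\<lambda>w. y w - x w) < e} \<subseteq> U))"

definition TA :: "(complex^'n::finite \<Rightarrow> complex) topology" where
  "TA = seminorm_topology compacts semiK Aset"

definition cont_seminorm :: "((complex^'n::finite \<Rightarrow> complex) \<Rightarrow> real) \<Rightarrow> bool" where
  "cont_seminorm p \<longleftrightarrow>
     (\<forall>a\<in>Aset. \<forall>b\<in>Aset. p (\<lambda>w. a w + b w) \<le> p a + p b) \<and>
     (\<forall>a\<in>Aset. \<forall>c. p (\<lambda>w. c * a w) = cmod c * p a) \<and>
     continuous_map TA euclideanreal p"

text \<open>f_{P,Q} for P,Q in N_0^(1+n), P = (P0, P')\<close>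
definition fPQ :: "(nat \<times> ('n::finite \<Rightarrow> nat)) \<Rightarrow> (nat \<times> ('n \<Rightarrow> nat)) \<Rightarrow> complex^'n \<Rightarrow> complex" where
  "fPQ P Q w = (if w \<in> Dn then
      xpow w (snd P) * xpow (vconj w) (snd Q) / complex_of_real (1 - wnorm2 w) ^ (fst P + mabs (snd P))
    else 0)"

definition Pset :: "(complex^'n::finite \<Rightarrow> complex) set" where
  "Pset = {a. \<exists>S c. finite S \<and>
      S \<subseteq> {(P,Q). fst P + mabs (snd P) = fst Q + mabs (snd Q)} \<and>
      a = (\<lambda>w. \<Sum>(P,Q)\<in>S. c (P,Q) * fPQ P Q w)}"

definition fr :: "('n::finite \<Rightarrow> nat) \<Rightarrow> ('n \<Rightarrow> nat) \<Rightarrow> complex^'n \<Rightarrow> complex" where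
  "fr P Q w = (if w \<in> Dn then
      xpow w P * xpow (vconj w) Q / complex_of_real (1 - wnorm2 w) ^ (max (mabs P) (mabs Q))
    else 0)"

definition pcoef :: "(complex^'n::finite \<Rightarrow> complex) \<Rightarrow> ('n \<Rightarrow> nat) \<times> ('n \<Rightarrow> nat) \<Rightarrow> complex" where
  "pcoef a = (SOME c. finite {PQ. c PQ \<noteq> 0} \<and>
      a = (\<lambda>w. \<Sum>PQ\<in>{PQ. c PQ \<noteq> 0}. c PQ * fr (fst PQ) (snd PQ) w))"

definition normrho :: "real \<Rightarrow> (complex^'n::finite \<Rightarrow> complex) \<Rightarrow> real" where
  "normrho \<rho> a = (\<Sum>PQ\<in>{PQ. pcoef a PQ \<noteq> 0}. cmod (pcoef a PQ) * \<rho> ^ (mabs (fst PQ) + mabs (snd PQ)))"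

definition TP :: "(complex^'n::finite \<Rightarrow> complex) topology" where
  "TP = seminorm_topology {\<rho>. \<rho> > 0} normrho Pset"

text \<open>inverse of the standard chart, with a chosen representative in hat Z\<close>
definition std_inv :: "complex^'n::finite \<Rightarrow> complex^'n \<Rightarrow> 'n hpt" where
  "std_inv x y = ((1, x), (1 / (1 - dotp x y), (1 / (1 - dotp x y)) *s y))"

fun cints :: "real \<Rightarrow> 'k list \<Rightarrow> (('k \<Rightarrow> complex) \<Rightarrow> complex) \<Rightarrow> ('k \<Rightarrow> complex) \<Rightarrow> complex" where
  "cints r [] g z = g z"
| "cints r (k # ks) g z = contour_integral (circlepath 0 r) (\<lambda>t. cints r ks g (z(k := t)))"

definition idx_list :: "('n::finite) list" where
  "idx_list = (SOME xs. distinct xs \<and> set xs = UNIV)"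

definition coef :: "real \<Rightarrow> (complex^'n::finite \<Rightarrow> complex) \<Rightarrow> ('n \<Rightarrow> nat) \<Rightarrow> ('n \<Rightarrow> nat) \<Rightarrow> complex" where
  "coef r a P Q = (1 / (2 * pi * \<i>)) ^ (2 * CARD('n)) *
     cints r (map Inl idx_list @ map Inr idx_list)
       (\<lambda>z. let x = (\<chi> i. z (Inl i)); y = (\<chi> i. z (Inr i)) in
          hat a (std_inv x y) * (1 - dotp x y) powi (int (max (mabs P) (mabs Q)) - 1)
          / (xpow x (\<lambda>i. P i + 1) * xpow y (\<lambda>i. Q i + 1)))
       (\<lambda>_. 0)"

definition abs_expansion :: "(('n::finite \<Rightarrow> nat) \<times> ('n \<Rightarrow> nat) \<Rightarrow> complex) \<Rightarrow> (complex^'n \<Rightarrow> complex) \<Rightarrow> bool" where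
  "abs_expansion c a \<longleftrightarrow>
     (\<forall>p. cont_seminorm p \<longrightarrow> (\<lambda>PQ. cmod (c PQ) * p (fr (fst PQ) (snd PQ))) summable_on UNIV) \<and>
     limitin TA (\<lambda>F. (\<lambda>w. \<Sum>PQ\<in>F. c PQ * fr (fst PQ) (snd PQ) w)) a (finite_subsets_at_top UNIV)"

end

theory Submission
  imports Defs
begin

text \<open>
  In the coordinates \<open>(s, y)\<close> with \<open>[p, q] = [(1 + s\<cdot>y, s), (1, y)]\<close>, and likewise \<open>(x, t)\<close> with
  \<open>[p, q] = [(1, x), (1 + x\<cdot>t, t)]\<close>, a holomorphic function on \<open>Zhat / \<complex>\<^sup>*\<close> becomes entire on
  \<open>\<complex>\<^bsup>2n\<^esup>\<close>. The standard coordinates are related to these by \<open>s = x / (1 - x\<cdot>y)\<close> and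
  \<open>t = y / (1 - x\<cdot>y)\<close>, so the fundamental monomial \<open>f\<^sub>P\<^sub>,\<^sub>Q\<close> is \<open>s\<^sup>P y\<^sup>Q\<close> if \<open>|P| \<ge> |Q|\<close>
  and \<open>x\<^sup>P t\<^sup>Q\<close> if \<open>|P| \<le> |Q|\<close>. Both charts intertwine the circle action
  \<open>(x, y) \<mapsto> (u x, u\<^sup>-\<^sup>1 y)\<close>; comparing Laurent coefficients in \<open>u\<close>, the part of weight \<open>|P| - |Q| \<ge> 0\<close>
  of the function is read off from the Taylor series in \<open>(s, y)\<close>, the part of negative weight
  from the Taylor series in \<open>(x, t)\<close>. Cauchy's estimates on polydiscs of arbitrary radius give the
  continuity of the coefficients and absolute convergence. Expanding \<open>(1 - x\<cdot>y)\<^sup>k\<close> binomially shows that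
  the integrals \<open>c\<^sub>P\<^sub>,\<^sub>Q\<close> are biorthogonal to the \<open>f\<^sub>P\<^sub>,\<^sub>Q\<close>, hence compute these coefficients.
\<close>

section \<open>Iterated circle integrals\<close>

text \<open>Each chart misses a hypersurface. Normalising q0 to 1 reaches only points with q0
  nonzero, and there s^P y^Q = p^P q^Q q0^(|P|-|Q|), which is singular along q0 = 0 if |P| < |Q|.
  One Taylor series therefore cannot serve the whole quotient, and the negative weights have to come
  from the chart normalised by p0 = 1. On the other hand each of these charts is a full copy of
  C^(2n), whereas the standard chart omits x.y = 1; this is why the coefficients decay faster than
  every geometric sequence and why norms of all radii appear. Two bounds carry the topological
  claims: a coefficient is at most a supremum over a compact set divided by R^(|P|+|Q|), and a
  fundamental monomial is at most M^(|P|+|Q|) on a compact set. The coefficients are first defined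
  through the two charts (\<open>ecoef\<close>); the integrals over a small torus are identified
  with them only afterwards, by termwise integration of the expansion. As \<open>hat\<close> is a
  choice, all this presupposes that an element of \<open>Ohat\<close> vanishing on the image of
  \<open>DeltaD\<close> vanishes on \<open>Zhat\<close>.\<close>

definition torus :: "real \<Rightarrow> 'k set \<Rightarrow> ('k \<Rightarrow> complex) set" where
  "torus r A = {z. \<forall>k\<in>A. cmod (z k) = r}"

lemma torus_empty [simp]: "torus r {} = UNIV"
  by (simp add: torus_def)

lemma torus_fun_upd: "z \<in> torus r (A - set (k # ks)) \<Longrightarrow> cmod t = r \<Longrightarrow> z(k := t) \<in> torus r (A - set ks)"
  by (auto simp: torus_def)

lemma path_image_circlepath_0: "0 < r \<Longrightarrow> path_image (circlepath 0 r) = {t. cmod t = r}"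
  by (auto simp: sphere_def dist_norm)

lemma contour_integral_circlepath_cong:
  assumes "0 < r" "\<And>t. cmod t = r \<Longrightarrow> f t = g t"
  shows "contour_integral (circlepath 0 r) f = contour_integral (circlepath 0 r) g"
  using assms by (intro contour_integral_cong) (auto simp: sphere_def dist_norm)

lemma continuous_on_fun_upd:
  fixes f :: "'a::topological_space \<Rightarrow> 'k \<Rightarrow> 'b::topological_space"
  assumes "continuous_on S f" "continuous_on S g"
  shows "continuous_on S (\<lambda>x. (f x)(k := g x))"
proof (rule continuous_on_coordinatewise_then_product)
  fix i
  show "continuous_on S (\<lambda>x. ((f x)(k := g x)) i)"
    using assms by (cases "i = k") (auto intro: continuous_on_product_then_coordinatewise)
qed

text \<open>Integrating over a coordinate overwrites it, so its initial value becomes arbitrary: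
  this is why the constraint set shrinks from \<open>A\<close> to \<open>A - set ks\<close>. Each
  step is the continuity of a parameter integral over [0,1].\<close>

lemma continuous_on_cints:
  assumes r: "0 < r" and g: "continuous_on (torus r A) g"
  shows "continuous_on (torus r (A - set ks)) (cints r ks g)"
proof (induction ks)
  case Nil
  then show ?case using g by (simp cong: continuous_on_cong)
next
  case (Cons k ks)
  let ?U = "torus r (A - set (k # ks))"
  have "continuous_on (?U \<times> cbox 0 1) (\<lambda>(z, x::real). cints r ks g (z(k := circlepath 0 r x)) *
      (2 * pi * \<i> * r * exp (2 * of_real pi * \<i> * x)))"
  proof -
    have *: "continuous_on (?U \<times> cbox 0 1) (\<lambda>w. (fst w)(k := circlepath 0 r (snd w :: real)))"
      unfolding circlepath
      by (intro continuous_on_fun_upd continuous_intros)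
    have "continuous_on (?U \<times> cbox 0 1) (\<lambda>w. cints r ks g ((fst w)(k := circlepath 0 r (snd w))))"
    proof (rule continuous_on_compose2[OF Cons.IH *], safe)
      fix z :: "'a \<Rightarrow> complex" and x :: real
      assume "z \<in> ?U"
      then show "(fst (z, x))(k := circlepath 0 r (snd (z, x))) \<in> torus r (A - set ks)"
        using r by (intro torus_fun_upd) (auto simp: circlepath norm_mult)
    qed
    then show ?thesis unfolding split_beta
      by (intro continuous_intros)
  qed
  from integral_continuous_on_param[OF this]
  have "continuous_on ?U (\<lambda>z. integral (cbox 0 1) (\<lambda>x. cints r ks g (z(k := circlepath 0 r x)) *
      (2 * pi * \<i> * r * exp (2 * of_real pi * \<i> * x))))" .
  then show ?case
    by (simp add: contour_integral_integral vector_derivative_circlepath fun_upd_def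
             cong: continuous_on_cong)
qed

lemma contour_integrable_cints:
  assumes r: "0 < r" and g: "continuous_on (torus r A) g" and z: "z \<in> torus r (A - set (k # ks))"
  shows "(\<lambda>t. cints r ks g (z(k := t))) contour_integrable_on circlepath 0 r"
proof (rule contour_integrable_continuous_circlepath)
  show "continuous_on (path_image (circlepath 0 r)) (\<lambda>t. cints r ks g (z(k := t)))"
  proof (rule continuous_on_compose2[OF continuous_on_cints[OF r g]])
    show "continuous_on (path_image (circlepath 0 r)) (\<lambda>t. z(k := t))"
      by (intro continuous_on_fun_upd continuous_intros)
    show "(\<lambda>t. z(k := t)) ` path_image (circlepath 0 r) \<subseteq> torus r (A - set ks)"
      using r torus_fun_upd[OF z] by (auto simp: path_image_circlepath_0)
  qed
qed

text \<open>Locality of the iterated integral: it sees the integrand only where the integrated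
  coordinates lie on the circle and the others are frozen at \<open>z\<close>.\<close>

lemma cints_cong:
  assumes "0 < r"
    and "\<And>w. (\<And>j. j \<notin> set ks \<Longrightarrow> w j = z j) \<Longrightarrow> (\<And>j. j \<in> set ks \<Longrightarrow> cmod (w j) = r) \<Longrightarrow> g w = h w"
  shows "cints r ks g z = cints r ks h z"
  using assms(2)
proof (induction ks arbitrary: z)
  case Nil
  then show ?case by simp
next
  case (Cons k ks)
  have "cints r ks g (z(k := t)) = cints r ks h (z(k := t))" if "cmod t = r" for t
  proof (rule Cons.IH)
    fix w assume w: "\<And>j. j \<notin> set ks \<Longrightarrow> w j = (z(k := t)) j" "\<And>j. j \<in> set ks \<Longrightarrow> cmod (w j) = r"
    show "g w = h w"
    proof (rule Cons.prems)
      show "w j = z j" if "j \<notin> set (k # ks)" for j using w(1)[of j] that by auto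
      show "cmod (w j) = r" if "j \<in> set (k # ks)" for j
        using w(1)[of j] w(2)[of j] that \<open>cmod t = r\<close> by (cases "j \<in> set ks") auto
    qed
  qed
  then show ?case
    by (auto intro: contour_integral_circlepath_cong[OF assms(1)])
qed

lemma cints_add:
  assumes "0 < r" "continuous_on (torus r A) g" "continuous_on (torus r A) h" "z \<in> torus r (A - set ks)"
  shows "cints r ks (\<lambda>w. g w + h w) z = cints r ks g z + cints r ks h z"
  using assms(4)
proof (induction ks arbitrary: z)
  case (Cons k ks)
  have "cints r ks (\<lambda>w. g w + h w) (z(k := t)) = cints r ks g (z(k := t)) + cints r ks h (z(k := t))"
    if "cmod t = r" for t
    by (rule Cons.IH[OF torus_fun_upd[OF Cons.prems that]])
  then have "cints r (k # ks) (\<lambda>w. g w + h w) z =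
      contour_integral (circlepath 0 r) (\<lambda>t. cints r ks g (z(k := t)) + cints r ks h (z(k := t)))"
    by (auto intro: contour_integral_circlepath_cong[OF assms(1)])
  also have "\<dots> = cints r (k # ks) g z + cints r (k # ks) h z"
    using Cons.prems assms
    by (simp add: contour_integral_add contour_integrable_cints)
  finally show ?case .
qed auto

lemma cints_cmult:
  assumes "0 < r" "continuous_on (torus r A) g" "z \<in> torus r (A - set ks)"
  shows "cints r ks (\<lambda>w. c * g w) z = c * cints r ks g z"
  using assms(3)
proof (induction ks arbitrary: z)
  case (Cons k ks)
  have "cints r ks (\<lambda>w. c * g w) (z(k := t)) = c * cints r ks g (z(k := t))"
    if "cmod t = r" for t
    by (rule Cons.IH[OF torus_fun_upd[OF Cons.prems that]])
  then have "cints r (k # ks) (\<lambda>w. c * g w) z =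
      contour_integral (circlepath 0 r) (\<lambda>t. c * cints r ks g (z(k := t)))"
    by (auto intro: contour_integral_circlepath_cong[OF assms(1)])
  also have "\<dots> = c * cints r (k # ks) g z"
    using Cons.prems assms
    by (simp add: contour_integral_lmul contour_integrable_cints)
  finally show ?case .
qed auto

lemma cints_zero [simp]: "cints r ks (\<lambda>w. 0) z = 0"
  by (induction ks arbitrary: z) auto

lemma cints_sum:
  assumes "0 < r" "finite I" "\<And>m. m \<in> I \<Longrightarrow> continuous_on (torus r A) (g m)" "z \<in> torus r (A - set ks)"
  shows "cints r ks (\<lambda>w. \<Sum>m\<in>I. g m w) z = (\<Sum>m\<in>I. cints r ks (g m) z)"
  using assms(2,3)
proof (induction I rule: finite_induct)
  case (insert i I)
  then show ?case
    using cints_add[OF assms(1) _ _ assms(4), of "g i" "\<lambda>w. \<Sum>m\<in>I. g m w"]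
    by (simp add: continuous_on_sum)
qed auto

lemma norm_cints_le:
  assumes "0 < r" "continuous_on (torus r A) g" "z \<in> torus r (A - set ks)"
    and "\<And>w. w \<in> torus r A \<Longrightarrow> cmod (g w) \<le> B" "0 \<le> B"
  shows "cmod (cints r ks g z) \<le> (2 * pi * r) ^ length ks * B"
  using assms(3)
proof (induction ks arbitrary: z)
  case Nil
  then show ?case using assms by auto
next
  case (Cons k ks)
  have "cmod (cints r ks g (z(k := t))) \<le> (2 * pi * r) ^ length ks * B" if "cmod t = r" for t
    by (rule Cons.IH[OF torus_fun_upd[OF Cons.prems that]])
  moreover have "((\<lambda>t. cints r ks g (z(k := t))) has_contour_integral cints r (k # ks) g z) (circlepath 0 r)"
    using contour_integrable_cints[OF assms(1,2) Cons.prems] has_contour_integral_integral by simp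
  ultimately have "cmod (cints r (k # ks) g z) \<le> (2 * pi * r) ^ length ks * B * (2 * pi * r)"
    using assms by (intro has_contour_integral_bound_circlepath) auto
  then show ?case by (simp add: mult_ac)
qed

lemma cints_tendsto:
  assumes r: "0 < r" and F: "F \<noteq> bot"
    and f: "\<And>X. continuous_on (torus r A) (f X)"
    and lim: "uniform_limit (torus r A) f g F" and z: "z \<in> torus r (A - set ks)"
  shows "((\<lambda>X. cints r ks (f X) z) \<longlongrightarrow> cints r ks g z) F"
proof (rule tendstoI)
  fix e :: real assume e: "0 < e"
  have g: "continuous_on (torus r A) g"
    by (rule uniform_limit_theorem[OF _ lim F]) (simp add: f)
  let ?C = "(2 * pi * r) ^ length ks"
  have C: "0 < ?C" using r by simp
  \<comment> \<open>The norm bound on the integral is not strict, so half of \<open>e\<close> is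
    spent and the final inequality stays strict.\<close>
  define d where "d = e / (2 * ?C)"
  have d: "0 < d" using e C by (simp add: d_def)
  have "\<forall>\<^sub>F X in F. \<forall>w\<in>torus r A. dist (f X w) (g w) < d"
    using lim d by (auto simp: uniform_limit_iff)
  then show "\<forall>\<^sub>F X in F. dist (cints r ks (f X) z) (cints r ks g z) < e"
  proof eventually_elim
    case (elim X)
    have "cints r ks (f X) z = cints r ks (\<lambda>w. (f X w - g w) + g w) z" by simp
    also have "\<dots> = cints r ks (\<lambda>w. f X w - g w) z + cints r ks g z"
      by (intro cints_add[OF r _ _ z] continuous_intros f g)
    finally have "dist (cints r ks (f X) z) (cints r ks g z) = cmod (cints r ks (\<lambda>w. f X w - g w) z)"
      by (simp add: dist_norm)
    also have "\<dots> \<le> ?C * d"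
      using elim d by (intro norm_cints_le[OF r _ z] continuous_intros f g) (auto simp: dist_norm less_imp_le)
    also have "\<dots> = e / 2"
      using less_imp_neq[OF C] unfolding d_def by (simp only: times_divide_eq_right) (metis mult_divide_mult_cancel_right mult.commute less_irrefl C)
    finally show ?case using e by simp
  qed
qed

text \<open>Weierstrass M-test on the torus, then passage to the limit under the integral. Taylor
  expansion, extraction of Laurent coefficients and biorthogonality all rest on this
  exchange.\<close>

lemma cints_has_sum:
  assumes r: "0 < r" and f: "\<And>m. continuous_on (torus r A) (f m)"
    and le: "\<And>m w. w \<in> torus r A \<Longrightarrow> cmod (f m w) \<le> M m" and M: "M summable_on I"
    and g: "\<And>w. w \<in> torus r A \<Longrightarrow> ((\<lambda>m. f m w) has_sum g w) I"
    and z: "z \<in> torus r (A - set ks)"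
  shows "((\<lambda>m. cints r ks (f m) z) has_sum cints r ks g z) I"
proof -
  have "uniform_limit (torus r A) (\<lambda>X w. \<Sum>m\<in>X. f m w) g (finite_subsets_at_top I)"
    by (rule Weierstrass_m_test_general'[OF _ g M]) (auto intro: le)
  from cints_tendsto[OF r _ _ this z]
  have "((\<lambda>X. cints r ks (\<lambda>w. \<Sum>m\<in>X. f m w) z) \<longlongrightarrow> cints r ks g z) (finite_subsets_at_top I)"
    by (auto intro!: continuous_intros f)
  moreover have "\<forall>\<^sub>F X in finite_subsets_at_top I. cints r ks (\<lambda>w. \<Sum>m\<in>X. f m w) z = (\<Sum>m\<in>X. cints r ks (f m) z)"
    by (rule eventually_finite_subsets_at_top_weakI) (auto intro!: cints_sum[OF r _ _ z] f)
  ultimately show ?thesis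
    unfolding has_sum_def using filterlim_cong by fast
qed

section \<open>Orthogonality of monomials and Cauchy's formula on the torus\<close>

lemma contour_integral_powi_circlepath:
  assumes "0 < r"
  shows "contour_integral (circlepath 0 r) (\<lambda>t. t powi e) = (if e = -1 then 2 * pi * \<i> else 0)"
proof (cases "e = -1")
  case True
  then show ?thesis
    using contour_integral_circlepath[OF assms, of 0] by (simp add: power_int_minus field_simps)
next
  case False
  have "((\<lambda>t. t powi e) has_contour_integral 0) (circlepath 0 r)"
  proof (rule Cauchy_theorem_primitive[of "UNIV - {0}" "\<lambda>t. t powi (e + 1) / of_int (e + 1)"])
    have "of_int (e + 1) \<noteq> (0::complex)"
      using False by (simp only: of_int_eq_0_iff)
    then show "((\<lambda>t. t powi (e + 1) / of_int (e + 1)) has_field_derivative x powi e) (at x within UNIV - {0})"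
      if "x \<in> UNIV - {0}" for x :: complex
      using that by (auto intro!: derivative_eq_intros simp del: of_int_add)
  qed (use assms in \<open>auto simp: path_image_circlepath_0\<close>)
  then show ?thesis using False by (simp add: contour_integral_unique)
qed

lemma continuous_on_torus_coordinate: "continuous_on (torus r A) (\<lambda>z. z k)"
  by (rule continuous_on_subset[of UNIV]) (auto intro: continuous_on_product_coordinates)

lemma continuous_on_torus_monomial:
  assumes "0 < r" "B \<subseteq> A"
  shows "continuous_on (torus r A) (\<lambda>z. \<Prod>k\<in>B. z k powi e k)"
proof -
  have "z k \<noteq> 0" if "k \<in> B" "z \<in> torus r A" for k and z :: "'a \<Rightarrow> complex"
    using that assms unfolding torus_def by (metis (mono_tags) mem_Collect_eq norm_zero order_less_irrefl subsetD)
  then show ?thesis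
    by (intro continuous_on_prod continuous_on_power_int continuous_on_torus_coordinate) auto
qed

text \<open>Orthogonality of the characters of the torus. Integer exponents allow a monomial and the
  denominator of a coefficient integral to be merged into one monomial.\<close>

lemma cints_monomial:
  assumes r: "0 < r" and "distinct ks"
  shows "cints r ks (\<lambda>z. \<Prod>k\<in>set ks. z k powi e k) z =
    (if \<forall>k\<in>set ks. e k = -1 then (2 * pi * \<i>) ^ length ks else 0)"
  using assms(2)
proof (induction ks arbitrary: z)
  case (Cons k ks)
  have "cints r ks (\<lambda>z. \<Prod>k\<in>set (k # ks). z k powi e k) (z(k := t)) =
      t powi e k * cints r ks (\<lambda>z. \<Prod>k\<in>set ks. z k powi e k) (z(k := t))" if t: "cmod t = r" for t
  proof -
    have "cints r ks (\<lambda>z. \<Prod>k\<in>set (k # ks). z k powi e k) (z(k := t)) =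
      cints r ks (\<lambda>z. t powi e k * (\<Prod>k\<in>set ks. z k powi e k)) (z(k := t))"
      using Cons.prems by (intro cints_cong[OF r]) auto
    also have "\<dots> = t powi e k * cints r ks (\<lambda>z. \<Prod>k\<in>set ks. z k powi e k) (z(k := t))"
      by (rule cints_cmult[OF r, of "set ks"]) (use r in \<open>auto intro: continuous_on_torus_monomial\<close>)
    finally show ?thesis .
  qed
  then have "cints r (k # ks) (\<lambda>z. \<Prod>k\<in>set (k # ks). z k powi e k) z =
     contour_integral (circlepath 0 r)
       (\<lambda>t. (if \<forall>k\<in>set ks. e k = -1 then (2 * pi * \<i>) ^ length ks else 0) * t powi e k)"
    using Cons unfolding cints.simps by (intro contour_integral_circlepath_cong[OF r]) (simp add: mult.commute)
  also have "\<dots> = (if \<forall>k\<in>set ks. e k = -1 then (2 * pi * \<i>) ^ length ks else 0) *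
      contour_integral (circlepath 0 r) (\<lambda>t. t powi e k)"
    using r by (intro contour_integral_lmul contour_integrable_continuous_circlepath continuous_intros)
      (auto simp: path_image_circlepath_0)
  finally show ?case
    by (simp add: contour_integral_powi_circlepath[OF r])
qed auto

text \<open>Cauchy's formula one variable at a time. Keeping \<open>w\<close> in the coordinates not
  yet integrated is the generality that the induction over \<open>ks\<close> requires.\<close>

lemma cints_Cauchy_kernel:
  assumes r: "0 < r" and ks: "distinct ks"
    and hol: "\<And>w k. (\<lambda>t. g (w(k := t))) holomorphic_on UNIV"
    and cont: "continuous_on UNIV g"
    and z: "\<And>k. k \<in> set ks \<Longrightarrow> cmod (z k) < r"
  shows "cints r ks (\<lambda>t. g t / (\<Prod>k\<in>set ks. t k - z k)) w =
    (2 * pi * \<i>) ^ length ks * g (\<lambda>k. if k \<in> set ks then z k else w k)"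
  using ks z
proof (induction ks arbitrary: w)
  case (Cons k ks)
  let ?G = "\<lambda>t. g t / (\<Prod>k\<in>set ks. t k - z k)"
  have *: "cints r ks (\<lambda>t. g t / (\<Prod>k\<in>set (k # ks). t k - z k)) (w(k := t)) =
      1 / (t - z k) * cints r ks ?G (w(k := t))" if t: "cmod t = r" for t
  proof -
    have "cints r ks (\<lambda>t. g t / (\<Prod>k\<in>set (k # ks). t k - z k)) (w(k := t)) =
      cints r ks (\<lambda>u. 1 / (t - z k) * ?G u) (w(k := t))"
      using Cons.prems by (intro cints_cong[OF r]) auto
    also have "\<dots> = 1 / (t - z k) * cints r ks ?G (w(k := t))"
    proof (rule cints_cmult[OF r, of "set ks"])
      have "continuous_on (torus r (set ks)) g"
        using cont continuous_on_subset by blast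
      then show "continuous_on (torus r (set ks)) ?G"
        using Cons.prems by (intro continuous_intros continuous_on_torus_coordinate) (force simp: torus_def)+
    qed auto
    finally show ?thesis .
  qed
  have "cints r (k # ks) (\<lambda>t. g t / (\<Prod>k\<in>set (k # ks). t k - z k)) w =
     contour_integral (circlepath 0 r)
       (\<lambda>t. (2 * pi * \<i>) ^ length ks * g ((\<lambda>j. if j \<in> set ks then z j else w j)(k := t)) / (t - z k))"
  proof -
    have eq: "(\<lambda>j. if j \<in> set ks then z j else (w(k := t)) j) = (\<lambda>j. if j \<in> set ks then z j else w j)(k := t)" for t
      using Cons.prems by auto
    show ?thesis
      using Cons.IH Cons.prems *
      by (auto intro!: contour_integral_circlepath_cong[OF r] simp: eq simp del: fun_upd_apply)
  qed
  also have "\<dots> = 2 * of_real pi * \<i> * ((2 * pi * \<i>) ^ length ks * g ((\<lambda>j. if j \<in> set ks then z j else w j)(k := z k)))"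
  proof (rule contour_integral_unique, rule Cauchy_integral_circlepath_simple)
    show "(\<lambda>t. (2 * pi * \<i>) ^ length ks * g ((\<lambda>j. if j \<in> set ks then z j else w j)(k := t))) holomorphic_on cball 0 r"
      using hol by (intro holomorphic_intros) (meson holomorphic_on_subset subset_UNIV)
    show "cmod (z k - 0) < r" using Cons.prems by simp
  qed
  also have "(\<lambda>j. if j \<in> set ks then z j else w j)(k := z k) = (\<lambda>j. if j \<in> set (k # ks) then z j else w j)"
    by auto
  finally show ?case by simp
qed auto

section \<open>Taylor series in several variables\<close>

lemma has_sum_geometric_product:
  fixes w :: "'k::finite \<Rightarrow> complex"
  assumes "\<And>k. cmod (w k) < 1"
  shows "((\<lambda>m. \<Prod>k\<in>UNIV. w k ^ m k) has_sum (\<Prod>k\<in>UNIV. 1 / (1 - w k))) UNIV"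
proof -
  have "infsum (\<lambda>m. \<Prod>k\<in>UNIV. w k ^ m k) (PiE UNIV (\<lambda>_. UNIV)) = (\<Prod>k\<in>UNIV. infsum (\<lambda>n. w k ^ n) UNIV)"
  proof (rule infsum_prod_PiE_abs)
    fix k
    have "((\<lambda>n. cmod (w k) ^ n) has_sum (1 / (1 - cmod (w k)))) UNIV"
      using assms[of k] by (intro sums_nonneg_imp_has_sum geometric_sums) auto
    then show "(\<lambda>n. norm (w k ^ n)) summable_on UNIV"
      by (auto simp: norm_power summable_on_def)
  qed auto
  also have "(\<lambda>k. infsum (\<lambda>n. w k ^ n) UNIV) = (\<lambda>k. 1 / (1 - w k))"
  proof (rule ext, rule infsumI, rule norm_summable_imp_has_sum)
    fix k
    show "summable (\<lambda>n. norm (w k ^ n))" using assms[of k] by (simp add: norm_power)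
    show "(\<lambda>n. w k ^ n) sums (1 / (1 - w k))" using assms[of k] by (rule geometric_sums)
  qed
  finally have *: "infsum (\<lambda>m. \<Prod>k\<in>UNIV. w k ^ m k) UNIV = (\<Prod>k\<in>UNIV. 1 / (1 - w k))"
    by (simp add: PiE_UNIV_domain)
  have "w k \<noteq> 1" for k using assms[of k] by auto
  then have "(\<Prod>k\<in>UNIV. 1 / (1 - w k)) \<noteq> 0" by simp
  \<comment> \<open>a nonzero infsum is never the junk value\<close>
  with * have "(\<lambda>m. \<Prod>k\<in>UNIV. w k ^ m k) summable_on UNIV"
    using infsum_not_exists by metis
  with * show ?thesis by (metis has_sum_infsum)
qed

lemma summable_geometric_product:
  fixes w :: "'k::finite \<Rightarrow> real"
  assumes "\<And>k. 0 \<le> w k" "\<And>k. w k < 1"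
  shows "(\<lambda>m. \<Prod>k\<in>UNIV. w k ^ m k) summable_on UNIV"
proof -
  have "(\<lambda>m. \<Prod>k\<in>UNIV. complex_of_real (w k) ^ m k) summable_on UNIV"
    using has_sum_geometric_product[of "\<lambda>k. of_real (w k)"] assms by (auto simp: summable_on_def)
  then have "(\<lambda>m. Re (\<Prod>k\<in>UNIV. complex_of_real (w k) ^ m k)) summable_on UNIV"
    by (rule summable_on_Re)
  moreover have "Re (\<Prod>k\<in>UNIV. complex_of_real (w k) ^ m k) = (\<Prod>k\<in>UNIV. w k ^ m k)" for m
    by (simp flip: of_real_power of_real_prod)
  ultimately show ?thesis by simp
qed

lemma summable_power_mabs:
  assumes "0 \<le> q" "q < (1::real)"
  shows "(\<lambda>m::'k::finite \<Rightarrow> nat. q ^ mabs m) summable_on UNIV"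
  using summable_geometric_product[of "\<lambda>_::'k. q"] assms by (simp add: mabs_def power_sum)

lemma compact_torus: "compact (torus R (UNIV::'k set))"
proof -
  have "compactin (product_topology (\<lambda>_::'k. euclidean :: complex topology) UNIV) (PiE UNIV (\<lambda>_. sphere 0 R))"
    unfolding compactin_PiE by auto
  moreover have "PiE UNIV (\<lambda>_::'k. sphere (0::complex) R) = torus R UNIV"
    by (auto simp: PiE_UNIV_domain torus_def)
  ultimately show ?thesis by (simp add: euclidean_product_topology)
qed

text \<open>By Osgood's lemma this is holomorphy on C^k for finite index types; in this form it
  feeds directly into the iterated Cauchy formula.\<close>

definition entire :: "(('k \<Rightarrow> complex) \<Rightarrow> complex) \<Rightarrow> bool" where
  "entire g \<longleftrightarrow> continuous_on UNIV g \<and> (\<forall>w k. (\<lambda>t. g (w(k := t))) holomorphic_on UNIV)"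

lemma entire_bounded_torus:
  assumes "entire g"
  obtains B where "0 \<le> B" "\<And>z. z \<in> torus R UNIV \<Longrightarrow> cmod (g z) \<le> B"
proof -
  have "compact (g ` torus R UNIV)"
    using assms continuous_on_subset
    by (intro compact_continuous_image compact_torus) (auto simp: entire_def)
  then obtain B where "\<forall>z\<in>torus R UNIV. cmod (g z) \<le> B"
    using compact_imp_bounded bounded_iff by (metis imageI)
  then show thesis using that[of "max B 0"] by fastforce
qed

text \<open>For entire \<open>g\<close> this is a Taylor coefficient at 0. For \<open>g\<close>
  merely continuous on the torus it is a Fourier coefficient divided by R^|m|; \<open>coef\<close>
  is treated in this second sense, since its integrand is regular only where x.y differs from
  1.\<close>

definition tcoef :: "real \<Rightarrow> 'k list \<Rightarrow> (('k::finite \<Rightarrow> complex) \<Rightarrow> complex) \<Rightarrow> ('k \<Rightarrow> nat) \<Rightarrow> complex" where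
  "tcoef R ks g m = (1 / (2 * pi * \<i>)) ^ length ks *
     cints R ks (\<lambda>z. g z / (\<Prod>k\<in>UNIV. z k ^ (m k + 1))) (\<lambda>_. 0)"

lemma norm_torus_monomial:
  fixes z :: "'k::finite \<Rightarrow> complex"
  assumes "z \<in> torus R UNIV" shows "cmod (\<Prod>k\<in>UNIV. z k ^ m k) = R ^ mabs m"
  using assms by (simp add: torus_def prod_norm[symmetric] norm_power mabs_def power_sum)

lemma mabs_Suc: "mabs (\<lambda>k::'k::finite. m k + 1) = mabs m + CARD('k)"
  by (simp only: mabs_def sum.distrib) simp

lemma continuous_on_torus_div_monomial:
  fixes g :: "('k::finite \<Rightarrow> complex) \<Rightarrow> complex"
  assumes "0 < R" "continuous_on (torus R UNIV) g"
  shows "continuous_on (torus R UNIV) (\<lambda>z. g z / (\<Prod>k\<in>UNIV. z k ^ m k))"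
proof -
  have "(\<Prod>k\<in>UNIV. z k ^ m k) \<noteq> 0" if "z \<in> torus R UNIV" for z :: "'k \<Rightarrow> complex"
    using norm_torus_monomial[OF that, of m] assms by (metis norm_zero power_eq_0_iff less_irrefl)
  then show ?thesis
    using assms by (intro continuous_intros continuous_on_torus_coordinate) auto
qed

text \<open>Cauchy's estimate: the lengths of the circles cancel the extra 1 in each exponent of the
  denominator.\<close>

lemma norm_tcoef_le:
  fixes g :: "('k::finite \<Rightarrow> complex) \<Rightarrow> complex"
  assumes R: "0 < R" and ks: "distinct ks" "set ks = UNIV" and g: "continuous_on (torus R UNIV) g"
    and B: "0 \<le> B" "\<And>z. z \<in> torus R UNIV \<Longrightarrow> cmod (g z) \<le> B"
  shows "cmod (tcoef R ks g m) \<le> B / R ^ mabs m"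
proof -
  have len: "length ks = CARD('k)" using ks distinct_card by metis
  have "cmod (cints R ks (\<lambda>z. g z / (\<Prod>k\<in>UNIV. z k ^ (m k + 1))) (\<lambda>_. 0)) \<le>
      (2 * pi * R) ^ length ks * (B / R ^ (mabs m + CARD('k)))"
  proof (rule norm_cints_le[OF R, of UNIV])
    fix w :: "'k \<Rightarrow> complex" assume w: "w \<in> torus R UNIV"
    show "cmod (g w / (\<Prod>k\<in>UNIV. w k ^ (m k + 1))) \<le> B / R ^ (mabs m + CARD('k))"
      unfolding norm_divide norm_torus_monomial[OF w] mabs_Suc
      using B w R by (intro divide_right_mono) auto
  next
    show "continuous_on (torus R UNIV) (\<lambda>z. g z / (\<Prod>k\<in>UNIV. z k ^ (m k + 1)))"
      by (rule continuous_on_torus_div_monomial[OF R g])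
  qed (use R B ks in auto)
  then have "cmod (tcoef R ks g m) \<le>
      1 / (2 * pi) ^ length ks * ((2 * pi * R) ^ length ks * (B / R ^ (mabs m + CARD('k))))"
    unfolding tcoef_def norm_mult by (intro mult_mono) (auto simp: norm_power norm_divide norm_mult power_divide power_mult_distrib)
  also have "\<dots> = B / R ^ mabs m"
    using R by (simp add: len power_add power_mult_distrib field_simps)
  finally show ?thesis .
qed

text \<open>The Cauchy kernel is expanded as a product of geometric series and integrated term by
  term; |z_k| < R on the torus of radius R supplies the majorant.\<close>

lemma tcoef_has_sum:
  fixes g :: "('k::finite \<Rightarrow> complex) \<Rightarrow> complex"
  assumes R: "0 < R" and ks: "distinct ks" "set ks = UNIV" and g: "entire g"
    and z: "\<And>k. cmod (z k) < R"
  shows "((\<lambda>m. tcoef R ks g m * (\<Prod>k\<in>UNIV. z k ^ m k)) has_sum g z) UNIV"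
proof -
  obtain B where B: "0 \<le> B" "\<And>z. z \<in> torus R UNIV \<Longrightarrow> cmod (g z) \<le> B"
    using entire_bounded_torus[OF g] by blast
  have cont: "continuous_on (torus R UNIV) g"
    using g continuous_on_subset by (auto simp: entire_def)
  let ?f = "\<lambda>m t. (\<Prod>k\<in>UNIV. z k ^ m k) * (g t / (\<Prod>k\<in>UNIV. t k ^ (m k + 1)))"
  have "((\<lambda>m. cints R ks (?f m) (\<lambda>_. 0)) has_sum
      cints R ks (\<lambda>t. g t / (\<Prod>k\<in>set ks. t k - z k)) (\<lambda>_. 0)) UNIV"
  proof (rule cints_has_sum[OF R, of UNIV])
    show "continuous_on (torus R UNIV) (?f m)" for m
      by (intro continuous_intros continuous_on_torus_div_monomial R cont)
    show "cmod (?f m t) \<le> (\<Prod>k\<in>UNIV. (cmod (z k) / R) ^ m k) * (B / R ^ CARD('k))" 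
      if t: "t \<in> torus R UNIV" for m t
    proof -
      have "cmod (?f m t) = (\<Prod>k\<in>UNIV. cmod (z k) ^ m k) * (cmod (g t) / R ^ (mabs m + CARD('k)))"
        unfolding norm_mult norm_divide norm_torus_monomial[OF t] mabs_Suc
        by (simp add: prod_norm[symmetric] norm_power)
      also have "\<dots> \<le> (\<Prod>k\<in>UNIV. cmod (z k) ^ m k) * (B / R ^ (mabs m + CARD('k)))"
        using B t R by (intro mult_left_mono divide_right_mono prod_nonneg) auto
      also have "\<dots> = (\<Prod>k\<in>UNIV. (cmod (z k) / R) ^ m k) * (B / R ^ CARD('k))"
        by (simp add: power_divide prod_dividef mabs_def power_sum power_add)
      finally show ?thesis .
    qed
    show "(\<lambda>m. (\<Prod>k\<in>UNIV. (cmod (z k) / R) ^ m k) * (B / R ^ CARD('k))) summable_on UNIV"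
      using z R by (intro summable_on_cmult_left summable_geometric_product) auto
    show "((\<lambda>m. ?f m t) has_sum g t / (\<Prod>k\<in>set ks. t k - z k)) UNIV" if t: "t \<in> torus R UNIV" for t
    proof -
      have tR: "cmod (t k) = R" for k using t by (auto simp: torus_def)
      then have t0: "t k \<noteq> 0" for k using R by (metis norm_zero less_irrefl)
      have "((\<lambda>m. \<Prod>k\<in>UNIV. (z k / t k) ^ m k) has_sum (\<Prod>k\<in>UNIV. 1 / (1 - z k / t k))) UNIV"
        using z R by (intro has_sum_geometric_product) (simp add: norm_divide tR)
      then have "((\<lambda>m. (g t / (\<Prod>k\<in>UNIV. t k)) * (\<Prod>k\<in>UNIV. (z k / t k) ^ m k)) has_sum
        (g t / (\<Prod>k\<in>UNIV. t k)) * (\<Prod>k\<in>UNIV. 1 / (1 - z k / t k))) UNIV"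
        by (rule has_sum_cmult_right)
      moreover have "(g t / (\<Prod>k\<in>UNIV. t k)) * (\<Prod>k\<in>UNIV. (z k / t k) ^ m k) = ?f m t" for m
        by (simp add: power_divide prod_dividef prod.distrib)
      moreover have "(g t / (\<Prod>k\<in>UNIV. t k)) * (\<Prod>k\<in>UNIV. 1 / (1 - z k / t k)) = g t / (\<Prod>k\<in>set ks. t k - z k)"
      proof -
        have "(\<Prod>k\<in>UNIV. t k) * (\<Prod>k\<in>UNIV. (1 - z k / t k)) = (\<Prod>k\<in>UNIV. t k - z k)"
          unfolding prod.distrib[symmetric] using t0 by (intro prod.cong) (auto simp: field_simps)
        then show ?thesis by (simp only: prod_dividef ks prod.neutral_const times_divide_times_eq mult_1_right)
      qed
      ultimately show ?thesis by simp
    qed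
  qed (simp add: ks)
  moreover have "cints R ks (\<lambda>t. g t / (\<Prod>k\<in>set ks. t k - z k)) (\<lambda>_. 0) = (2 * pi * \<i>) ^ length ks * g z"
    using cints_Cauchy_kernel[OF R ks(1), of g z "\<lambda>_. 0"] g z by (simp add: ks entire_def)
  moreover have "cints R ks (?f m) (\<lambda>_. 0) = (\<Prod>k\<in>UNIV. z k ^ m k) *
      cints R ks (\<lambda>t. g t / (\<Prod>k\<in>UNIV. t k ^ (m k + 1))) (\<lambda>_. 0)" for m
    by (rule cints_cmult[OF R continuous_on_torus_div_monomial[OF R cont]]) (simp add: ks)
  ultimately have "((\<lambda>m. (1 / (2 * pi * \<i>)) ^ length ks * ((\<Prod>k\<in>UNIV. z k ^ m k) *
      cints R ks (\<lambda>t. g t / (\<Prod>k\<in>UNIV. t k ^ (m k + 1))) (\<lambda>_. 0))) has_sum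
     (1 / (2 * pi * \<i>)) ^ length ks * ((2 * pi * \<i>) ^ length ks * g z)) UNIV"
    by (intro has_sum_cmult_right) simp
  moreover have "(1 / (2 * pi * \<i>)) ^ length ks * ((2 * pi * \<i>) ^ length ks * g z) = g z"
    by (simp add: mult.assoc[symmetric] power_mult_distrib[symmetric])
  ultimately show ?thesis unfolding tcoef_def by (simp only: mult.commute mult.left_commute)
qed

text \<open>Multiplying the series by the inverse monomial leaves, by orthogonality, a single
  nonzero integral. Only values on one torus enter, which is what the comparison of radii and the
  later computations with monomials use.\<close>

lemma tcoef_power_series:
  fixes g :: "('k::finite \<Rightarrow> complex) \<Rightarrow> complex"
  assumes R: "0 < R" and ks: "distinct ks" "set ks = UNIV"
    and sum: "\<And>z. z \<in> torus R UNIV \<Longrightarrow> ((\<lambda>m. e m * (\<Prod>k\<in>UNIV. z k ^ m k)) has_sum g z) UNIV"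
    and e: "(\<lambda>m. cmod (e m) * R ^ mabs m) summable_on UNIV"
  shows "tcoef R ks g m = e m"
proof -
  let ?f = "\<lambda>m' z. e m' * (\<Prod>k\<in>UNIV. z k powi (int (m' k) - int (m k) - 1))"
  have f: "?f m' z = e m' * (\<Prod>k\<in>UNIV. z k ^ m' k) / (\<Prod>k\<in>UNIV. z k ^ (m k + 1))"
    if z: "z \<in> torus R UNIV" for m' z
  proof -
    have "z k \<noteq> 0" for k using z R by (auto simp: torus_def)
    then have "z k powi (int (m' k) - int (m k) - 1) = z k ^ m' k / z k ^ (m k + 1)" for k
      by (simp add: power_int_diff)
    then show ?thesis by (simp add: prod_dividef)
  qed
  have "((\<lambda>m'. cints R ks (?f m') (\<lambda>_. 0)) has_sum
      cints R ks (\<lambda>z. g z / (\<Prod>k\<in>UNIV. z k ^ (m k + 1))) (\<lambda>_. 0)) UNIV"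
  proof (rule cints_has_sum[OF R, of UNIV])
    show "continuous_on (torus R UNIV) (?f m')" for m'
      by (intro continuous_intros continuous_on_torus_monomial R) auto
    show "cmod (?f m' z) \<le> cmod (e m') * R ^ mabs m' * (1 / R ^ mabs (\<lambda>k. m k + 1))" if "z \<in> torus R UNIV" for m' z
      unfolding f[OF that] norm_mult norm_divide norm_torus_monomial[OF that] by simp
    show "((\<lambda>m'. ?f m' z) has_sum g z / (\<Prod>k\<in>UNIV. z k ^ (m k + 1))) UNIV" if "z \<in> torus R UNIV" for z
      unfolding f[OF that] by (rule has_sum_divide_const[OF sum[OF that]])
    show "(\<lambda>m'. cmod (e m') * R ^ mabs m' * (1 / R ^ mabs (\<lambda>k. m k + 1))) summable_on UNIV"
      by (rule summable_on_cmult_left[OF e])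
  qed (simp add: ks)
  moreover have "cints R ks (?f m') (\<lambda>_. 0) = (if m' = m then e m * (2 * pi * \<i>) ^ length ks else 0)" for m'
  proof -
    have "cints R ks (?f m') (\<lambda>_. 0) = e m' * cints R ks (\<lambda>z. \<Prod>k\<in>set ks. z k powi (int (m' k) - int (m k) - 1)) (\<lambda>_. 0)"
      by (subst cints_cmult[OF R, of UNIV]) (auto intro: continuous_on_torus_monomial R simp: ks)
    moreover have "(\<forall>k\<in>set ks. int (m' k) - int (m k) - 1 = -1) \<longleftrightarrow> m' = m"
      by (auto simp: ks fun_eq_iff)
    ultimately show ?thesis
      unfolding cints_monomial[OF R ks(1)] by simp
  qed
  ultimately have "((\<lambda>m'. if m' = m then e m * (2 * pi * \<i>) ^ length ks else 0) has_sum
      cints R ks (\<lambda>z. g z / (\<Prod>k\<in>UNIV. z k ^ (m k + 1))) (\<lambda>_. 0)) UNIV" by simp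
  moreover have "((\<lambda>m'. if m' = m then e m * (2 * pi * \<i>) ^ length ks else 0) has_sum e m * (2 * pi * \<i>) ^ length ks) UNIV"
    by (rule has_sum_finite_neutralI[of "{m}"]) auto
  ultimately have "cints R ks (\<lambda>z. g z / (\<Prod>k\<in>UNIV. z k ^ (m k + 1))) (\<lambda>_. 0) = e m * (2 * pi * \<i>) ^ length ks"
    using has_sum_unique by blast
  then show ?thesis
    by (simp add: tcoef_def mult.assoc[symmetric] power_divide)
qed

lemma tcoef_abs_summable:
  fixes g :: "('k::finite \<Rightarrow> complex) \<Rightarrow> complex"
  assumes R: "0 < R" and ks: "distinct ks" "set ks = UNIV" and g: "entire g" and q: "0 \<le> q" "q < R"
  shows "(\<lambda>m. cmod (tcoef R ks g m) * q ^ mabs m) summable_on UNIV"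
proof -
  obtain B where B: "0 \<le> B" "\<And>z. z \<in> torus R UNIV \<Longrightarrow> cmod (g z) \<le> B"
    using entire_bounded_torus[OF g] by blast
  have cont: "continuous_on (torus R UNIV) g"
    using g continuous_on_subset by (auto simp: entire_def)
  show ?thesis
  proof (rule summable_on_comparison_test)
    show "(\<lambda>m::'k \<Rightarrow> nat. B * (q / R) ^ mabs m) summable_on UNIV"
      using q R by (intro summable_on_cmult_right summable_power_mabs) auto
    show "cmod (tcoef R ks g m) * q ^ mabs m \<le> B * (q / R) ^ mabs m" for m
      using mult_right_mono[OF norm_tcoef_le[OF R ks cont B, of m], of "q ^ mabs m"] q
      by (simp add: power_divide)
  qed (use q in auto)
qed

text \<open>Both radii are compared with some \<open>q\<close> below them: the Taylor series
  computed at a larger radius converges absolutely on the torus of radius \<open>q\<close>, so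
  uniqueness there applies. Hence coefficients can be defined at radius 1 and estimated at any
  radius.\<close>

lemma tcoef_radius:
  fixes g :: "('k::finite \<Rightarrow> complex) \<Rightarrow> complex"
  assumes "0 < R" "0 < R'" and ks: "distinct ks" "set ks = UNIV" and g: "entire g"
  shows "tcoef R ks g = tcoef R' ks g"
proof
  fix m
  define q where "q = min R R' / 2"
  have q: "0 < q" "q < R" "q < R'" using assms by (auto simp: q_def)
  have "tcoef q ks g m = tcoef S ks g m" if S: "q < S" for S
  proof (rule tcoef_power_series[OF q(1) ks])
    show "((\<lambda>m. tcoef S ks g m * (\<Prod>k\<in>UNIV. z k ^ m k)) has_sum g z) UNIV" if "z \<in> torus q UNIV" for z
      using that q S by (intro tcoef_has_sum ks g) (auto simp: torus_def)
    show "(\<lambda>m. cmod (tcoef S ks g m) * q ^ mabs m) summable_on UNIV"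
      using q S by (intro tcoef_abs_summable ks g) auto
  qed
  with q show "tcoef R ks g m = tcoef R' ks g m" by metis
qed

section \<open>Holomorphic functions on the quotient\<close>

lemma cscale_sel [simp]:
  "fst (fst (cscale c v)) = c * fst (fst v)" "snd (fst (cscale c v)) $ i = c * snd (fst v) $ i"
  "fst (snd (cscale c v)) = c * fst (snd v)" "snd (snd (cscale c v)) $ i = c * snd (snd v) $ i"
  by (simp_all add: cscale_def case_prod_unfold)

text \<open>Through this decomposition a real-linear map commuting with multiplication by i is seen
  to be complex linear.\<close>

lemma cscale_eq: "cscale c v = Re c *\<^sub>R v + Im c *\<^sub>R cscale \<i> v"
  by (simp add: prod_eq_iff vec_eq_iff complex_eq_iff algebra_simps)

lemma holo_amb_const: "holo_amb (\<lambda>_. c) UNIV"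
  by (auto simp: holo_amb_def intro!: exI[of _ "\<lambda>_. 0"] derivative_intros)

lemma holo_amb_linear:
  assumes "bounded_linear G" "\<And>v. G (cscale \<i> v) = \<i> * G v"
  shows "holo_amb G UNIV"
  using assms bounded_linear_imp_has_derivative unfolding holo_amb_def by blast

lemma holo_amb_add:
  assumes "holo_amb G U" "holo_amb H V"
  shows "holo_amb (\<lambda>x. G x + H x) (U \<inter> V)"
  unfolding holo_amb_def
proof (intro conjI ballI)
  fix z assume z: "z \<in> U \<inter> V"
  from z assms obtain L M where "(G has_derivative L) (at z)" "(H has_derivative M) (at z)"
    "\<And>v. L (cscale \<i> v) = \<i> * L v" "\<And>v. M (cscale \<i> v) = \<i> * M v"
    unfolding holo_amb_def by blast
  then show "\<exists>L. ((\<lambda>x. G x + H x) has_derivative L) (at z) \<and> (\<forall>v. L (cscale \<i> v) = \<i> * L v)"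
    by (intro exI[of _ "\<lambda>h. L h + M h"] conjI has_derivative_add) (auto simp: algebra_simps)
qed (use assms in \<open>auto simp: holo_amb_def\<close>)

lemma holo_amb_mult:
  assumes "holo_amb G U" "holo_amb H V"
  shows "holo_amb (\<lambda>x. G x * H x) (U \<inter> V)"
  unfolding holo_amb_def
proof (intro conjI ballI)
  fix z assume z: "z \<in> U \<inter> V"
  from z assms obtain L M where "(G has_derivative L) (at z)" "(H has_derivative M) (at z)"
    "\<And>v. L (cscale \<i> v) = \<i> * L v" "\<And>v. M (cscale \<i> v) = \<i> * M v"
    unfolding holo_amb_def by blast
  then show "\<exists>L. ((\<lambda>x. G x * H x) has_derivative L) (at z) \<and> (\<forall>v. L (cscale \<i> v) = \<i> * L v)"
    by (intro exI[of _ "\<lambda>h. G z * M h + L h * H z"] conjI has_derivative_mult) (auto simp: algebra_simps)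
qed (use assms in \<open>auto simp: holo_amb_def\<close>)

text \<open>The local clause of \<open>Ohat\<close> without invariance, so that the coordinates,
  which are not invariant under the action, can serve as building blocks.\<close>

definition lhol :: "(('n::finite) hpt \<Rightarrow> complex) \<Rightarrow> bool" where
  "lhol F \<longleftrightarrow> (\<forall>x\<in>Zhat. \<exists>U G. x \<in> U \<and> holo_amb G U \<and> (\<forall>y\<in>U \<inter> Zhat. F y = G y))"

lemma Ohat_iff: "F \<in> Ohat \<longleftrightarrow> (\<forall>x\<in>Zhat. \<forall>z. z \<noteq> 0 \<longrightarrow> F (act z x) = F x) \<and> lhol F"
  by (simp add: Ohat_def lhol_def)

lemma lholI: "holo_amb F UNIV \<Longrightarrow> lhol F"
  by (auto simp: lhol_def)

lemma lhol_const: "lhol (\<lambda>_. c)"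
  by (rule lholI[OF holo_amb_const])

lemma lhol_coordinates:
  "lhol (\<lambda>X. fst (fst X))" "lhol (\<lambda>X. snd (fst X) $ i)" "lhol (\<lambda>X. fst (snd X))" "lhol (\<lambda>X. snd (snd X) $ i)"
  by (auto intro!: lholI holo_amb_linear bounded_linear_intros
      bounded_linear_compose[OF bounded_linear_vec_nth])

lemma lhol_add: assumes "lhol F" "lhol G" shows "lhol (\<lambda>X. F X + G X)"
  unfolding lhol_def
proof
  fix x :: "'a hpt" assume x: "x \<in> Zhat"
  from x assms obtain U F' V G' where *: "x \<in> U" "holo_amb F' U" "\<forall>y\<in>U \<inter> Zhat. F y = F' y"
    "x \<in> V" "holo_amb G' V" "\<forall>y\<in>V \<inter> Zhat. G y = G' y"
    unfolding lhol_def by meson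
  then show "\<exists>U H. x \<in> U \<and> holo_amb H U \<and> (\<forall>y\<in>U \<inter> Zhat. F y + G y = H y)"
    by (intro exI[of _ "U \<inter> V"] exI[of _ "\<lambda>x. F' x + G' x"]) (auto intro: holo_amb_add)
qed

lemma lhol_mult: assumes "lhol F" "lhol G" shows "lhol (\<lambda>X. F X * G X)"
  unfolding lhol_def
proof
  fix x :: "'a hpt" assume x: "x \<in> Zhat"
  from x assms obtain U F' V G' where *: "x \<in> U" "holo_amb F' U" "\<forall>y\<in>U \<inter> Zhat. F y = F' y"
    "x \<in> V" "holo_amb G' V" "\<forall>y\<in>V \<inter> Zhat. G y = G' y"
    unfolding lhol_def by meson
  then show "\<exists>U H. x \<in> U \<and> holo_amb H U \<and> (\<forall>y\<in>U \<inter> Zhat. F y * G y = H y)"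
    by (intro exI[of _ "U \<inter> V"] exI[of _ "\<lambda>x. F' x * G' x"]) (auto intro: holo_amb_mult)
qed

lemma lhol_power: "lhol F \<Longrightarrow> lhol (\<lambda>X. F X ^ k)"
  by (induction k) (auto intro: lhol_const lhol_mult)

lemma lhol_prod: "finite I \<Longrightarrow> (\<And>i. i \<in> I \<Longrightarrow> lhol (F i)) \<Longrightarrow> lhol (\<lambda>X. \<Prod>i\<in>I. F i X)"
  by (induction I rule: finite_induct) (auto intro: lhol_const lhol_mult)

lemma lhol_continuous_on:
  assumes "lhol F" shows "continuous_on Zhat F"
  unfolding continuous_on_def
proof
  fix x :: "'a hpt" assume x: "x \<in> Zhat"
  from x assms obtain U G where U: "x \<in> U" "holo_amb G U" "\<forall>y\<in>U \<inter> Zhat. F y = G y"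
    unfolding lhol_def by meson
  then have "isCont G x" unfolding holo_amb_def using has_derivative_continuous by blast
  then have "(G \<longlongrightarrow> G x) (at x within Zhat)"
    using isCont_def tendsto_within_subset by blast
  moreover have "\<forall>\<^sub>F y in at x within Zhat. G y = F y"
    using U by (auto simp: holo_amb_def eventually_at_topological)
  ultimately show "(F \<longlongrightarrow> F x) (at x within Zhat)"
    using U x by (auto intro: Lim_transform_eventually)
qed

lemma has_derivative_vec_lambda_components:
  fixes f :: "complex \<Rightarrow> complex^'n::finite"
  assumes "\<And>i. ((\<lambda>t. f t $ i) has_field_derivative d $ i) (at t)"
  shows "(f has_derivative (\<lambda>h. h *s d)) (at t)"
proof -
  have "((\<lambda>t. f t \<bullet> b) has_derivative (\<lambda>h. (h *s d) \<bullet> b)) (at t)" if "b \<in> Basis" for b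
  proof -
    from that obtain i c where b: "b = axis i c" by (auto simp: Basis_vec_def)
    have "((\<lambda>t. f t $ i \<bullet> c) has_derivative (\<lambda>h. (d $ i * h) \<bullet> c)) (at t)"
      by (rule has_derivative_inner_left[OF assms[unfolded has_field_derivative_def]])
    then show ?thesis by (simp add: b inner_axis mult.commute)
  qed
  then show ?thesis by (subst has_derivative_componentwise_within) auto
qed

text \<open>The bridge from real derivatives in the ambient space to one complex variable: by the
  chain rule the derivative along the curve is \<open>L (cscale h D)\<close>, and complex linearity
  of \<open>L\<close> turns it into multiplication of \<open>h\<close> by the number
  \<open>L D\<close>.\<close>

lemma lhol_holomorphic_curve:
  fixes \<gamma> :: "complex \<Rightarrow> ('n::finite) hpt"
  assumes F: "lhol F" and S: "open S" and Z: "\<And>t. t \<in> S \<Longrightarrow> \<gamma> t \<in> Zhat"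
    and hol: "(\<lambda>t. fst (fst (\<gamma> t))) holomorphic_on S" "\<And>i. (\<lambda>t. snd (fst (\<gamma> t)) $ i) holomorphic_on S"
      "(\<lambda>t. fst (snd (\<gamma> t))) holomorphic_on S" "\<And>i. (\<lambda>t. snd (snd (\<gamma> t)) $ i) holomorphic_on S"
  shows "(\<lambda>t. F (\<gamma> t)) holomorphic_on S"
  unfolding holomorphic_on_def
proof
  fix t assume t: "t \<in> S"
  from Z[OF t] F obtain U G where U: "\<gamma> t \<in> U" "holo_amb G U" "\<forall>y\<in>U \<inter> Zhat. F y = G y"
    unfolding lhol_def by meson
  from U obtain L where L: "(G has_derivative L) (at (\<gamma> t))" "\<And>v. L (cscale \<i> v) = \<i> * L v"
    unfolding holo_amb_def by blast
  let ?a = "deriv (\<lambda>t. fst (fst (\<gamma> t))) t" and ?b = "\<chi> i. deriv (\<lambda>t. snd (fst (\<gamma> t)) $ i) t"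
  let ?c = "deriv (\<lambda>t. fst (snd (\<gamma> t))) t" and ?d = "\<chi> i. deriv (\<lambda>t. snd (snd (\<gamma> t)) $ i) t"
  define D where "D = ((?a, ?b), (?c, ?d))"
  have 1: "((\<lambda>t. fst (fst (\<gamma> t))) has_derivative (\<lambda>h. h * ?a)) (at t)"
    using holomorphic_derivI[OF hol(1) S t] by (simp add: has_field_derivative_def mult_commute_abs)
  have 3: "((\<lambda>t. fst (snd (\<gamma> t))) has_derivative (\<lambda>h. h * ?c)) (at t)"
    using holomorphic_derivI[OF hol(3) S t] by (simp add: has_field_derivative_def mult_commute_abs)
  have 2: "((\<lambda>t. snd (fst (\<gamma> t))) has_derivative (\<lambda>h. h *s ?b)) (at t)"
    using holomorphic_derivI[OF hol(2) S t] by (intro has_derivative_vec_lambda_components) simp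
  have 4: "((\<lambda>t. snd (snd (\<gamma> t))) has_derivative (\<lambda>h. h *s ?d)) (at t)"
    using holomorphic_derivI[OF hol(4) S t] by (intro has_derivative_vec_lambda_components) simp
  have "(\<gamma> has_derivative (\<lambda>h. cscale h D)) (at t)"
    using has_derivative_Pair[OF has_derivative_Pair[OF 1 2] has_derivative_Pair[OF 3 4]]
    by (simp add: D_def cscale_def)
  note \<gamma> = this
  have "((\<lambda>s. G (\<gamma> s)) has_derivative (\<lambda>h. L (cscale h D))) (at t)"
    by (rule has_derivative_compose[OF \<gamma> L(1)])
  moreover have "L (cscale h D) = L D * h" for h
  proof -
    interpret bounded_linear L using L(1) by (rule has_derivative_bounded_linear)
    have "L (cscale h D) = Re h *\<^sub>R L D + Im h *\<^sub>R (\<i> * L D)"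
      by (subst cscale_eq) (simp add: add scaleR L)
    then show ?thesis by (simp add: complex_eq_iff scaleR_conv_of_real algebra_simps)
  qed
  ultimately have "((\<lambda>s. G (\<gamma> s)) has_field_derivative L D) (at t)"
    by (simp add: has_field_derivative_def)
  then have G: "(\<lambda>s. G (\<gamma> s)) field_differentiable at t within S"
    using field_differentiable_def field_differentiable_at_within by blast
  have "isCont \<gamma> t" using \<gamma> has_derivative_continuous by blast
  \<comment> \<open>\<open>F\<close> agrees with the ambient function \<open>G\<close> only on the
    part of \<open>Zhat\<close> inside \<open>U\<close>: continuity of the curve keeps it in
    \<open>U\<close> near \<open>t\<close>, and hypothesis \<open>Z\<close> keeps it on
    \<open>Zhat\<close>.\<close>
  then obtain e where e: "0 < e" "\<And>s. dist s t < e \<Longrightarrow> \<gamma> s \<in> U"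
    using U(1,2) unfolding holo_amb_def continuous_at_open
    by (metis open_contains_ball dist_commute mem_ball subsetD)
  show "(\<lambda>t. F (\<gamma> t)) field_differentiable at t within S"
    by (rule field_differentiable_transform_within[OF e(1) t _ G]) (use U(3) e(2) Z in auto)
qed

section \<open>Charts of the quotient and density of the standard chart\<close>

lemma dotp_scale [simp]: "dotp (c *s x) y = c * dotp x y" "dotp x (c *s y) = c * dotp x y"
  by (simp_all add: dotp_def sum_distrib_left mult_ac)

lemma Zhat_iff: "((p0, p), (q0, q)) \<in> Zhat \<longleftrightarrow> p0 * q0 = 1 + dotp p q"
  by (auto simp: Zhat_def algebra_simps)

lemma act_apply [simp]: "act z ((p0, p), (q0, q)) = ((z * p0, z *s p), (q0 / z, (1 / z) *s q))"
  by (simp add: act_def)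

lemma std_inv_in_Zhat: "dotp x y \<noteq> 1 \<Longrightarrow> std_inv x y \<in> Zhat"
  by (simp add: std_inv_def Zhat_iff field_simps)

definition chart_sy :: "complex^'n::finite \<Rightarrow> complex^'n \<Rightarrow> 'n hpt" where
  "chart_sy s y = ((1 + dotp s y, s), (1, y))"

definition chart_xt :: "complex^'n::finite \<Rightarrow> complex^'n \<Rightarrow> 'n hpt" where
  "chart_xt x t = ((1, x), (1 + dotp x t, t))"

lemma chart_in_Zhat: "chart_sy s y \<in> Zhat" "chart_xt x t \<in> Zhat"
  by (simp_all add: chart_sy_def chart_xt_def Zhat_iff)

lemma Ohat_act: "F \<in> Ohat \<Longrightarrow> X \<in> Zhat \<Longrightarrow> z \<noteq> 0 \<Longrightarrow> F (act z X) = F X"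
  by (simp add: Ohat_iff)

lemma Ohat_chart_sy:
  assumes "F \<in> Ohat" "dotp x y \<noteq> 1"
  shows "F (chart_sy ((1 / (1 - dotp x y)) *s x) y) = F (std_inv x y)"
proof -
  have "act (1 / (1 - dotp x y)) (std_inv x y) = chart_sy ((1 / (1 - dotp x y)) *s x) y"
    using assms(2) by (simp add: std_inv_def chart_sy_def field_simps)
  then show ?thesis using Ohat_act[OF assms(1) std_inv_in_Zhat[OF assms(2)]] assms(2)
    by (metis divide_eq_0_iff eq_iff_diff_eq_0 one_neq_zero)
qed

text \<open>Both representatives are normalised by p0 = 1, so they are equal as points of
  \<open>Zhat\<close>; for the (s, y) chart they agree only up to the action.\<close>

lemma chart_xt_std_inv:
  assumes "dotp x y \<noteq> 1"
  shows "chart_xt x ((1 / (1 - dotp x y)) *s y) = std_inv x y"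
  using assms by (simp add: std_inv_def chart_xt_def field_simps)

text \<open>Acting with 1/p0 moves the point to the standard section, where 1 - x.y = 1/(p0
  q0).\<close>

lemma Ohat_std:
  assumes F: "F \<in> Ohat" and Z: "((p0, p), (q0, q)) \<in> Zhat" and nz: "p0 \<noteq> 0" "q0 \<noteq> 0"
  shows "dotp ((1 / p0) *s p) ((1 / q0) *s q) \<noteq> 1"
    and "F ((p0, p), (q0, q)) = F (std_inv ((1 / p0) *s p) ((1 / q0) *s q))"
proof -
  have d: "dotp p q = p0 * q0 - 1" using Z by (simp add: Zhat_iff)
  have e: "1 - dotp ((1 / p0) *s p) ((1 / q0) *s q) = 1 / (p0 * q0)"
    using nz by (simp add: d field_simps)
  then show "dotp ((1 / p0) *s p) ((1 / q0) *s q) \<noteq> 1" using nz by auto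
  have "act (1 / p0) ((p0, p), (q0, q)) = std_inv ((1 / p0) *s p) ((1 / q0) *s q)"
    unfolding std_inv_def e using nz by (simp add: field_simps)
  then show "F ((p0, p), (q0, q)) = F (std_inv ((1 / p0) *s p) ((1 / q0) *s q))"
    using Ohat_act[OF F Z, of "1 / p0"] nz by simp
qed

lemma closed_Zhat: "closed (Zhat :: ('n::finite) hpt set)"
proof -
  have "Zhat = {X :: 'n hpt. - fst (fst X) * fst (snd X) + (\<Sum>i\<in>UNIV. snd (fst X) $ i * snd (snd X) $ i) = -1}"
    by (auto simp: Zhat_def dotp_def)
  also have "closed \<dots>"
    by (intro closed_Collect_eq continuous_intros)
  finally show ?thesis .
qed

lemma Zhat_std_dense:
  fixes X :: "('n::finite) hpt"
  assumes "X \<in> Zhat"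
  shows "X \<in> closure {Y \<in> Zhat. fst (fst Y) \<noteq> 0 \<and> fst (snd Y) \<noteq> 0}" (is "_ \<in> closure ?S")
proof -
  obtain p0 p q0 q where X: "X = ((p0, p), (q0, q))" by (metis surj_pair)
  show ?thesis
  proof (cases "p0 * q0 = 0")
    case False
    then show ?thesis using assms X closure_subset by fastforce
  next
    case True
    then have pq: "dotp p q = -1" using assms unfolding X Zhat_iff by (metis add_eq_0_iff)
    \<comment> \<open>Both zeroth coordinates are shifted by \<open>e\<close>. Since p.q = -1 here,
      scaling \<open>q\<close> by 1 - (p0 + e)(q0 + e) restores the equation of \<open>Zhat\<close>,
      and this factor is 1 at e = 0 because p0 q0 = 0.\<close>
    let ?\<gamma> = "\<lambda>e. ((p0 + e, p), (q0 + e, \<chi> i. (1 - (p0 + e) * (q0 + e)) * q $ i))"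
    have "(?\<gamma> \<longlongrightarrow> ((p0 + 0, p), (q0 + 0, \<chi> i. (1 - (p0 + 0) * (q0 + 0)) * q $ i))) (at 0)"
      by (intro tendsto_Pair tendsto_vec_lambda tendsto_mult tendsto_diff tendsto_add tendsto_const tendsto_ident_at)
    moreover have "((p0 + 0, p), (q0 + 0, \<chi> i. (1 - (p0 + 0) * (q0 + 0)) * q $ i)) = X"
      using True by (auto simp: X vec_eq_iff)
    ultimately have lim: "(?\<gamma> \<longlongrightarrow> X) (at 0)" by simp
    have "\<forall>\<^sub>F e in at 0. ?\<gamma> e \<in> ?S"
      using eventually_neq_at_within[of "-p0" 0 UNIV] eventually_neq_at_within[of "-q0" 0 UNIV]
    proof eventually_elim
      case (elim e)
      have "(\<chi> i. c * q $ i) = c *s q" for c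
        by (simp add: vec_eq_iff)
      then have "?\<gamma> e \<in> Zhat"
        unfolding Zhat_iff by (simp only: dotp_scale pq) simp
      then show ?case using elim by (auto simp: add_eq_0_iff2 add_eq_0_iff)
    qed
    then have "\<forall>\<^sub>F e in at 0. ?\<gamma> e \<in> closure ?S"
      by (rule eventually_mono) (rule subsetD[OF closure_subset])
    then show ?thesis
      by (rule Lim_in_closed_set[OF closed_closure _ at_neq_bot lim])
  qed
qed

lemma Zhat_eqI:
  fixes F G :: "('n::finite) hpt \<Rightarrow> complex"
  assumes "continuous_on Zhat F" "continuous_on Zhat G" "X \<in> Zhat"
    and eq: "\<And>p0 p q0 q. ((p0, p), (q0, q)) \<in> Zhat \<Longrightarrow> p0 \<noteq> 0 \<Longrightarrow> q0 \<noteq> 0 \<Longrightarrow> F ((p0, p), (q0, q)) = G ((p0, p), (q0, q))"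
  shows "F X = G X"
proof -
  let ?S = "{Y \<in> Zhat. fst (fst Y) \<noteq> 0 \<and> fst (snd Y) \<noteq> 0} :: 'n hpt set"
  have "closure ?S \<subseteq> Zhat" by (rule closure_minimal) (auto simp: closed_Zhat)
  then have "continuous_on (closure ?S) (\<lambda>Y. F Y - G Y)"
    by (intro continuous_intros continuous_on_subset[OF assms(1)] continuous_on_subset[OF assms(2)])
  then have "F X - G X = 0"
    by (rule continuous_constant_on_closure[OF _ _ Zhat_std_dense[OF assms(3)]]) (auto intro: eq)
  then show ?thesis by simp
qed

section \<open>Uniqueness of the holomorphic extension from the ball\<close>

lemma dotp_vconj: "dotp w (vconj w) = complex_of_real (wnorm2 w)"
  by (simp add: dotp_def vconj_def wnorm2_def complex_norm_square[symmetric])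

lemma Dn_dotp: "w \<in> Dn \<Longrightarrow> dotp w (vconj w) \<noteq> 1"
  by (simp add: dotp_vconj Dn_def)

lemma DeltaD_act:
  fixes w :: "complex^'n::finite"
  assumes w: "w \<in> Dn"
  shows "DeltaD w = act (complex_of_real (1 / sqrt (1 - wnorm2 w))) (std_inv w (vconj w))"
proof -
  define s where "s = complex_of_real (1 / sqrt (1 - wnorm2 w))"
  have pos: "0 < 1 - wnorm2 w" using w by (simp add: Dn_def)
  then have "s * s = complex_of_real (1 / (1 - wnorm2 w))"
    unfolding s_def of_real_mult[symmetric] by (simp add: real_sqrt_mult[symmetric])
  then have s: "1 / (1 - dotp w (vconj w)) = s * s" "s \<noteq> 0"
    using pos by (auto simp: dotp_vconj)
  have "cnj s = s" by (simp add: s_def)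
  then have "DeltaD w = ((s, s *s w), (s, s *s vconj w))"
    unfolding DeltaD_def rep_def Let_def s_def[symmetric] by (simp add: vconj_def vec_eq_iff)
  then show ?thesis
    unfolding s_def[symmetric] std_inv_def s(1) using s(2) by (simp add: vec_eq_iff)
qed

lemma Ohat_DeltaD: "F \<in> Ohat \<Longrightarrow> w \<in> Dn \<Longrightarrow> F (DeltaD w) = F (std_inv w (vconj w))"
  unfolding DeltaD_act using Dn_dotp[of w]
  by (intro Ohat_act std_inv_in_Zhat) (auto simp: Dn_def)

lemma dotp_bound:
  fixes x y :: "complex^'n::finite" and \<epsilon> :: real
  assumes "\<And>i. cmod (x $ i) \<le> \<epsilon>" "\<And>i. cmod (y $ i) \<le> \<epsilon>"
  shows "cmod (dotp x y) \<le> CARD('n) * \<epsilon>\<^sup>2"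
proof -
  have "0 \<le> \<epsilon>" using assms(1) norm_ge_zero order_trans by blast
  then have "cmod (dotp x y) \<le> (\<Sum>i\<in>(UNIV::'n set). \<epsilon> * \<epsilon>)"
    unfolding dotp_def by (intro sum_norm_le) (auto simp: norm_mult intro!: mult_mono assms)
  then show ?thesis by (simp add: power2_eq_square)
qed

text \<open>The points \<open>(x, y)\<close> with \<open>y = cnj x\<close> form a totally real subspace: the complex line
  \<open>z \<mapsto> (a + z b, cnj a + z cnj b)\<close> lies in it for real \<open>z\<close>, and its value at \<open>z = \<i>\<close> is arbitrary.\<close>

lemma Ohat_zero_near_origin:
  fixes F :: "('n::finite) hpt \<Rightarrow> complex" and x y :: "complex^'n"
  assumes F: "F \<in> Ohat" and zero: "\<And>w. w \<in> Dn \<Longrightarrow> F (DeltaD w) = 0"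
    and x: "\<And>i. cmod (x $ i) \<le> 1 / (4 * CARD('n))" and y: "\<And>i. cmod (y $ i) \<le> 1 / (4 * CARD('n))"
  shows "F (std_inv x y) = 0"
proof -
  let ?N = "real CARD('n)"
  \<comment> \<open>For |z| < 2, a disc containing i, the points on the line have coordinates of
    modulus at most 3 \<open>\<epsilon>\<close>. With this \<open>\<epsilon>\<close>, |x.y| is then
    at most 9/(16 N) < 1, so the line stays inside the standard chart.\<close>
  define \<epsilon> where "\<epsilon> = 1 / (4 * ?N)"
  have N: "?N \<ge> 1" by (simp add: Suc_leI)
  have N\<epsilon>: "?N * (3 * \<epsilon>)\<^sup>2 < 1"
  proof -
    have "?N * (3 * \<epsilon>)\<^sup>2 = 9 / (16 * ?N)" using N by (simp add: \<epsilon>_def power2_eq_square field_simps)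
    also have "\<dots> < 1" using N by (subst divide_less_eq_1_pos) linarith+
    finally show ?thesis .
  qed
  \<comment> \<open>The solution of a + i b = x and cnj a + i cnj b = y, so that the line passes
    through (x, y) at z = i.\<close>
  define a b where "a = (\<chi> i. (x $ i + cnj (y $ i)) / 2)" and "b = (\<chi> i. (x $ i - cnj (y $ i)) / (2 * \<i>))"
  define X Y where "X z = (\<chi> i. a $ i + z * b $ i)" and "Y z = (\<chi> i. cnj (a $ i) + z * cnj (b $ i))" for z
  have ab: "cmod (a $ i) \<le> \<epsilon>" "cmod (b $ i) \<le> \<epsilon>" for i
    using norm_triangle_ineq[of "x $ i" "cnj (y $ i)"] norm_triangle_ineq4[of "x $ i" "cnj (y $ i)"] x[of i] y[of i]
    by (simp_all add: a_def b_def norm_divide norm_mult \<epsilon>_def)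
  have zab: "cmod z * cmod (b $ i) \<le> 2 * \<epsilon>" if "cmod z < 2" for z i
    using that ab(2)[of i] by (intro mult_mono) auto
  have XY: "cmod (X z $ i) \<le> 3 * \<epsilon>" "cmod (Y z $ i) \<le> 3 * \<epsilon>" if "cmod z < 2" for z i
    using norm_triangle_ineq[of "a $ i" "z * b $ i"] norm_triangle_ineq[of "cnj (a $ i)" "z * cnj (b $ i)"]
      zab[OF that, of i] ab(1)[of i]
    by (simp_all add: X_def Y_def norm_mult)
  have dot: "cmod (dotp (X z) (Y z)) < 1" if "cmod z < 2" for z
    using dotp_bound[of "X z" "3 * \<epsilon>" "Y z"] XY[OF that] N\<epsilon> by fastforce
  then have dot': "dotp (X z) (Y z) \<noteq> 1" if "cmod z < 2" for z using that by fastforce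
  let ?f = "\<lambda>z. F (std_inv (X z) (Y z))"
  have "?f \<i> = 0"
  proof (rule analytic_continuation[of ?f "ball 0 2" "{z. z \<in> \<real> \<and> cmod z < 2}" 0])
    have hd: "(\<lambda>z. dotp (X z) (Y z)) holomorphic_on ball 0 2"
      unfolding dotp_def X_def Y_def by (auto intro!: holomorphic_intros)
    have d0: "1 - dotp (X z) (Y z) \<noteq> 0" if "z \<in> ball 0 2" for z using dot'[of z] that by auto
    show "?f holomorphic_on ball 0 2"
    proof (rule lhol_holomorphic_curve)
      show "lhol F" using F by (simp add: Ohat_iff)
      show "std_inv (X z) (Y z) \<in> Zhat" if "z \<in> ball 0 2" for z
        using that dot'[of z] by (intro std_inv_in_Zhat) auto
      have hX: "(\<lambda>z. X z $ i) holomorphic_on ball 0 2" "(\<lambda>z. Y z $ i) holomorphic_on ball 0 2" for i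
        unfolding X_def Y_def by (auto intro!: holomorphic_intros)
      show "(\<lambda>z. fst (fst (std_inv (X z) (Y z)))) holomorphic_on ball 0 2" by (simp add: std_inv_def)
      show "(\<lambda>z. snd (fst (std_inv (X z) (Y z))) $ i) holomorphic_on ball 0 2" for i
        by (simp add: std_inv_def hX)
      show "(\<lambda>z. fst (snd (std_inv (X z) (Y z)))) holomorphic_on ball 0 2"
        unfolding std_inv_def fst_conv snd_conv by (intro holomorphic_intros hd d0)
      show "(\<lambda>z. snd (snd (std_inv (X z) (Y z))) $ i) holomorphic_on ball 0 2" for i
        unfolding std_inv_def fst_conv snd_conv vector_smult_component
        by (intro holomorphic_intros hd d0 hX)
    qed simp
    show "(0::complex) islimpt {z. z \<in> \<real> \<and> cmod z < 2}"
      unfolding islimpt_approachable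
    proof safe
      fix e :: real assume "0 < e"
      then show "\<exists>x'\<in>{z. z \<in> \<real> \<and> cmod z < 2}. x' \<noteq> 0 \<and> dist x' 0 < e"
        by (intro bexI[of _ "of_real (min e 1 / 2)"]) auto
    qed
    fix z :: complex assume z: "z \<in> {z. z \<in> \<real> \<and> cmod z < 2}"
    then have "cnj z = z" by (simp add: Reals_cnj_iff)
    then have "Y z = vconj (X z)" by (simp add: X_def Y_def vconj_def)
    moreover from this have "X z \<in> Dn"
      using dot[of z] z by (simp add: dotp_vconj Dn_def)
    ultimately show "?f z = 0"
      using zero[of "X z"] Ohat_DeltaD[OF F, of "X z"] by simp
  qed auto
  moreover have "X \<i> = x" "Y \<i> = y"
    by (simp_all add: X_def Y_def a_def b_def vec_eq_iff field_simps)
  ultimately show ?thesis by simp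
qed

text \<open>Shrinking (s, y) to (z s, z y) brings the point close to the origin of the standard
  chart, where vanishing is known. The function is entire in z, so it also vanishes at z =
  1.\<close>

lemma Ohat_zero_chart_sy:
  fixes F :: "('n::finite) hpt \<Rightarrow> complex"
  assumes F: "F \<in> Ohat" and zero: "\<And>w. w \<in> Dn \<Longrightarrow> F (DeltaD w) = 0"
  shows "F (chart_sy s y) = 0"
proof -
  let ?\<epsilon> = "1 / (4 * real CARD('n))"
  \<comment> \<open>The coordinate p0 of the shrunk point; its standard coordinates are (z / d) s
    and z y.\<close>
  let ?d = "\<lambda>z. 1 + z * z * dotp s y"
  let ?f = "\<lambda>z. F (chart_sy (z *s s) (z *s y))"
  have "\<forall>\<^sub>F z in at 0. ?d z \<noteq> 0 \<and> (\<forall>i. cmod (z / ?d z * s $ i) < ?\<epsilon> \<and> cmod (z * y $ i) < ?\<epsilon>)"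
  proof (intro eventually_conj eventually_all_finite)
    have d: "(?d \<longlongrightarrow> 1 + 0 * 0 * dotp s y) (at 0)" by (intro tendsto_intros)
    then show "\<forall>\<^sub>F z in at 0. ?d z \<noteq> 0"
      by (rule tendsto_imp_eventually_ne) simp
    have \<epsilon>: "0 < ?\<epsilon>" by simp
    show "\<forall>\<^sub>F z in at 0. cmod (z / ?d z * s $ i) < ?\<epsilon>" for i
    proof (rule order_tendstoD(2)[OF _ \<epsilon>])
      have "((\<lambda>z. cmod (z / ?d z * s $ i)) \<longlongrightarrow> cmod (0 / (1 + 0 * 0 * dotp s y) * s $ i)) (at 0)"
        by (intro tendsto_intros) auto
      then show "((\<lambda>z. cmod (z / ?d z * s $ i)) \<longlongrightarrow> 0) (at 0)" by simp
    qed
    show "\<forall>\<^sub>F z in at 0. cmod (z * y $ i) < ?\<epsilon>" for i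
    proof (rule order_tendstoD(2)[OF _ \<epsilon>])
      have "((\<lambda>z. cmod (z * y $ i)) \<longlongrightarrow> cmod (0 * y $ i)) (at 0)"
        by (intro tendsto_intros)
      then show "((\<lambda>z. cmod (z * y $ i)) \<longlongrightarrow> 0) (at 0)" by simp
    qed
  qed
  then obtain \<delta> where \<delta>: "0 < \<delta>" "\<And>z::complex. z \<noteq> 0 \<Longrightarrow> dist z 0 < \<delta> \<Longrightarrow> ?d z \<noteq> 0"
    "\<And>(z::complex) i. z \<noteq> 0 \<Longrightarrow> dist z 0 < \<delta> \<Longrightarrow> cmod (z / ?d z * s $ i) < ?\<epsilon> \<and> cmod (z * y $ i) < ?\<epsilon>"
    unfolding eventually_at by blast
  have "?f 1 = 0"
  proof (rule analytic_continuation[of ?f UNIV "ball 0 \<delta> - {0}" 0])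
    show "?f holomorphic_on UNIV"
    proof (rule lhol_holomorphic_curve)
      show "lhol F" using F by (simp add: Ohat_iff)
      show "(\<lambda>z. fst (fst (chart_sy (z *s s) (z *s y)))) holomorphic_on UNIV"
        by (simp add: chart_sy_def) (intro holomorphic_intros)
      show "(\<lambda>z. snd (fst (chart_sy (z *s s) (z *s y))) $ i) holomorphic_on UNIV" for i
        by (simp add: chart_sy_def) (intro holomorphic_intros)
      show "(\<lambda>z. snd (snd (chart_sy (z *s s) (z *s y))) $ i) holomorphic_on UNIV" for i
        by (simp add: chart_sy_def) (intro holomorphic_intros)
      show "(\<lambda>z. fst (snd (chart_sy (z *s s) (z *s y)))) holomorphic_on UNIV"
        by (simp add: chart_sy_def)
    qed (simp_all add: chart_in_Zhat)
    show "0 islimpt ball 0 \<delta> - {0::complex}"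
      by (subst islimpt_punctured[symmetric]) (simp add: islimpt_ball \<delta>(1) less_imp_le)
    fix z :: complex assume z: "z \<in> ball 0 \<delta> - {0}"
    then have z': "z \<noteq> 0" "dist z 0 < \<delta>" by (auto simp: dist_commute)
    let ?x = "(z / ?d z) *s s" and ?y = "z *s y"
    have "1 - dotp ?x ?y = 1 / ?d z" using \<delta>(2)[OF z'] by (simp add: field_simps)
    moreover from this have "dotp ?x ?y \<noteq> 1" using \<delta>(2)[OF z'] by auto
    ultimately have "?f z = F (std_inv ?x ?y)"
      using Ohat_chart_sy[OF F, of ?x ?y] \<delta>(2)[OF z'] by (simp add: vector_smult_assoc)
    also have "\<dots> = 0"
      using \<delta>(3)[OF z'] by (intro Ohat_zero_near_origin[OF F zero]) (auto simp: less_imp_le)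
    finally show "?f z = 0" .
  qed auto
  then show ?thesis by simp
qed

text \<open>Points with q0 nonzero are moved into the (s, y) chart by acting with q0; the remaining
  ones are reached by density. This is what makes the choice in \<open>hat\<close> unique on
  \<open>Zhat\<close>.\<close>

lemma Ohat_zero:
  fixes F :: "('n::finite) hpt \<Rightarrow> complex"
  assumes F: "F \<in> Ohat" and zero: "\<And>w. w \<in> Dn \<Longrightarrow> F (DeltaD w) = 0" and X: "X \<in> Zhat"
  shows "F X = 0"
proof (rule Zhat_eqI[of F "\<lambda>_. 0"])
  show "continuous_on Zhat F" using F lhol_continuous_on by (auto simp: Ohat_iff)
  fix p0 q0 and p q :: "complex^'n" assume Z: "((p0, p), (q0, q)) \<in> Zhat" and q: "q0 \<noteq> 0"
  have "act q0 ((p0, p), (q0, q)) = chart_sy (q0 *s p) ((1 / q0) *s q)"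
    using Z q by (simp add: chart_sy_def Zhat_iff mult.commute)
  then show "F ((p0, p), (q0, q)) = 0"
    using Ohat_act[OF F Z q] Ohat_zero_chart_sy[OF F zero] by metis
qed (use X in auto)

section \<open>Expansion in fundamental monomials\<close>

text \<open>A point of C^(2n) is a function on the sum type, as in \<open>coef\<close>;
  \<open>vl\<close> and \<open>vr\<close> recover its two halves, so that the general Taylor theory
  applies to pairs of vectors.\<close>

definition vl :: "('n::finite + 'n \<Rightarrow> complex) \<Rightarrow> complex^'n" where "vl z = (\<chi> i. z (Inl i))"
definition vr :: "('n::finite + 'n \<Rightarrow> complex) \<Rightarrow> complex^'n" where "vr z = (\<chi> i. z (Inr i))"

definition jn :: "('n \<Rightarrow> nat) \<times> ('n \<Rightarrow> nat) \<Rightarrow> 'n + 'n \<Rightarrow> nat" where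
  "jn PQ = case_sum (fst PQ) (snd PQ)"

definition klist :: "('n::finite + 'n) list" where
  "klist = map Inl idx_list @ map Inr idx_list"

lemma vl_vr_nth [simp]: "vl z $ i = z (Inl i)" "vr z $ i = z (Inr i)"
  by (simp_all add: vl_def vr_def)

lemma vl_vr_case_sum [simp]: "vl (case_sum (\<lambda>i. x $ i) (\<lambda>i. y $ i)) = x" "vr (case_sum (\<lambda>i. x $ i) (\<lambda>i. y $ i)) = y"
  by (simp_all add: vl_def vr_def)

lemma idx_list: "distinct (idx_list :: 'n::finite list)" "set (idx_list :: 'n list) = UNIV"
proof -
  have "\<exists>xs :: 'n list. distinct xs \<and> set xs = UNIV"
    using finite_distinct_list[of "UNIV :: 'n set"] by auto
  from someI_ex[OF this] show "distinct (idx_list :: 'n list)" "set (idx_list :: 'n list) = UNIV"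
    by (simp_all add: idx_list_def)
qed

lemma klist: "distinct (klist :: ('n::finite + 'n) list)" "set (klist :: ('n + 'n) list) = UNIV"
  by (auto simp: klist_def distinct_map idx_list intro: sum.exhaust_sel)

lemma bij_jn: "bij jn"
proof (rule bijI')
  show "jn x = jn y \<longleftrightarrow> x = y" for x y :: "('n \<Rightarrow> nat) \<times> ('n \<Rightarrow> nat)"
    by (auto simp: jn_def prod_eq_iff fun_eq_iff split: sum.splits)
  show "\<exists>x. y = jn x" for y :: "'n + 'n \<Rightarrow> nat"
    by (intro exI[of _ "(y \<circ> Inl, y \<circ> Inr)"]) (auto simp: jn_def fun_eq_iff split: sum.splits)
qed

lemma mabs_jn: "mabs (jn PQ) = mabs (fst PQ) + mabs (snd PQ)"
  unfolding mabs_def UNIV_Plus_UNIV[symmetric] by (simp add: sum.Plus jn_def del: UNIV_Plus_UNIV)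

lemma monomial_jn: "(\<Prod>k\<in>UNIV. z k ^ jn PQ k) = xpow (vl z) (fst PQ) * xpow (vr z) (snd PQ)"
  unfolding UNIV_Plus_UNIV[symmetric] by (simp add: prod.Plus jn_def xpow_def del: UNIV_Plus_UNIV)

lemma xpow_scale: "xpow (c *s x) P = c ^ mabs P * xpow x P"
  by (simp add: xpow_def mabs_def power_mult_distrib prod.distrib power_sum)

lemma norm_xpow_le:
  fixes x :: "complex^'n::finite"
  assumes "\<And>i. cmod (x $ i) \<le> M" shows "cmod (xpow x P) \<le> M ^ mabs P"
  unfolding xpow_def mabs_def power_sum prod_norm[symmetric] norm_power
  using assms by (intro prod_mono) (auto intro: power_mono)

lemma continuous_on_vl_vr:
  "continuous_on S (\<lambda>z. vl z :: complex^'n::finite)" "continuous_on S (\<lambda>z. vr z :: complex^'n)"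
  "continuous_on S (\<lambda>z. dotp (vl z) (vr z :: complex^'n))"
proof -
  have c: "continuous_on S (\<lambda>z. z k :: complex)" for k and S :: "('n + 'n \<Rightarrow> complex) set"
    by (rule continuous_on_subset[OF continuous_on_product_coordinates]) auto
  show "continuous_on S (\<lambda>z. vl z :: complex^'n)" "continuous_on S (\<lambda>z. vr z :: complex^'n)"
    unfolding vl_def vr_def by (intro continuous_on_vec_lambda c)+
  show "continuous_on S (\<lambda>z. dotp (vl z) (vr z :: complex^'n))"
    unfolding dotp_def vl_vr_nth by (intro continuous_on_sum continuous_on_mult c)
qed

lemma entire_chart:
  fixes F :: "('n::finite) hpt \<Rightarrow> complex"
  assumes F: "F \<in> Ohat"
  shows "entire (\<lambda>z. F (chart_sy (vl z) (vr z)))" "entire (\<lambda>z. F (chart_xt (vl z) (vr z)))"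
proof -
  have lhol: "lhol F" using F by (simp add: Ohat_iff)
  have FC: "continuous_on Zhat F" by (rule lhol_continuous_on[OF lhol])
  have c: "continuous_on UNIV (\<lambda>z. F (chart_sy (vl z) (vr z)))" "continuous_on UNIV (\<lambda>z. F (chart_xt (vl z) (vr z)))"
  proof -
    have "continuous_on UNIV (\<lambda>z. chart_sy (vl z) (vr z) :: 'n hpt)" "continuous_on UNIV (\<lambda>z. chart_xt (vl z) (vr z) :: 'n hpt)"
      unfolding chart_sy_def chart_xt_def
      by (intro continuous_on_Pair continuous_on_add continuous_on_const continuous_on_vl_vr)+
    then show "continuous_on UNIV (\<lambda>z. F (chart_sy (vl z) (vr z)))" "continuous_on UNIV (\<lambda>z. F (chart_xt (vl z) (vr z)))"
      by (auto intro!: continuous_on_compose2[OF FC] simp: chart_in_Zhat)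
  qed
  have hv: "(\<lambda>t. (w(k := t)) j) holomorphic_on UNIV" for w :: "'n + 'n \<Rightarrow> complex" and k j
    by (cases "j = k") auto
  have h: "(\<lambda>t. F (chart_sy (vl (w(k := t))) (vr (w(k := t))))) holomorphic_on UNIV"
    "(\<lambda>t. F (chart_xt (vl (w(k := t))) (vr (w(k := t))))) holomorphic_on UNIV" for w k
  proof -
    have hd: "(\<lambda>t. dotp (vl (w(k := t))) (vr (w(k := t)))) holomorphic_on UNIV"
      unfolding dotp_def vl_vr_nth by (intro holomorphic_intros hv)
    show "(\<lambda>t. F (chart_sy (vl (w(k := t))) (vr (w(k := t))))) holomorphic_on UNIV"
      by (rule lhol_holomorphic_curve[OF lhol], simp_all only: chart_in_Zhat)
        (simp_all only: open_UNIV chart_sy_def fst_conv snd_conv vl_vr_nth hv holomorphic_on_const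
          holomorphic_on_add hd)
    show "(\<lambda>t. F (chart_xt (vl (w(k := t))) (vr (w(k := t))))) holomorphic_on UNIV"
      by (rule lhol_holomorphic_curve[OF lhol], simp_all only: chart_in_Zhat)
        (simp_all only: open_UNIV chart_xt_def fst_conv snd_conv vl_vr_nth hv holomorphic_on_const
          holomorphic_on_add hd)
  qed
  show "entire (\<lambda>z. F (chart_sy (vl z) (vr z)))" "entire (\<lambda>z. F (chart_xt (vl z) (vr z)))"
    unfolding entire_def using c h by blast+
qed

text \<open>The extension of \<open>fr P Q\<close> to \<open>Zhat\<close>. With m = max(|P|, |Q|),
  the zeroth coordinates fill both degrees, in p and in q, up to m; equal degrees give invariance,
  and at least one of the two filling powers is trivial.\<close>

definition frh :: "('n::finite \<Rightarrow> nat) \<Rightarrow> ('n \<Rightarrow> nat) \<Rightarrow> 'n hpt \<Rightarrow> complex" where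
  "frh P Q X = xpow (snd (fst X)) P * xpow (snd (snd X)) Q *
     fst (fst X) ^ (max (mabs P) (mabs Q) - mabs P) * fst (snd X) ^ (max (mabs P) (mabs Q) - mabs Q)"

lemma frh_std_inv: "frh P Q (std_inv x y) = xpow x P * xpow y Q / (1 - dotp x y) ^ max (mabs P) (mabs Q)"
proof -
  let ?c = "1 / (1 - dotp x y)" and ?m = "max (mabs P) (mabs Q)"
  have "frh P Q (std_inv x y) = xpow x P * xpow y Q * (?c ^ mabs Q * ?c ^ (?m - mabs Q))"
    by (simp add: frh_def std_inv_def xpow_scale)
  also have "?c ^ mabs Q * ?c ^ (?m - mabs Q) = ?c ^ ?m"
    by (simp flip: power_add)
  finally show ?thesis by (simp add: power_divide)
qed

lemma frh_Ohat: "frh P Q \<in> Ohat"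
  unfolding Ohat_iff
proof (intro conjI ballI allI impI)
  show "lhol (frh P Q)"
    unfolding frh_def xpow_def by (intro lhol_mult lhol_prod lhol_power lhol_coordinates) auto
  fix X :: "'a hpt" and z :: complex assume z: "z \<noteq> 0"
  obtain p0 p q0 q where X: "X = ((p0, p), (q0, q))" by (metis surj_pair)
  let ?m = "max (mabs P) (mabs Q)"
  have "z ^ mabs P * (1 / z) ^ mabs Q * z ^ (?m - mabs P) * (1 / z) ^ (?m - mabs Q) =
     (z ^ mabs P * z ^ (?m - mabs P)) * ((1 / z) ^ mabs Q * (1 / z) ^ (?m - mabs Q))"
    by (simp add: mult_ac)
  also have "\<dots> = z ^ ?m * (1 / z) ^ ?m"
    by (simp flip: power_add)
  also have "\<dots> = 1" using z by (simp flip: power_mult_distrib)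
  finally have e: "z ^ mabs P * (1 / z) ^ mabs Q * z ^ (?m - mabs P) * (1 / z) ^ (?m - mabs Q) = 1" .
  have "frh P Q (act z X) = (z ^ mabs P * (1 / z) ^ mabs Q * z ^ (?m - mabs P) * (1 / z) ^ (?m - mabs Q)) * frh P Q X"
    by (simp add: X frh_def xpow_scale power_mult_distrib power_divide)
  then show "frh P Q (act z X) = frh P Q X" unfolding e by simp
qed

lemma fr_DeltaD: "w \<in> Dn \<Longrightarrow> fr P Q w = frh P Q (DeltaD w)"
  by (simp add: Ohat_DeltaD[OF frh_Ohat] frh_std_inv fr_def dotp_vconj)

text \<open>The monomial has total degree 2 max(|P|, |Q|), at most 2 (|P| + |Q|), in coordinates
  bounded by some M >= 1; hence the square of M as geometric rate.\<close>

lemma frh_bound: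
  fixes K :: "('n::finite) hpt set"
  assumes "compact K"
  obtains M where "1 \<le> M" "\<And>P Q X. X \<in> K \<Longrightarrow> cmod (frh P Q X) \<le> M ^ (mabs P + mabs Q)"
proof -
  obtain B where B: "\<And>X. X \<in> K \<Longrightarrow> norm X \<le> B"
    using compact_imp_bounded[OF assms] unfolding bounded_iff by blast
  define M where "M = max B 1"
  have M: "1 \<le> M" "\<And>X. X \<in> K \<Longrightarrow> norm X \<le> M" using B by (auto simp: M_def intro: le_max_iff_disj[THEN iffD2])
  show thesis
  proof (rule that[of "M * M"])
    show "1 \<le> M * M" using M(1) by (metis mult_mono' mult_1 zero_le_one)
    fix P Q :: "'n \<Rightarrow> nat" and X assume X: "X \<in> K"
    let ?m = "max (mabs P) (mabs Q)"
    have 1: "norm (fst X) \<le> M" "norm (snd X) \<le> M"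
      using M(2)[OF X] norm_fst_le[of "fst X" "snd X"] norm_snd_le[of "snd X" "fst X"] by auto
    have 2: "norm (fst (fst X)) \<le> M" "norm (snd (fst X)) \<le> M" "norm (fst (snd X)) \<le> M" "norm (snd (snd X)) \<le> M"
      using 1 norm_fst_le[of "fst (fst X)" "snd (fst X)"] norm_snd_le[of "snd (fst X)" "fst (fst X)"]
        norm_fst_le[of "fst (snd X)" "snd (snd X)"] norm_snd_le[of "snd (snd X)" "fst (snd X)"] by auto
    have 3: "cmod (snd (fst X) $ i) \<le> M" "cmod (snd (snd X) $ i) \<le> M" for i
      using 2 Finite_Cartesian_Product.norm_nth_le order_trans by blast+
    have "cmod (frh P Q X) \<le> M ^ mabs P * M ^ mabs Q * M ^ (?m - mabs P) * M ^ (?m - mabs Q)"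
      unfolding frh_def norm_mult norm_power
      using M(1) by (intro mult_mono norm_xpow_le 3 power_mono 2) auto
    also have "\<dots> = M ^ (mabs P + mabs Q + (?m - mabs P) + (?m - mabs Q))"
      by (simp only: power_add)
    also have "\<dots> \<le> M ^ (2 * (mabs P + mabs Q))"
      by (intro power_increasing M(1)) auto
    also have "\<dots> = (M * M) ^ (mabs P + mabs Q)"
      by (simp only: power_mult power2_eq_square)
    finally show "cmod (frh P Q X) \<le> (M * M) ^ (mabs P + mabs Q)" .
  qed
qed

lemma chart_has_sum:
  fixes x y :: "complex^'n::finite"
  assumes "entire G"
  shows "((\<lambda>PQ. tcoef 1 klist G (jn PQ) * (xpow x (fst PQ) * xpow y (snd PQ))) has_sum
     G (case_sum (\<lambda>i. x $ i) (\<lambda>i. y $ i))) UNIV"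
proof -
  let ?z = "case_sum (\<lambda>i. x $ i) (\<lambda>i. y $ i)"
  \<comment> \<open>Any radius exceeding all coordinates of the point works;
    \<open>tcoef_radius\<close> then returns to radius 1, so the series represents \<open>G\<close>
    everywhere.\<close>
  define R where "R = 1 + (\<Sum>k\<in>UNIV. cmod (?z k))"
  have z: "cmod (?z k) < R" for k
    using member_le_sum[of k UNIV "\<lambda>k. cmod (?z k)"] by (simp add: R_def)
  then have R: "0 < R" by (meson norm_ge_zero order_le_less_trans)
  have "((\<lambda>m. tcoef R klist G m * (\<Prod>k\<in>UNIV. ?z k ^ m k)) has_sum G ?z) UNIV"
    using R klist assms z by (rule tcoef_has_sum)
  then have "((\<lambda>PQ. tcoef R klist G (jn PQ) * (\<Prod>k\<in>UNIV. ?z k ^ jn PQ k)) has_sum G ?z) UNIV"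
    by (subst has_sum_reindex_bij_betw[OF bij_jn])
  then show ?thesis
    unfolding monomial_jn vl_vr_case_sum tcoef_radius[OF R zero_less_one klist assms] .
qed

lemma has_sum_diff:
  fixes f g :: "'a \<Rightarrow> complex"
  assumes "(f has_sum a) A" "(g has_sum b) A"
  shows "((\<lambda>x. f x - g x) has_sum (a - b)) A"
  using has_sum_add[OF assms(1) has_sum_uminusI[OF assms(2)]] by simp

text \<open>Integration against u^(-k-1) over the unit circle isolates the total of weight k. A
  weight class may be infinite, so it is the sum over each class that vanishes, not \<open>d\<close>
  itself; summing the classes with k < 0 gives the claim.\<close>

lemma Laurent_negative_part_zero:
  fixes d :: "'a \<Rightarrow> complex" and wt :: "'a \<Rightarrow> int"
  assumes d: "d summable_on UNIV"
    and sum: "\<And>u. cmod u = 1 \<Longrightarrow> ((\<lambda>a. d a * u powi wt a) has_sum 0) UNIV"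
  shows "(d has_sum 0) {a. wt a < 0}"
proof -
  have nd: "(\<lambda>a. cmod (d a)) summable_on UNIV"
    using d by (simp add: summable_on_iff_abs_summable_on_complex)
  have weight: "(d has_sum 0) {a. wt a = k}" for k
  proof -
    \<comment> \<open>A single circle integral, written as an iterated one indexed by the unit type,
      so that the exchange and orthogonality lemmas apply.\<close>
    let ?f = "\<lambda>a z. d a * (\<Prod>j\<in>set [()]. z j powi (wt a - k - 1))"
    have "((\<lambda>a. cints 1 [()] (?f a) (\<lambda>_. 0)) has_sum cints 1 [()] (\<lambda>z. 0) (\<lambda>_. 0)) UNIV"
    proof (rule cints_has_sum[OF zero_less_one _ _ nd, of UNIV])
      show "continuous_on (torus 1 UNIV) (?f a)" for a
        by (intro continuous_intros continuous_on_torus_monomial) auto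
      fix z :: "unit \<Rightarrow> complex" assume z: "z \<in> torus 1 UNIV"
      then have z1: "cmod (z ()) = 1" by (auto simp: torus_def)
      then show "cmod (?f a z) \<le> cmod (d a)" for a
        by (simp add: norm_mult norm_power_int)
      have "((\<lambda>a. d a * z () powi wt a * z () powi (- k - 1)) has_sum 0 * z () powi (- k - 1)) UNIV"
        by (intro has_sum_cmult_left sum z1)
      moreover have "z () powi wt a * z () powi (- k - 1) = z () powi (wt a - k - 1)" for a
        using z1 by (subst power_int_add[symmetric]) (auto simp: algebra_simps)
      ultimately show "((\<lambda>a. ?f a z) has_sum 0) UNIV"
        by (simp add: mult.assoc)
    qed (auto simp: torus_def)
    moreover have "cints 1 [()] (?f a) (\<lambda>_. 0) = (if wt a = k then d a else 0) * (2 * pi * \<i>)" for a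
    proof -
      have "cints 1 [()] (?f a) (\<lambda>_. 0) = d a * cints 1 [()] (\<lambda>z. \<Prod>j\<in>set [()]. z j powi (wt a - k - 1)) (\<lambda>_. 0)"
        by (rule cints_cmult[OF zero_less_one continuous_on_torus_monomial]) (auto simp: torus_def)
      then show ?thesis
        by (subst (asm) cints_monomial) auto
    qed
    ultimately have "((\<lambda>a. (if wt a = k then d a else 0) * (2 * pi * \<i>)) has_sum 0) UNIV"
      by simp
    then have "((\<lambda>a. (if wt a = k then d a else 0) * (2 * pi * \<i>) * (1 / (2 * pi * \<i>))) has_sum 0 * (1 / (2 * pi * \<i>))) UNIV"
      by (rule has_sum_cmult_left)
    then have "((\<lambda>a. if wt a = k then d a else 0) has_sum 0) UNIV" by simp
    then show ?thesis
      by (subst (asm) has_sum_cong_neutral[where T = "{a. wt a = k}" and g = d]) auto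
  qed
  have "d summable_on {a. wt a < 0}" using d summable_on_subset_banach by blast
  then obtain S where S: "(d has_sum S) {a. wt a < 0}" by (auto simp: summable_on_def)
  \<comment> \<open>Tagging each index with its weight displays the sum as a double sum over weight
    classes, each contributing 0.\<close>
  have "((d \<circ> snd) has_sum S) ((\<lambda>a. (wt a, a)) ` {a. wt a < 0})"
    by (subst has_sum_reindex) (auto simp: inj_on_def comp_def S)
  moreover have "(\<lambda>a. (wt a, a)) ` {a. wt a < 0} = Sigma {k. k < 0} (\<lambda>k. {a. wt a = k})"
    by auto
  ultimately have "((\<lambda>k::int. 0) has_sum S) {k. k < 0}"
    by (intro has_sum_SigmaD[where f = "d \<circ> snd" and B = "\<lambda>k. {a. wt a = k}"]) (auto simp: weight)
  then have "S = 0" by (rule has_sum_unique) (rule has_sum_0, simp)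
  with S show ?thesis by simp
qed

text \<open>Radius 1 stands for every radius, since \<open>F\<close> is entire in both charts. For
  |P| = |Q| the monomials s^P y^Q and x^P t^Q coincide.\<close>

definition ecoef :: "(('n::finite) hpt \<Rightarrow> complex) \<Rightarrow> ('n \<Rightarrow> nat) \<times> ('n \<Rightarrow> nat) \<Rightarrow> complex" where
  "ecoef F PQ = (if mabs (snd PQ) \<le> mabs (fst PQ)
     then tcoef 1 klist (\<lambda>z. F (chart_sy (vl z) (vr z))) (jn PQ)
     else tcoef 1 klist (\<lambda>z. F (chart_xt (vl z) (vr z))) (jn PQ))"

text \<open>The two Taylor series \<open>\<alpha>\<close> and \<open>\<beta>\<close> have the same
  sum at every rotated point, so their parts of negative weight have equal totals. Exchanging
  \<open>\<alpha>\<close> for \<open>\<beta>\<close> on those weights keeps the sum and makes each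
  term a coefficient times a fundamental monomial.\<close>

lemma ecoef_has_sum_std:
  fixes F :: "('n::finite) hpt \<Rightarrow> complex"
  assumes F: "F \<in> Ohat" and xy: "dotp x y \<noteq> 1"
  shows "((\<lambda>PQ. ecoef F PQ * frh (fst PQ) (snd PQ) (std_inv x y)) has_sum F (std_inv x y)) UNIV"
proof -
  define c where "c = 1 / (1 - dotp x y)"
  let ?E = "\<lambda>z. F (chart_sy (vl z) (vr z))" and ?E' = "\<lambda>z. F (chart_xt (vl z) (vr z))"
  define \<alpha> where "\<alpha> PQ = tcoef 1 klist ?E (jn PQ) * (xpow (c *s x) (fst PQ) * xpow y (snd PQ))" for PQ
  define \<beta> where "\<beta> PQ = tcoef 1 klist ?E' (jn PQ) * (xpow x (fst PQ) * xpow (c *s y) (snd PQ))" for PQ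
  define wt where "wt PQ = int (mabs (fst PQ)) - int (mabs (snd PQ))" for PQ :: "('n \<Rightarrow> nat) \<times> ('n \<Rightarrow> nat)"
  \<comment> \<open>Replacing (x, y) by (u x, y / u) leaves x.y, hence the factor \<open>c\<close>,
    unchanged and multiplies a term of weight k by u^k in both series.\<close>
  have rot: "((\<lambda>PQ. \<alpha> PQ * u powi wt PQ) has_sum F (std_inv (u *s x) ((1 / u) *s y))) UNIV"
    "((\<lambda>PQ. \<beta> PQ * u powi wt PQ) has_sum F (std_inv (u *s x) ((1 / u) *s y))) UNIV" if u: "u \<noteq> 0" for u
  proof -
    have d: "dotp (u *s x) ((1 / u) *s y) = dotp x y" using u by simp
    have "u ^ j * (1 / u) ^ k = u powi (int j - int k)" for j k
      using u by (simp add: power_int_diff power_divide)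
    then have p: "xpow (u *s v) (fst PQ) * xpow ((1 / u) *s w) (snd PQ) = xpow v (fst PQ) * xpow w (snd PQ) * u powi wt PQ"
      for PQ and v w :: "complex^'n"
      unfolding xpow_scale wt_def by (metis (no_types, lifting) mult.assoc mult.commute)
    have "F (chart_sy (u *s (c *s x)) ((1 / u) *s y)) = F (std_inv (u *s x) ((1 / u) *s y))"
      using Ohat_chart_sy[OF F, of "u *s x" "(1 / u) *s y"] xy unfolding d c_def
      by (simp add: vector_smult_assoc mult.commute)
    with chart_has_sum[OF entire_chart(1)[OF F], of "u *s (c *s x)" "(1 / u) *s y"]
    show "((\<lambda>PQ. \<alpha> PQ * u powi wt PQ) has_sum F (std_inv (u *s x) ((1 / u) *s y))) UNIV"
      unfolding vl_vr_case_sum p \<alpha>_def mult.assoc by simp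
    have "F (chart_xt (u *s x) ((1 / u) *s (c *s y))) = F (std_inv (u *s x) ((1 / u) *s y))"
      using chart_xt_std_inv[of "u *s x" "(1 / u) *s y"] xy unfolding d c_def
      by (simp add: vector_smult_assoc mult.commute)
    with chart_has_sum[OF entire_chart(2)[OF F], of "u *s x" "(1 / u) *s (c *s y)"]
    show "((\<lambda>PQ. \<beta> PQ * u powi wt PQ) has_sum F (std_inv (u *s x) ((1 / u) *s y))) UNIV"
      unfolding vl_vr_case_sum p \<beta>_def mult.assoc by simp
  qed
  have \<alpha>: "(\<alpha> has_sum F (std_inv x y)) UNIV" and \<beta>: "(\<beta> has_sum F (std_inv x y)) UNIV"
    using rot[of 1] by simp_all
  have "((\<lambda>PQ. \<alpha> PQ - \<beta> PQ) has_sum 0) {PQ. wt PQ < 0}"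
  proof (rule Laurent_negative_part_zero)
    show "(\<lambda>PQ. \<alpha> PQ - \<beta> PQ) summable_on UNIV"
      using has_sum_diff[OF \<alpha> \<beta>] by (auto simp: summable_on_def)
    fix u :: complex assume "cmod u = 1"
    then have u: "u \<noteq> 0" by auto
    show "((\<lambda>PQ. (\<alpha> PQ - \<beta> PQ) * u powi wt PQ) has_sum 0) UNIV"
      using has_sum_diff[OF rot(1)[OF u] rot(2)[OF u]] by (simp add: left_diff_distrib)
  qed
  then have "((\<lambda>PQ. if wt PQ < 0 then \<alpha> PQ - \<beta> PQ else 0) has_sum 0) UNIV"
    by (subst has_sum_cong_neutral[where T = "{PQ. wt PQ < 0}" and g = "\<lambda>PQ. \<alpha> PQ - \<beta> PQ"]) auto
  then have "((\<lambda>PQ. \<alpha> PQ - (if wt PQ < 0 then \<alpha> PQ - \<beta> PQ else 0)) has_sum (F (std_inv x y) - 0)) UNIV"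
    by (intro has_sum_diff \<alpha>)
  moreover have "\<alpha> PQ - (if wt PQ < 0 then \<alpha> PQ - \<beta> PQ else 0) = ecoef F PQ * frh (fst PQ) (snd PQ) (std_inv x y)" for PQ
    unfolding frh_std_inv
    by (auto simp: \<alpha>_def \<beta>_def wt_def ecoef_def xpow_scale c_def power_divide max_def)
  ultimately show ?thesis by simp
qed

text \<open>Taylor coefficients taken at radius q + 1 give convergence at \<open>q\<close>. Each
  \<open>ecoef\<close> is one of two such coefficients, so the sum of both series is a
  majorant.\<close>

lemma ecoef_summable:
  fixes F :: "('n::finite) hpt \<Rightarrow> complex"
  assumes F: "F \<in> Ohat" and q: "0 \<le> q"
  shows "(\<lambda>PQ. cmod (ecoef F PQ) * q ^ (mabs (fst PQ) + mabs (snd PQ))) summable_on UNIV"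
proof -
  let ?E = "\<lambda>z. F (chart_sy (vl z) (vr z))" and ?E' = "\<lambda>z. F (chart_xt (vl z) (vr z))"
  have *: "(\<lambda>PQ. cmod (tcoef 1 klist G (jn PQ)) * q ^ (mabs (fst PQ) + mabs (snd PQ))) summable_on UNIV"
    if G: "entire G" for G :: "('n + 'n \<Rightarrow> complex) \<Rightarrow> complex"
  proof -
    have "(\<lambda>m. cmod (tcoef (q + 1) klist G m) * q ^ mabs m) summable_on UNIV"
      using q by (intro tcoef_abs_summable klist G) auto
    also have "tcoef (q + 1) klist G = tcoef 1 klist G"
      using q by (intro tcoef_radius klist G) auto
    finally have "(\<lambda>PQ. cmod (tcoef 1 klist G (jn PQ)) * q ^ mabs (jn PQ)) summable_on UNIV"
      by (subst summable_on_reindex_bij_betw[OF bij_jn, where f = "\<lambda>m. cmod (tcoef 1 klist G m) * q ^ mabs m"])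
    then show ?thesis by (simp add: mabs_jn)
  qed
  show ?thesis
    by (rule summable_on_comparison_test[OF summable_on_add[OF *[OF entire_chart(1)[OF F]] *[OF entire_chart(2)[OF F]]]])
      (auto simp: ecoef_def q)
qed

lemma ecoef_uniform_limit:
  fixes F :: "('n::finite) hpt \<Rightarrow> complex"
  assumes F: "F \<in> Ohat" and K: "compact K"
  shows "uniform_limit K (\<lambda>I X. \<Sum>PQ\<in>I. ecoef F PQ * frh (fst PQ) (snd PQ) X)
    (\<lambda>X. \<Sum>\<^sub>\<infinity>PQ. ecoef F PQ * frh (fst PQ) (snd PQ) X) (finite_subsets_at_top UNIV)"
proof -
  obtain M where M: "1 \<le> M" "\<And>P Q X. X \<in> K \<Longrightarrow> cmod (frh P Q X) \<le> M ^ (mabs P + mabs Q)"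
    using frh_bound[OF K] by blast
  show ?thesis
    by (rule Weierstrass_m_test_general[where M = "\<lambda>PQ. cmod (ecoef F PQ) * M ^ (mabs (fst PQ) + mabs (snd PQ))"])
      (use M ecoef_summable[OF F] in \<open>auto simp: norm_mult intro!: mult_left_mono\<close>)
qed

text \<open>The expansion is known where p0 and q0 are nonzero. Locally uniform convergence makes
  the series continuous on all of \<open>Zhat\<close>, so density extends the identity to the points
  missed by the standard chart.\<close>

lemma ecoef_infsum:
  fixes F :: "('n::finite) hpt \<Rightarrow> complex"
  assumes F: "F \<in> Ohat" and X: "X \<in> Zhat"
  shows "(\<Sum>\<^sub>\<infinity>PQ. ecoef F PQ * frh (fst PQ) (snd PQ) X) = F X"
proof (rule Zhat_eqI[OF _ _ X])
  show "continuous_on Zhat F" using F lhol_continuous_on by (auto simp: Ohat_iff)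
  let ?G = "\<lambda>X. \<Sum>\<^sub>\<infinity>PQ. ecoef F PQ * frh (fst PQ) (snd PQ) X"
  show "continuous_on Zhat ?G"
    unfolding continuous_on_eq_continuous_within
  proof
    fix Y :: "'n hpt" assume Y: "Y \<in> Zhat"
    \<comment> \<open>A compact neighbourhood of \<open>Y\<close> within the closed set
      \<open>Zhat\<close>: uniform convergence is available on it, and it determines continuity at
      \<open>Y\<close>.\<close>
    let ?K = "Zhat \<inter> cball Y 1"
    have K: "compact ?K" by (intro closed_Int_compact closed_Zhat compact_cball)
    have "continuous_on ?K ?G"
    proof (rule uniform_limit_theorem[OF _ ecoef_uniform_limit[OF F K]])
      have "continuous_on Zhat (frh P Q :: 'n hpt \<Rightarrow> complex)" for P Q
        using frh_Ohat lhol_continuous_on unfolding Ohat_iff by blast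
      then have "continuous_on ?K (frh P Q :: 'n hpt \<Rightarrow> complex)" for P Q
        by (rule continuous_on_subset) auto
      then show "\<forall>\<^sub>F I in finite_subsets_at_top UNIV. continuous_on ?K (\<lambda>X. \<Sum>PQ\<in>I. ecoef F PQ * frh (fst PQ) (snd PQ) X)"
        by (intro always_eventually allI continuous_on_sum continuous_on_mult continuous_on_const)
    qed simp
    then have "continuous (at Y within ?K) ?G"
      using Y by (simp add: continuous_on_eq_continuous_within)
    moreover have "at Y within ?K = at Y within Zhat"
      by (rule at_within_nhd[of _ "ball Y 1"]) auto
    ultimately show "continuous (at Y within Zhat) ?G" by simp
  qed
  fix p0 q0 and p q :: "complex^'n"
  assume Z: "((p0, p), (q0, q)) \<in> Zhat" and nz: "p0 \<noteq> 0" "q0 \<noteq> 0"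
  show "?G ((p0, p), (q0, q)) = F ((p0, p), (q0, q))"
    unfolding Ohat_std(2)[OF F Z nz] Ohat_std(2)[OF frh_Ohat Z nz]
    by (rule infsumI[OF ecoef_has_sum_std[OF F Ohat_std(1)[OF F Z nz]]])
qed

section \<open>The coefficient functionals\<close>

lemma Ohat_lincomb:
  assumes "F \<in> Ohat" "G \<in> Ohat"
  shows "(\<lambda>X. c * F X + d * G X) \<in> Ohat"
  using assms by (auto simp: Ohat_iff intro!: lhol_add lhol_mult lhol_const)

lemma Ohat_unique:
  assumes "F \<in> Ohat" "G \<in> Ohat" "\<And>w. w \<in> Dn \<Longrightarrow> F (DeltaD w) = G (DeltaD w)" "X \<in> Zhat"
  shows "F X = G X"
  using Ohat_zero[OF Ohat_lincomb[OF assms(1,2), of 1 "-1"] _ assms(4)] assms(3) by simp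

lemma AsetD:
  assumes "a \<in> Aset"
  shows "hat a \<in> Ohat" "w \<in> Dn \<Longrightarrow> a w = hat a (DeltaD w)" "w \<notin> Dn \<Longrightarrow> a w = 0"
proof -
  have "\<exists>F. F \<in> Ohat \<and> (\<forall>w\<in>Dn. a w = F (DeltaD w))" using assms by (auto simp: Aset_def)
  from someI_ex[OF this] show "hat a \<in> Ohat" "w \<in> Dn \<Longrightarrow> a w = hat a (DeltaD w)"
    unfolding hat_def by blast+
  show "w \<notin> Dn \<Longrightarrow> a w = 0" using assms by (auto simp: Aset_def)
qed

text \<open>Any holomorphic extension computes \<open>hat a\<close> on \<open>Zhat\<close>;
  elsewhere the chosen function is arbitrary, so later arguments evaluate it only on
  \<open>Zhat\<close>.\<close>

lemma Aset_hatI: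
  assumes "F \<in> Ohat" "\<And>w. w \<in> Dn \<Longrightarrow> a w = F (DeltaD w)" "\<And>w. w \<notin> Dn \<Longrightarrow> a w = 0"
  shows "a \<in> Aset" "X \<in> Zhat \<Longrightarrow> hat a X = F X"
proof -
  show a: "a \<in> Aset" using assms by (auto simp: Aset_def)
  show "X \<in> Zhat \<Longrightarrow> hat a X = F X"
    by (rule Ohat_unique[OF AsetD(1)[OF a] assms(1)]) (metis AsetD(2)[OF a] assms(2))
qed

lemma Aset_lincomb:
  assumes "a \<in> Aset" "b \<in> Aset"
  shows "(\<lambda>w. c * a w + d * b w) \<in> Aset"
    and "X \<in> Zhat \<Longrightarrow> hat (\<lambda>w. c * a w + d * b w) X = c * hat a X + d * hat b X"
  by (rule Aset_hatI[OF Ohat_lincomb[OF AsetD(1)[OF assms(1)] AsetD(1)[OF assms(2)]]];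
      simp add: AsetD(2,3)[OF assms(1)] AsetD(2,3)[OF assms(2)])+

lemma Aset_diff:
  assumes "a \<in> Aset" "b \<in> Aset"
  shows "(\<lambda>w. a w - b w) \<in> Aset" and "X \<in> Zhat \<Longrightarrow> hat (\<lambda>w. a w - b w) X = hat a X - hat b X"
  using Aset_lincomb[OF assms, where c = 1 and d = "-1"] by auto

lemma Aset_cmult:
  assumes "a \<in> Aset"
  shows "(\<lambda>w. c * a w) \<in> Aset" and "X \<in> Zhat \<Longrightarrow> hat (\<lambda>w. c * a w) X = c * hat a X"
  using Aset_lincomb[OF assms assms, where c = c and d = 0] by auto

lemma fr_outside: "w \<notin> Dn \<Longrightarrow> fr P Q w = 0"
  by (simp add: fr_def)

lemma fr_Aset: "fr P Q \<in> Aset" and hat_fr: "X \<in> Zhat \<Longrightarrow> hat (fr P Q) X = frh P Q X"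
  by (rule Aset_hatI[OF frh_Ohat[of P Q]]; simp add: fr_DeltaD fr_outside)+

text \<open>For infinite \<open>I\<close> the sum is 0 by convention, which is what lets
  \<open>psum_Aset\<close> and \<open>hat_psum\<close> hold for every index set.\<close>

definition psum :: "(('n::finite \<Rightarrow> nat) \<times> ('n \<Rightarrow> nat) \<Rightarrow> complex) \<Rightarrow> (('n \<Rightarrow> nat) \<times> ('n \<Rightarrow> nat)) set \<Rightarrow> complex^'n \<Rightarrow> complex" where
  "psum c I = (\<lambda>w. \<Sum>PQ\<in>I. c PQ * fr (fst PQ) (snd PQ) w)"

lemma zero_Aset: "(\<lambda>w. 0) \<in> Aset" and hat_zero: "X \<in> Zhat \<Longrightarrow> hat (\<lambda>w. 0) X = 0"
  using Aset_cmult(1)[OF fr_Aset, where c = 0] Aset_cmult(2)[OF fr_Aset, where c = 0 and X = X] by simp_all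

lemma psum_insert:
  "finite I \<Longrightarrow> PQ \<notin> I \<Longrightarrow> psum c (insert PQ I) = (\<lambda>w. c PQ * fr (fst PQ) (snd PQ) w + 1 * psum c I w)"
  by (simp add: psum_def)

lemma psum_Aset: "psum c I \<in> Aset"
proof (induction I rule: infinite_finite_induct)
  case (insert PQ I)
  then show ?case unfolding psum_insert[OF insert.hyps] by (intro Aset_lincomb fr_Aset)
qed (auto simp: psum_def zero_Aset)

lemma hat_psum:
  assumes "X \<in> Zhat"
  shows "hat (psum c I) X = (\<Sum>PQ\<in>I. c PQ * frh (fst PQ) (snd PQ) X)"
proof (induction I rule: infinite_finite_induct)
  case (insert PQ I)
  then show ?case
    using psum_insert[OF insert.hyps, of c] Aset_lincomb(2)[OF fr_Aset psum_Aset assms, of "c PQ" "fst PQ" "snd PQ" 1 c I]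
    by (simp add: hat_fr[OF assms])
qed (auto simp: psum_def hat_zero assms)

section \<open>Seminorms of compact sets and continuity of the coefficients\<close>

lemma hat_bdd_above:
  assumes "a \<in> Aset" "K \<in> compacts" shows "bdd_above ((\<lambda>X. cmod (hat a X)) ` K)"
proof -
  have "continuous_on Zhat (hat a)" using AsetD(1)[OF assms(1)] lhol_continuous_on by (auto simp: Ohat_iff)
  then have "compact ((\<lambda>X. cmod (hat a X)) ` K)"
    using assms(2) by (intro compact_continuous_image continuous_on_norm)
      (auto simp: compacts_def intro: continuous_on_subset)
  then show ?thesis by (intro bounded_imp_bdd_above compact_imp_bounded)
qed

lemma semiK_upper:
  assumes "a \<in> Aset" "K \<in> compacts" "X \<in> K" shows "cmod (hat a X) \<le> semiK K a"
  unfolding semiK_def by (rule cSUP_upper[OF assms(3) hat_bdd_above[OF assms(1,2)]])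

lemma semiK_least:
  assumes "K \<in> compacts" "\<And>X. X \<in> K \<Longrightarrow> cmod (hat a X) \<le> B" shows "semiK K a \<le> B"
  unfolding semiK_def using assms by (intro cSUP_least) (auto simp: compacts_def)

lemma semiK_nonneg: "a \<in> Aset \<Longrightarrow> K \<in> compacts \<Longrightarrow> 0 \<le> semiK K a"
  using semiK_upper[of a K] norm_ge_zero order_trans unfolding compacts_def by blast

lemma compacts_Zhat: "K \<in> compacts \<Longrightarrow> X \<in> K \<Longrightarrow> X \<in> Zhat"
  by (auto simp: compacts_def)

lemma semiK_cmult: "a \<in> Aset \<Longrightarrow> K \<in> compacts \<Longrightarrow> semiK K (\<lambda>w. c * a w) \<le> cmod c * semiK K a"
  by (rule semiK_least) (auto simp: Aset_cmult(2) compacts_Zhat norm_mult intro!: mult_left_mono semiK_upper)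

lemma semiK_triangle:
  assumes "a \<in> Aset" "b \<in> Aset" "c \<in> Aset" "K \<in> compacts"
  shows "semiK K (\<lambda>w. a w - c w) \<le> semiK K (\<lambda>w. a w - b w) + semiK K (\<lambda>w. b w - c w)"
proof (rule semiK_least[OF assms(4)])
  fix X assume X: "X \<in> K"
  have Z: "X \<in> Zhat" by (rule compacts_Zhat[OF assms(4) X])
  have "cmod (hat (\<lambda>w. a w - c w) X) = cmod (hat (\<lambda>w. a w - b w) X + hat (\<lambda>w. b w - c w) X)"
    by (simp add: Aset_diff(2) assms Z)
  also have "\<dots> \<le> cmod (hat (\<lambda>w. a w - b w) X) + cmod (hat (\<lambda>w. b w - c w) X)" by (rule norm_triangle_ineq)
  also have "\<dots> \<le> semiK K (\<lambda>w. a w - b w) + semiK K (\<lambda>w. b w - c w)"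
    by (intro add_mono semiK_upper Aset_diff assms X)
  finally show "cmod (hat (\<lambda>w. a w - c w) X) \<le> semiK K (\<lambda>w. a w - b w) + semiK K (\<lambda>w. b w - c w)" .
qed

text \<open>The compact set that carries the Cauchy integrals of both charts at radius
  \<open>R\<close>.\<close>

definition chart_torus :: "real \<Rightarrow> ('n::finite) hpt set" where
  "chart_torus R = (\<lambda>z. chart_sy (vl z) (vr z)) ` torus R UNIV \<union> (\<lambda>z. chart_xt (vl z) (vr z)) ` torus R UNIV"

lemma torus_nonempty: "0 < R \<Longrightarrow> torus R A \<noteq> {}"
  unfolding torus_def by (auto intro!: exI[of _ "\<lambda>_. of_real R"])

lemma chart_torus_compacts: "0 < R \<Longrightarrow> chart_torus R \<in> compacts"
  unfolding compacts_def chart_torus_def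
  by (auto intro!: compact_Un compact_continuous_image compact_torus simp: chart_in_Zhat torus_nonempty)
    (auto simp: chart_sy_def chart_xt_def intro!: continuous_on_Pair continuous_on_add continuous_on_const continuous_on_vl_vr)

text \<open>Cauchy's estimate in either chart, after moving the coefficient from radius 1 to radius
  \<open>R\<close>. This is the continuity of the coefficient functionals on
  \<open>Aset\<close>.\<close>

lemma norm_ecoef_hat_le:
  fixes a :: "complex^'n::finite \<Rightarrow> complex"
  assumes a: "a \<in> Aset" and R: "0 < R"
  shows "cmod (ecoef (hat a) PQ) \<le> semiK (chart_torus R) a / R ^ (mabs (fst PQ) + mabs (snd PQ))"
proof -
  note E = entire_chart[OF AsetD(1)[OF a]]
  have B: "cmod (hat a (chart_sy (vl z) (vr z))) \<le> semiK (chart_torus R) a"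
    "cmod (hat a (chart_xt (vl z) (vr z))) \<le> semiK (chart_torus R) a" if "z \<in> torus R UNIV" for z
    by (intro semiK_upper a chart_torus_compacts R; use that in \<open>simp add: chart_torus_def\<close>)+
  have s0: "0 \<le> semiK (chart_torus R) a" by (rule semiK_nonneg[OF a chart_torus_compacts[OF R]])
  have "cmod (tcoef 1 klist (\<lambda>z. hat a (chart_sy (vl z) (vr z))) (jn PQ)) \<le> semiK (chart_torus R) a / R ^ mabs (jn PQ)"
    unfolding tcoef_radius[OF zero_less_one R klist E(1)]
    using E(1) by (intro norm_tcoef_le R klist s0 B) (auto simp: entire_def intro: continuous_on_subset)
  moreover have "cmod (tcoef 1 klist (\<lambda>z. hat a (chart_xt (vl z) (vr z))) (jn PQ)) \<le> semiK (chart_torus R) a / R ^ mabs (jn PQ)"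
    unfolding tcoef_radius[OF zero_less_one R klist E(2)]
    using E(2) by (intro norm_tcoef_le R klist s0 B) (auto simp: entire_def intro: continuous_on_subset)
  ultimately show ?thesis by (simp add: ecoef_def mabs_jn)
qed

lemma tcoef_lincomb:
  fixes g h :: "('k::finite \<Rightarrow> complex) \<Rightarrow> complex"
  assumes R: "0 < R" and ks: "set ks = UNIV"
    and g: "continuous_on (torus R UNIV) g" and h: "continuous_on (torus R UNIV) h"
  shows "tcoef R ks (\<lambda>z. c * g z + d * h z) m = c * tcoef R ks g m + d * tcoef R ks h m"
proof -
  let ?M = "\<lambda>z::'k \<Rightarrow> complex. \<Prod>k\<in>UNIV. z k ^ (m k + 1)"
  have c: "continuous_on (torus R UNIV) (\<lambda>z. g z / ?M z)" "continuous_on (torus R UNIV) (\<lambda>z. h z / ?M z)"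
    by (rule continuous_on_torus_div_monomial[OF R g] continuous_on_torus_div_monomial[OF R h])+
  have z: "(\<lambda>_. 0) \<in> torus R (UNIV - set ks)" by (simp add: ks)
  have "cints R ks (\<lambda>z. (c * g z + d * h z) / ?M z) (\<lambda>_. 0) =
      cints R ks (\<lambda>z. c * (g z / ?M z) + d * (h z / ?M z)) (\<lambda>_. 0)"
    by (simp only: add_divide_distrib times_divide_eq_right)
  also have "\<dots> = c * cints R ks (\<lambda>z. g z / ?M z) (\<lambda>_. 0) + d * cints R ks (\<lambda>z. h z / ?M z) (\<lambda>_. 0)"
    by (subst cints_add[OF R _ _ z])
      (auto simp only: cints_cmult[OF R c(1) z] cints_cmult[OF R c(2) z] intro!: continuous_on_mult continuous_on_const c)
  finally show ?thesis
    unfolding tcoef_def by (simp only: distrib_left mult.left_commute)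
qed

lemma ecoef_hat_lincomb:
  fixes a b :: "complex^'n::finite \<Rightarrow> complex"
  assumes a: "a \<in> Aset" and b: "b \<in> Aset"
  shows "ecoef (hat (\<lambda>w. c * a w + d * b w)) PQ = c * ecoef (hat a) PQ + d * ecoef (hat b) PQ"
proof -
  have *: "continuous_on (torus 1 UNIV) (\<lambda>z. hat u (chart_sy (vl z) (vr z)))"
    "continuous_on (torus 1 UNIV) (\<lambda>z. hat u (chart_xt (vl z) (vr z)))" if "u \<in> Aset" for u :: "complex^'n \<Rightarrow> complex"
    using entire_chart[OF AsetD(1)[OF that]] by (auto simp: entire_def intro: continuous_on_subset)
  show ?thesis
    unfolding ecoef_def Aset_lincomb(2)[OF a b chart_in_Zhat(1)] Aset_lincomb(2)[OF a b chart_in_Zhat(2)]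
      tcoef_lincomb[OF zero_less_one klist(2) *(1)[OF a] *(1)[OF b]]
      tcoef_lincomb[OF zero_less_one klist(2) *(2)[OF a] *(2)[OF b]]
    by simp
qed

lemma tcoef_sum_interchange:
  fixes g :: "('k::finite \<Rightarrow> complex) \<Rightarrow> complex"
  assumes R: "0 < R" and ks: "distinct ks" "set ks = UNIV"
    and f: "\<And>j. continuous_on (torus R UNIV) (f j)"
    and le: "\<And>j z. z \<in> torus R UNIV \<Longrightarrow> cmod (f j z) \<le> M j" and M: "M summable_on I"
    and g: "\<And>z. z \<in> torus R UNIV \<Longrightarrow> ((\<lambda>j. f j z) has_sum g z) I"
  shows "((\<lambda>j. tcoef R ks (f j) m) has_sum tcoef R ks g m) I"
  unfolding tcoef_def
proof (intro has_sum_cmult_right cints_has_sum[OF R, of UNIV])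
  let ?N = "\<lambda>z::'k \<Rightarrow> complex. \<Prod>k\<in>UNIV. z k ^ (m k + 1)"
  show "continuous_on (torus R UNIV) (\<lambda>z. f j z / ?N z)" for j
    by (rule continuous_on_torus_div_monomial[OF R f])
  show "cmod (f j z / ?N z) \<le> M j * (1 / R ^ mabs (\<lambda>k. m k + 1))" if z: "z \<in> torus R UNIV" for j z
    unfolding norm_divide norm_torus_monomial[OF z] using divide_right_mono[OF le[OF z]] R by simp
  show "(\<lambda>j. M j * (1 / R ^ mabs (\<lambda>k. m k + 1))) summable_on I" by (rule summable_on_cmult_left[OF M])
  show "((\<lambda>j. f j z / ?N z) has_sum g z / ?N z) I" if "z \<in> torus R UNIV" for z
    by (rule has_sum_divide_const[OF g[OF that]])
qed (simp add: ks)

lemma tcoef_monomial: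
  fixes m m' :: "'k::finite \<Rightarrow> nat"
  assumes R: "0 < R" and ks: "distinct ks" "set ks = UNIV"
  shows "tcoef R ks (\<lambda>z. \<Prod>k\<in>UNIV. z k ^ m' k) m = (if m = m' then 1 else 0)"
proof (rule tcoef_power_series[OF R ks])
  show "((\<lambda>m. (if m = m' then 1 else 0) * (\<Prod>k\<in>UNIV. z k ^ m k)) has_sum (\<Prod>k\<in>UNIV. z k ^ m' k)) UNIV"
    for z :: "'k \<Rightarrow> complex"
    by (rule has_sum_finite_neutralI[of "{m'}"]) auto
  show "(\<lambda>m. cmod (if m = m' then 1 else 0) * R ^ mabs m) summable_on UNIV"
    by (rule summable_on_cong_neutral[where T = "{m'}" and g = "\<lambda>m. R ^ mabs m", THEN iffD2]) auto
qed

section \<open>Biorthogonality of the coefficient integrals and the fundamental monomials\<close>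

lemma mabs_fun_upd_Suc: "mabs (P(i := Suc (P i))) = Suc (mabs P)"
proof -
  have "mabs (P(i := Suc (P i))) = (\<Sum>j\<in>UNIV. P j + (if j = i then 1 else 0))"
    unfolding mabs_def by (intro sum.cong) auto
  then show ?thesis by (simp only: sum.distrib sum.delta' finite mabs_def) simp
qed

lemma xpow_fun_upd_Suc: "xpow x (P(i := Suc (P i))) = x $ i * xpow x P"
proof -
  have "xpow x (P(i := Suc (P i))) = (\<Prod>j\<in>UNIV. (if j = i then x $ j else 1) * x $ j ^ P j)"
    unfolding xpow_def by (intro prod.cong) auto
  then show ?thesis by (simp only: prod.distrib prod.delta' finite xpow_def) simp
qed

lemma continuous_on_xpow_vl_vr:
  "continuous_on S (\<lambda>z. xpow (vl z) P)" "continuous_on S (\<lambda>z. xpow (vr z) P)"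
proof -
  have c: "continuous_on S (\<lambda>z. z k :: complex)" for k and S :: "('a + 'a \<Rightarrow> complex) set"
    by (rule continuous_on_subset[OF continuous_on_product_coordinates]) auto
  show "continuous_on S (\<lambda>z. xpow (vl z) P)" "continuous_on S (\<lambda>z. xpow (vr z) P)"
    unfolding xpow_def vl_vr_nth by (intro continuous_on_prod continuous_on_power c)+
qed

text \<open>Multiplication by x.y raises the degree in x and the degree in y by one each. The
  induction peels off one factor and absorbs its summand x_i y_i into the exponents.\<close>

lemma tcoef_monomial_dotp_power:
  fixes P Q P' Q' :: "'n::finite \<Rightarrow> nat"
  assumes R: "0 < R"
    and "tcoef R klist (\<lambda>z. xpow (vl z) P' * xpow (vr z) Q' * dotp (vl z) (vr z) ^ j) (jn (P, Q)) \<noteq> 0"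
  shows "mabs P = mabs P' + j \<and> mabs Q = mabs Q' + j"
  using assms(2)
proof (induction j arbitrary: P' Q')
  case 0
  have "(\<lambda>z. xpow (vl z) P' * xpow (vr z) Q' * dotp (vl z) (vr z) ^ 0) = (\<lambda>z. \<Prod>k\<in>UNIV. z k ^ jn (P', Q') k)"
    by (simp add: monomial_jn)
  with 0 have "jn (P, Q) = jn (P', Q')"
    by (simp add: tcoef_monomial[OF R klist] split: if_splits)
  then show ?case using bij_jn by (auto dest!: injD[OF bij_is_inj])
next
  case (Suc j)
  let ?f = "\<lambda>i z. xpow (vl z) (P'(i := Suc (P' i))) * xpow (vr z) (Q'(i := Suc (Q' i))) * dotp (vl z) (vr z) ^ j"
  have eq: "(\<lambda>z. xpow (vl z) P' * xpow (vr z) Q' * dotp (vl z) (vr z) ^ Suc j) = (\<lambda>z. \<Sum>i\<in>UNIV. ?f i z)"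
    unfolding xpow_fun_upd_Suc power_Suc dotp_def[of "vl _" "vr _"]
    by (simp add: fun_eq_iff sum_distrib_left sum_distrib_right mult_ac)
  have "((\<lambda>i. tcoef R klist (?f i) (jn (P, Q))) has_sum tcoef R klist (\<lambda>z. \<Sum>i\<in>UNIV. ?f i z) (jn (P, Q))) UNIV"
  proof (rule tcoef_sum_interchange[OF R klist])
    show c: "continuous_on (torus R UNIV) (?f i)" for i
      by (intro continuous_on_mult continuous_on_power continuous_on_vl_vr continuous_on_xpow_vl_vr)
    show "((\<lambda>i. ?f i z) has_sum (\<Sum>i\<in>UNIV. ?f i z)) UNIV" for z by (rule has_sum_finite) simp
    \<comment> \<open>The index set is finite, so the suprema over the compact torus are a summable
      majorant.\<close>
    show "cmod (?f i z) \<le> (SUP z\<in>torus R UNIV. cmod (?f i z))" if "z \<in> torus R UNIV" for i z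
      by (intro cSUP_upper that bounded_imp_bdd_above compact_imp_bounded compact_continuous_image
          continuous_on_norm c compact_torus)
  qed simp
  then have "tcoef R klist (\<lambda>z. \<Sum>i\<in>UNIV. ?f i z) (jn (P, Q)) = (\<Sum>i\<in>UNIV. tcoef R klist (?f i) (jn (P, Q)))"
    using has_sum_unique has_sum_finite[OF finite] by blast
  with Suc.prems eq obtain i where "tcoef R klist (?f i) (jn (P, Q)) \<noteq> 0"
    by (metis (no_types, lifting) sum.neutral)
  from Suc.IH[OF this] show ?case unfolding mabs_fun_upd_Suc by simp
qed


lemma tcoef_cmult:
  fixes g :: "('k::finite \<Rightarrow> complex) \<Rightarrow> complex"
  assumes "0 < R" "set ks = UNIV" "continuous_on (torus R UNIV) g"
  shows "tcoef R ks (\<lambda>z. c * g z) m = c * tcoef R ks g m"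
  using tcoef_lincomb[OF assms assms(3), of c 0] by simp

lemma coef_eq_tcoef:
  fixes a :: "complex^'n::finite \<Rightarrow> complex"
  shows "coef r a P Q = tcoef r klist (\<lambda>z. hat a (std_inv (vl z) (vr z)) *
    (1 - dotp (vl z) (vr z)) powi (int (max (mabs P) (mabs Q)) - 1)) (jn (P, Q))"
proof -
  have len: "length (klist :: ('n + 'n) list) = 2 * CARD('n)"
    using distinct_card[OF idx_list(1)[where 'n = 'n]] by (simp add: klist_def idx_list(2))
  have jn1: "jn (P, Q) k + 1 = jn (\<lambda>i. P i + 1, \<lambda>i. Q i + 1) k" for k
    by (cases k) (simp_all add: jn_def)
  show ?thesis
    unfolding coef_def tcoef_def len jn1 monomial_jn fst_conv snd_conv Let_def
      vl_def[symmetric] vr_def[symmetric] klist_def[symmetric] ..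
qed

text \<open>\<open>\<rho>\<close> bounds |x.y| on the torus of radius \<open>r\<close>, and
  \<open>\<rho>\<close> < 1 is the condition r < 1/sqrt n. It keeps 1 - x.y away from 0 and makes
  the binomial series of its powers converge.\<close>

context
  fixes r \<rho> :: real
  assumes r: "0 < r" and rho: "\<rho> = real CARD('n::finite) * r\<^sup>2" "\<rho> < 1"
begin

lemma torus_dotp_le: "z \<in> torus r UNIV \<Longrightarrow> cmod (dotp (vl z) (vr z :: complex^'n)) \<le> \<rho>"
  unfolding rho(1) by (rule dotp_bound) (auto simp: torus_def)

lemma torus_dotp_neq_1: "z \<in> torus r UNIV \<Longrightarrow> dotp (vl z) (vr z :: complex^'n) \<noteq> 1"
  using torus_dotp_le[of z] rho(2) by auto

lemma continuous_on_torus_one_minus_dotp_powi: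
  "continuous_on (torus r UNIV) (\<lambda>z. (1 - dotp (vl z) (vr z :: complex^'n)) powi e)"
  by (intro continuous_on_power_int continuous_on_diff continuous_on_const continuous_on_vl_vr)
    (auto dest: torus_dotp_neq_1)

lemma continuous_on_torus_frh:
  fixes P Q :: "'n \<Rightarrow> nat"
  shows "continuous_on (torus r UNIV) (\<lambda>z. frh P Q (std_inv (vl z) (vr z)))"
  unfolding frh_std_inv
  by (intro continuous_on_divide continuous_on_mult continuous_on_power continuous_on_diff continuous_on_const
      continuous_on_vl_vr continuous_on_xpow_vl_vr) (auto dest: torus_dotp_neq_1)

lemma gchoose_abs_summable: "(\<lambda>j. cmod ((a gchoose j) * complex_of_real \<rho> ^ j)) summable_on UNIV"
proof -
  have \<rho>0: "0 \<le> \<rho>" by (simp add: rho(1))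
  \<comment> \<open>A convergent power series converges absolutely strictly inside, so ordinary
    convergence is taken at a point between \<open>\<rho>\<close> and 1.\<close>
  define s where "s = (1 + \<rho>) / 2"
  have s: "\<rho> < s" "s < 1" "0 < s" using \<rho>0 rho(2) by (auto simp: s_def)
  have "summable (\<lambda>j. (a gchoose j) * complex_of_real s ^ j)"
    using gen_binomial_complex[of "of_real s" a] s by (auto simp: sums_iff)
  from powser_insidea[OF this, of "of_real \<rho>"]
  have "summable (\<lambda>j. cmod ((a gchoose j) * complex_of_real \<rho> ^ j))" using s \<rho>0 by simp
  then show ?thesis by (rule summable_nonneg_imp_summable_on) auto
qed

text \<open>The integrand is x^P' y^Q' (1 - x.y)^k up to the Cauchy denominator. In its binomial
  expansion the term (x.y)^j contributes only if |P| = |P'| + j and |Q| = |Q'| + j; then the maxima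
  also differ by j and k = j - 1. For j > 0 the coefficient is (j - 1) choose j = 0, which is the
  effect of the -1 in the exponent in \<open>coef\<close>. Only j = 0 remains, a plain
  monomial.\<close>

lemma tcoef_frh:
  fixes P Q P' Q' :: "'n \<Rightarrow> nat"
  shows "tcoef r klist (\<lambda>z. frh P' Q' (std_inv (vl z) (vr z)) *
      (1 - dotp (vl z) (vr z)) powi (int (max (mabs P) (mabs Q)) - 1)) (jn (P, Q)) =
    (if (P', Q') = (P, Q) then 1 else 0)"
proof -
  define k where "k = int (max (mabs P) (mabs Q)) - 1 - int (max (mabs P') (mabs Q'))"
  let ?J = "\<lambda>j z. xpow (vl z) P' * xpow (vr z) Q' * dotp (vl z) (vr z) ^ j"
  let ?c = "\<lambda>j. (of_int k gchoose j) * (-1) ^ j :: complex"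
  let ?m = "jn (P, Q)"
  let ?g = "\<lambda>z. frh P' Q' (std_inv (vl z) (vr z)) * (1 - dotp (vl z) (vr z)) powi (int (max (mabs P) (mabs Q)) - 1)"
  have \<rho>0: "0 \<le> \<rho>" by (simp add: rho(1))
  have cJ: "continuous_on (torus r UNIV) (?J j)" for j
    by (intro continuous_on_mult continuous_on_power continuous_on_vl_vr continuous_on_xpow_vl_vr)
  have "((\<lambda>j. tcoef r klist (\<lambda>z. ?c j * ?J j z) ?m) has_sum tcoef r klist ?g ?m) UNIV"
  proof (rule tcoef_sum_interchange[OF r klist])
    show "continuous_on (torus r UNIV) (\<lambda>z. ?c j * ?J j z)" for j
      by (intro continuous_on_mult continuous_on_const cJ)
    let ?M = "\<lambda>j. cmod ((of_int k gchoose j) * complex_of_real \<rho> ^ j) * r ^ mabs (jn (P', Q'))"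
    show "?M summable_on UNIV" by (intro summable_on_cmult_left gchoose_abs_summable)
    fix z :: "'n + 'n \<Rightarrow> complex" assume z: "z \<in> torus r UNIV"
    let ?u = "dotp (vl z) (vr z)"
    have u: "cmod ?u \<le> \<rho>" "?u \<noteq> 1" using torus_dotp_le[OF z] torus_dotp_neq_1[OF z] .
    have mono: "cmod (xpow (vl z) P' * xpow (vr z) Q') = r ^ mabs (jn (P', Q'))"
      using norm_torus_monomial[OF z, of "jn (P', Q')"] unfolding monomial_jn by simp
    have "cmod (?c j * ?J j z) = cmod (of_int k gchoose j) * cmod ?u ^ j * r ^ mabs (jn (P', Q'))" for j
      unfolding norm_mult[of _ "?u ^ j"] norm_mult[of "?c j"] mono by (simp add: norm_mult norm_power)
    also have "\<dots> j \<le> ?M j" for j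
      using u r \<rho>0 by (auto simp: norm_mult norm_power intro!: mult_mono power_mono)
    finally show "cmod (?c j * ?J j z) \<le> ?M j" for j .
    \<comment> \<open>The exponent may be negative, hence the generalised binomial series; its
      complex power agrees with the integer power because 1 - x.y is nonzero.\<close>
    have "((\<lambda>j. (of_int k gchoose j) * (- ?u) ^ j) has_sum (1 + - ?u) powr (of_int k)) UNIV"
    proof (rule norm_summable_imp_has_sum)
      show "(\<lambda>j. (of_int k gchoose j) * (- ?u) ^ j) sums (1 + - ?u) powr (of_int k)"
        using u rho(2) by (intro gen_binomial_complex) simp
      have "summable (\<lambda>j. cmod ((of_int k gchoose j) * complex_of_real \<rho> ^ j))"
        using gchoose_abs_summable summable_on_imp_summable by blast
      then show "summable (\<lambda>j. cmod ((of_int k gchoose j) * (- ?u) ^ j))"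
        by (rule summable_comparison_test'[where N = 0])
          (use u \<rho>0 in \<open>auto simp: norm_mult norm_power intro!: mult_left_mono power_mono\<close>)
    qed
    then have "((\<lambda>j. (xpow (vl z) P' * xpow (vr z) Q') * ((of_int k gchoose j) * (- ?u) ^ j)) has_sum
        (xpow (vl z) P' * xpow (vr z) Q') * (1 - ?u) powi k) UNIV"
      using u by (intro has_sum_cmult_right) (simp add: complex_powr_of_int)
    moreover have "(xpow (vl z) P' * xpow (vr z) Q') * ((of_int k gchoose j) * (- ?u) ^ j) = ?c j * ?J j z" for j
      by (subst power_minus) (simp add: mult_ac)
    moreover have "(xpow (vl z) P' * xpow (vr z) Q') * (1 - ?u) powi k = ?g z"
      unfolding k_def frh_std_inv using u by (simp add: power_int_diff[of _ _ "int _"])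
    ultimately show "((\<lambda>j. ?c j * ?J j z) has_sum ?g z) UNIV" by simp
  qed
  moreover have "tcoef r klist (\<lambda>z. ?c j * ?J j z) ?m = (if j = 0 \<and> (P', Q') = (P, Q) then 1 else 0)" for j
  proof -
    have *: "tcoef r klist (\<lambda>z. ?c j * ?J j z) ?m = ?c j * tcoef r klist (?J j) ?m"
      by (rule tcoef_cmult[OF r klist(2) cJ])
    show ?thesis
    proof (cases "j = 0")
      case True
      have "(\<lambda>z. xpow (vl z) P' * xpow (vr z) Q' * dotp (vl z) (vr z) ^ 0) = (\<lambda>z. \<Prod>k\<in>UNIV. z k ^ jn (P', Q') k)"
        by (simp add: monomial_jn)
      moreover have "jn (P, Q) = jn (P', Q') \<longleftrightarrow> (P', Q') = (P, Q)"
        using inj_eq[OF bij_is_inj[OF bij_jn]] by metis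
      ultimately show ?thesis using * True by (simp add: tcoef_monomial[OF r klist])
    next
      case False
      have "?c j = 0" if nz: "tcoef r klist (?J j) ?m \<noteq> 0"
      proof -
        have "k = int (j - 1)"
          using tcoef_monomial_dotp_power[OF r nz] False unfolding k_def by auto
        then have "of_int k gchoose j = (of_nat ((j - 1) choose j) :: complex)"
          by (simp add: binomial_gbinomial)
        also have "\<dots> = 0" using False by simp
        finally show ?thesis by simp
      qed
      then show ?thesis using * False by auto
    qed
  qed
  ultimately have "((\<lambda>j::nat. if j = 0 \<and> (P', Q') = (P, Q) then 1 else 0) has_sum tcoef r klist ?g ?m) UNIV"
    by simp
  moreover have "((\<lambda>j::nat. if j = 0 \<and> (P', Q') = (P, Q) then 1 else 0 :: complex) has_sum (if (P', Q') = (P, Q) then 1 else 0)) UNIV"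
    by (rule has_sum_finite_neutralI[of "{0}"]) auto
  ultimately show ?thesis using has_sum_unique by blast
qed

text \<open>Here |1 - x.y| >= 1 - \<open>\<rho>\<close>, and as 1/(1 - \<open>\<rho>\<close>) is at
  least 1 the exponent max(|P|, |Q|) may be raised to |P| + |Q|.\<close>

lemma frh_torus_bound:
  fixes P Q :: "'n \<Rightarrow> nat"
  assumes z: "z \<in> torus r UNIV"
  shows "cmod (frh P Q (std_inv (vl z) (vr z))) \<le> (r / (1 - \<rho>)) ^ (mabs P + mabs Q)"
proof -
  let ?u = "dotp (vl z) (vr z)"
  have "1 - \<rho> \<le> cmod (1 - ?u)"
    using torus_dotp_le[OF z] norm_triangle_ineq2[of 1 ?u] by simp
  then have "1 / cmod (1 - ?u) ^ max (mabs P) (mabs Q) \<le> 1 / (1 - \<rho>) ^ max (mabs P) (mabs Q)"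
    using rho(2) by (intro divide_left_mono power_mono) (auto intro!: mult_pos_pos zero_less_power)
  also have "\<dots> = (1 / (1 - \<rho>)) ^ max (mabs P) (mabs Q)" by (simp add: power_divide)
  also have "\<dots> \<le> (1 / (1 - \<rho>)) ^ (mabs P + mabs Q)"
    using rho by (intro power_increasing) auto
  finally have le: "1 / cmod (1 - ?u) ^ max (mabs P) (mabs Q) \<le> (1 / (1 - \<rho>)) ^ (mabs P + mabs Q)" .
  have "cmod (xpow (vl z) P * xpow (vr z) Q) = r ^ (mabs P + mabs Q)"
    using norm_torus_monomial[OF z, of "jn (P, Q)"] unfolding monomial_jn mabs_jn by simp
  then have "cmod (frh P Q (std_inv (vl z) (vr z))) = r ^ (mabs P + mabs Q) * (1 / cmod (1 - ?u) ^ max (mabs P) (mabs Q))"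
    unfolding frh_std_inv norm_divide norm_power by simp
  also have "\<dots> \<le> r ^ (mabs P + mabs Q) * (1 / (1 - \<rho>)) ^ (mabs P + mabs Q)"
    using r by (intro mult_left_mono le) auto
  finally show ?thesis by (simp add: power_divide)
qed

text \<open>The expansion in fundamental monomials is integrated term by term against the kernel of
  \<open>coef\<close>, and biorthogonality leaves one term. In particular the integrals do not
  depend on \<open>r\<close>.\<close>

lemma coef_eq_ecoef:
  fixes a :: "complex^'n \<Rightarrow> complex"
  assumes a: "a \<in> Aset"
  shows "coef r a P Q = ecoef (hat a) (P, Q)"
proof -
  let ?e = "int (max (mabs P) (mabs Q)) - 1"
  let ?p = "\<lambda>z. (1 - dotp (vl z) (vr z :: complex^'n)) powi ?e"
  let ?h = "\<lambda>PQ z. frh (fst PQ) (snd PQ) (std_inv (vl z) (vr z)) * ?p z"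
  let ?M = "r / (1 - \<rho>)"
  have "bounded (?p ` torus r UNIV)"
    by (intro compact_imp_bounded compact_continuous_image compact_torus continuous_on_torus_one_minus_dotp_powi)
  then obtain C where C: "\<And>z. z \<in> torus r UNIV \<Longrightarrow> cmod (?p z) \<le> C"
    unfolding bounded_iff by blast
  have ch: "continuous_on (torus r UNIV) (?h PQ)" for PQ
    by (intro continuous_on_mult continuous_on_torus_frh continuous_on_torus_one_minus_dotp_powi)
  have "((\<lambda>PQ. tcoef r klist (\<lambda>z. ecoef (hat a) PQ * ?h PQ z) (jn (P, Q))) has_sum
      tcoef r klist (\<lambda>z. hat a (std_inv (vl z) (vr z)) * ?p z) (jn (P, Q))) UNIV"
  proof (rule tcoef_sum_interchange[OF r klist])
    show "continuous_on (torus r UNIV) (\<lambda>z. ecoef (hat a) PQ * ?h PQ z)" for PQ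
      by (intro continuous_on_mult[OF continuous_on_const] ch)
    show "(\<lambda>PQ. cmod (ecoef (hat a) PQ) * ?M ^ (mabs (fst PQ) + mabs (snd PQ)) * C) summable_on UNIV"
      using r rho by (intro summable_on_cmult_left ecoef_summable AsetD a) auto
    fix z :: "'n + 'n \<Rightarrow> complex" assume z: "z \<in> torus r UNIV"
    show "cmod (ecoef (hat a) PQ * ?h PQ z) \<le> cmod (ecoef (hat a) PQ) * ?M ^ (mabs (fst PQ) + mabs (snd PQ)) * C" for PQ
      unfolding norm_mult mult.assoc using r rho(2)
      by (intro mult_left_mono mult_mono frh_torus_bound C z) auto
    have "((\<lambda>PQ. ecoef (hat a) PQ * frh (fst PQ) (snd PQ) (std_inv (vl z) (vr z)) * ?p z) has_sum
        hat a (std_inv (vl z) (vr z)) * ?p z) UNIV"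
      by (intro has_sum_cmult_left ecoef_has_sum_std AsetD a torus_dotp_neq_1 z)
    then show "((\<lambda>PQ. ecoef (hat a) PQ * ?h PQ z) has_sum hat a (std_inv (vl z) (vr z)) * ?p z) UNIV"
      by (simp only: mult.assoc)
  qed
  moreover have "tcoef r klist (\<lambda>z. ecoef (hat a) PQ * ?h PQ z) (jn (P, Q)) =
      (if PQ = (P, Q) then ecoef (hat a) (P, Q) else 0)" for PQ
    unfolding tcoef_cmult[OF r klist(2) ch] tcoef_frh by auto
  ultimately have "((\<lambda>PQ. if PQ = (P, Q) then ecoef (hat a) (P, Q) else 0) has_sum coef r a P Q) UNIV"
    by (simp add: coef_eq_tcoef)
  moreover have "((\<lambda>PQ. if PQ = (P, Q) then ecoef (hat a) (P, Q) else 0) has_sum ecoef (hat a) (P, Q)) UNIV"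
    by (rule has_sum_finite_neutralI[of "{(P, Q)}"]) auto
  ultimately show ?thesis using has_sum_unique by blast
qed

text \<open>Biorthogonality carried over from the integrals to \<open>ecoef\<close>. As
  \<open>hat (fr P Q)\<close> and \<open>frh P Q\<close> are known to agree only on
  \<open>Zhat\<close>, the integrands are compared on the torus alone.\<close>

lemma ecoef_hat_fr:
  fixes P Q :: "'n \<Rightarrow> nat"
  shows "ecoef (hat (fr P Q)) PQ = (if PQ = (P, Q) then 1 else 0)"
proof -
  have "tcoef r klist (\<lambda>z. hat (fr P Q) (std_inv (vl z) (vr z)) *
      (1 - dotp (vl z) (vr z)) powi (int (max (mabs (fst PQ)) (mabs (snd PQ))) - 1)) (jn PQ) =
    tcoef r klist (\<lambda>z. frh P Q (std_inv (vl z) (vr z)) *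
      (1 - dotp (vl z) (vr z)) powi (int (max (mabs (fst PQ)) (mabs (snd PQ))) - 1)) (jn PQ)"
    unfolding tcoef_def
    by (intro arg_cong2[where f = "(*)"] refl cints_cong[OF r])
      (simp add: hat_fr std_inv_in_Zhat torus_dotp_neq_1 torus_def klist)
  then show ?thesis
    using coef_eq_ecoef[OF fr_Aset, of P Q "fst PQ" "snd PQ"] tcoef_frh[of P Q "fst PQ" "snd PQ"]
    by (auto simp: coef_eq_tcoef)
qed

text \<open>Linear independence of the fundamental monomials. The radius is absent from the equation
  but present in the proof through the integrals; \<open>ecoef_hat_psum\<close> inserts a concrete
  one.\<close>

lemma ecoef_hat_psum_radius:
  fixes c :: "('n \<Rightarrow> nat) \<times> ('n \<Rightarrow> nat) \<Rightarrow> complex"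
  assumes "finite I"
  shows "ecoef (hat (psum c I)) PQ = (if PQ \<in> I then c PQ else 0)"
  using assms
proof (induction I rule: finite_induct)
  case empty
  \<comment> \<open>The zero function as a combination with zero coefficients, so that linearity of
    \<open>ecoef\<close> covers the empty sum.\<close>
  have "(\<lambda>w::complex^'n. 0 * fr (\<lambda>_. 0) (\<lambda>_. 0) w + 0 * fr (\<lambda>_. 0) (\<lambda>_. 0) w) = psum c {}"
    by (simp add: psum_def)
  then show ?case using ecoef_hat_lincomb[OF fr_Aset fr_Aset, of 0 "\<lambda>_. 0" "\<lambda>_. 0" 0 "\<lambda>_. 0" "\<lambda>_. 0" PQ] by simp
next
  case (insert x I)
  then show ?case
    unfolding psum_insert[OF insert.hyps] ecoef_hat_lincomb[OF fr_Aset psum_Aset] ecoef_hat_fr by auto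
qed

end

section \<open>The two topologies\<close>

lemma psum_add:
  assumes "finite I" "finite J"
  shows "\<exists>e L. finite L \<and> (\<lambda>w. psum c I w + psum d J w) = psum e L"
proof (intro exI conjI)
  let ?e = "\<lambda>PQ. (if PQ \<in> I then c PQ else 0) + (if PQ \<in> J then d PQ else 0)"
  show "finite (I \<union> J)" using assms by simp
  show "(\<lambda>w. psum c I w + psum d J w) = psum ?e (I \<union> J)"
  proof
    fix w
    have *: "(\<Sum>PQ\<in>I \<union> J. (if PQ \<in> S then f PQ else 0) * fr (fst PQ) (snd PQ) w) = psum f S w"
      if "S \<subseteq> I \<union> J" for S f
      unfolding psum_def using assms that by (intro sum.mono_neutral_cong_right) auto
    show "psum c I w + psum d J w = psum ?e (I \<union> J) w"
      using *[of I c] *[of J d] by (simp add: psum_def[of ?e] distrib_right sum.distrib)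
  qed
qed

lemma psum_cmult: "(\<lambda>w. a * psum c I w) = psum (\<lambda>PQ. a * c PQ) I"
  by (simp add: psum_def sum_distrib_left mult.assoc)

lemma fr_eq_psum: "fr P Q = psum (\<lambda>_. 1) {(P, Q)}"
  by (simp add: psum_def)

definition Pspan :: "(complex^'n::finite \<Rightarrow> complex) set" where
  "Pspan = {a. \<exists>c I. finite I \<and> a = psum c I}"

lemma Pspan_add: "a \<in> Pspan \<Longrightarrow> b \<in> Pspan \<Longrightarrow> (\<lambda>w. a w + b w) \<in> Pspan"
  using psum_add by (fastforce simp: Pspan_def)

lemma Pspan_cmult: "a \<in> Pspan \<Longrightarrow> (\<lambda>w. c * a w) \<in> Pspan"
  using psum_cmult by (fastforce simp: Pspan_def)

lemma Pspan_zero: "(\<lambda>w. 0) \<in> Pspan"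
  by (auto simp: Pspan_def psum_def intro!: exI[of _ "{}"])

lemma Pspan_sum: "(\<And>i. i \<in> I \<Longrightarrow> f i \<in> Pspan) \<Longrightarrow> (\<lambda>w. \<Sum>i\<in>I. f i w) \<in> Pspan"
  by (induction I rule: infinite_finite_induct) (auto intro: Pspan_zero Pspan_add)

lemma fr_Pspan: "fr P Q \<in> Pspan"
  unfolding Pspan_def fr_eq_psum by blast

text \<open>The relation \<open>p\<^sup>0 q\<^sup>0 = 1 + \<Sum> p\<^sup>i q\<^sup>i\<close> lowers both zeroth exponents simultaneously.\<close>

lemma fPQ_Suc_Suc:
  fixes P Q :: "'n::finite \<Rightarrow> nat"
  shows "fPQ (Suc p, P) (Suc q, Q) w = fPQ (p, P) (q, Q) w +
    (\<Sum>i\<in>UNIV. fPQ (p, P(i := Suc (P i))) (q, Q(i := Suc (Q i))) w)"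
proof (cases "w \<in> Dn")
  case True
  define D where "D = complex_of_real (1 - wnorm2 w)"
  have D: "D \<noteq> 0" using True by (simp add: D_def Dn_def)
  have dot: "dotp w (vconj w) = 1 - D" by (simp add: dotp_vconj D_def)
  let ?m = "xpow w P * xpow (vconj w) Q" and ?N = "p + mabs P"
  have "(\<Sum>i\<in>UNIV. fPQ (p, P(i := Suc (P i))) (q, Q(i := Suc (Q i))) w) = (\<Sum>i\<in>UNIV. w $ i * vconj w $ i) * (?m / D ^ Suc ?N)"
    unfolding fPQ_def fst_conv snd_conv mabs_fun_upd_Suc xpow_fun_upd_Suc D_def[symmetric] sum_distrib_right
    using True by (intro sum.cong refl) (simp add: mult_ac)
  also have "\<dots> = (1 - D) * (?m / D ^ Suc ?N)"
    using dot by (simp add: dotp_def)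
  finally have sum: "(\<Sum>i\<in>UNIV. fPQ (p, P(i := Suc (P i))) (q, Q(i := Suc (Q i))) w) = (1 - D) * (?m / D ^ Suc ?N)" .
  have "fPQ (Suc p, P) (Suc q, Q) w = ?m / D ^ Suc ?N" "fPQ (p, P) (q, Q) w = ?m / D ^ ?N"
    using True by (simp_all add: fPQ_def D_def)
  then show ?thesis
    unfolding sum using D by (simp add: field_simps)
qed (simp add: fPQ_def)

text \<open>Lowering both zeroth exponents ends when one of them is 0; then the denominator has
  exponent max(|P|, |Q|) and the function is a fundamental monomial.\<close>

lemma fPQ_Pspan:
  fixes P Q :: "'n::finite \<Rightarrow> nat"
  assumes "p + mabs P = q + mabs Q"
  shows "fPQ (p, P) (q, Q) \<in> Pspan"
  using assms
proof (induction p arbitrary: q P Q)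
  case 0
  then have "fPQ (0, P) (q, Q) = fr P Q"
    by (auto simp: fun_eq_iff fPQ_def fr_def max_def)
  then show ?case by (simp add: fr_Pspan)
next
  case (Suc p)
  show ?case
  proof (cases q)
    case 0
    with Suc.prems have "fPQ (Suc p, P) (q, Q) = fr P Q"
      by (auto simp: fun_eq_iff fPQ_def fr_def max_def)
    then show ?thesis by (simp add: fr_Pspan)
  next
    case (Suc q')
    have "(\<lambda>w. fPQ (p, P) (q', Q) w + (\<Sum>i\<in>UNIV. fPQ (p, P(i := Suc (P i))) (q', Q(i := Suc (Q i))) w)) \<in> Pspan"
    proof (intro Pspan_add Pspan_sum)
      show "fPQ (p, P) (q', Q) \<in> Pspan" using Suc.prems \<open>q = Suc q'\<close> by (intro Suc.IH) simp
      show "fPQ (p, P(i := Suc (P i))) (q', Q(i := Suc (Q i))) \<in> Pspan" for i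
        using Suc.prems \<open>q = Suc q'\<close> by (intro Suc.IH) (unfold mabs_fun_upd_Suc, simp)
    qed
    also have "(\<lambda>w. fPQ (p, P) (q', Q) w + (\<Sum>i\<in>UNIV. fPQ (p, P(i := Suc (P i))) (q', Q(i := Suc (Q i))) w)) = fPQ (Suc p, P) (q, Q)"
      by (simp add: \<open>q = Suc q'\<close> fPQ_Suc_Suc fun_eq_iff)
    finally show ?thesis .
  qed
qed

lemma Pset_eq_Pspan: "(Pset :: (complex^'n::finite \<Rightarrow> complex) set) = Pspan"
proof
  show "(Pset :: (complex^'n \<Rightarrow> complex) set) \<subseteq> Pspan"
  proof
    fix a :: "complex^'n \<Rightarrow> complex" assume "a \<in> Pset"
    then obtain S c where S: "S \<subseteq> {(P, Q). fst P + mabs (snd P) = fst Q + mabs (snd Q)}"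
      and a: "a = (\<lambda>w. \<Sum>(P, Q)\<in>S. c (P, Q) * fPQ P Q w)" by (auto simp: Pset_def)
    have "fPQ (fst PQ) (snd PQ) \<in> Pspan" if "PQ \<in> S" for PQ
    proof -
      have "fst (fst PQ) + mabs (snd (fst PQ)) = fst (snd PQ) + mabs (snd (snd PQ))"
        using subsetD[OF S that] by (simp add: case_prod_unfold)
      from fPQ_Pspan[OF this] show ?thesis by simp
    qed
    then have "(\<lambda>w. \<Sum>PQ\<in>S. c PQ * fPQ (fst PQ) (snd PQ) w) \<in> Pspan"
      by (intro Pspan_sum Pspan_cmult)
    then show "a \<in> Pspan" by (simp add: a case_prod_unfold)
  qed
  show "(Pspan :: (complex^'n \<Rightarrow> complex) set) \<subseteq> Pset"
  proof
    fix a :: "complex^'n \<Rightarrow> complex" assume "a \<in> Pspan"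
    then obtain c I where I: "finite I" and a: "a = psum c I" by (auto simp: Pspan_def)
    \<comment> \<open>Homogenisation: the zeroth exponents fill both multi-indices up to the degree
      max(|P|, |Q|).\<close>
    define \<phi> where "\<phi> PQ = ((max (mabs (fst PQ)) (mabs (snd PQ)) - mabs (fst PQ), fst PQ),
      (max (mabs (fst PQ)) (mabs (snd PQ)) - mabs (snd PQ), snd PQ))" for PQ :: "('n \<Rightarrow> nat) \<times> ('n \<Rightarrow> nat)"
    define c' where "c' X = c (snd (fst X), snd (snd X))" for X :: "(nat \<times> ('n \<Rightarrow> nat)) \<times> (nat \<times> ('n \<Rightarrow> nat))"
    have inj: "inj_on \<phi> I" by (auto simp: inj_on_def \<phi>_def)
    have "fr P Q = fPQ (fst (\<phi> (P, Q))) (snd (\<phi> (P, Q)))" for P Q :: "'n \<Rightarrow> nat"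
      by (auto simp: \<phi>_def fr_def fPQ_def fun_eq_iff)
    then have "a = (\<lambda>w. \<Sum>PQ\<in>\<phi> ` I. c' PQ * fPQ (fst PQ) (snd PQ) w)"
      unfolding a psum_def sum.reindex[OF inj] by (simp add: c'_def \<phi>_def)
    then show "a \<in> Pset"
      unfolding Pset_def using I
      by (intro CollectI exI[of _ "\<phi> ` I"] exI[of _ c']) (auto simp: case_prod_unfold \<phi>_def)
  qed
qed

lemma Pset_diff: "a \<in> Pset \<Longrightarrow> b \<in> Pset \<Longrightarrow> (\<lambda>w. a w - b w) \<in> Pset"
  using Pspan_add[OF _ Pspan_cmult, of a b "-1"] by (simp add: Pset_eq_Pspan)

lemma Pset_subset_Aset: "Pset \<subseteq> Aset"
  using psum_Aset by (auto simp: Pset_eq_Pspan Pspan_def)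

lemma psum_Pset: "finite I \<Longrightarrow> psum c I \<in> Pset"
  by (auto simp: Pset_eq_Pspan Pspan_def)

lemma ecoef_hat_psum:
  fixes c :: "('n::finite \<Rightarrow> nat) \<times> ('n \<Rightarrow> nat) \<Rightarrow> complex"
  assumes "finite I"
  shows "ecoef (hat (psum c I)) PQ = (if PQ \<in> I then c PQ else 0)"
proof -
  \<comment> \<open>A radius admissible in every dimension N >= 1: N r^2 = 1/(4 N) < 1.\<close>
  define r where "r = 1 / (2 * real CARD('n))"
  have N: "1 \<le> real CARD('n)" by (simp add: Suc_leI)
  then have "real CARD('n) * r\<^sup>2 = 1 / (4 * real CARD('n))" by (simp add: r_def power2_eq_square)
  also have "\<dots> < 1" using N by (subst divide_less_eq_1_pos) linarith+
  finally have "0 < r" "real CARD('n) * r\<^sup>2 < 1" by (simp_all add: r_def)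
  then show ?thesis by (intro ecoef_hat_psum_radius[OF _ refl] assms)
qed

text \<open>\<open>pcoef\<close> is a choice of coefficients; applying \<open>ecoef\<close> to the
  finite sum that it represents determines it.\<close>

lemma pcoef_eq_ecoef:
  fixes a :: "complex^'n::finite \<Rightarrow> complex"
  assumes "a \<in> Pset"
  shows "pcoef a = ecoef (hat a)" "finite {PQ. ecoef (hat a) PQ \<noteq> 0}"
    "a = psum (ecoef (hat a)) {PQ. ecoef (hat a) PQ \<noteq> 0}"
proof -
  obtain c I where I: "finite I" and a: "a = psum c I" using assms by (auto simp: Pset_eq_Pspan Pspan_def)
  let ?d = "\<lambda>PQ. if PQ \<in> I then c PQ else 0"
  have "finite {PQ. ?d PQ \<noteq> 0}" using I by (auto intro: finite_subset[of _ I])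
  moreover have "a = psum ?d {PQ. ?d PQ \<noteq> 0}"
    unfolding a psum_def using I by (intro ext sum.mono_neutral_cong_right) auto
  ultimately have "\<exists>c. finite {PQ. c PQ \<noteq> 0} \<and> a = (\<lambda>w. \<Sum>PQ\<in>{PQ. c PQ \<noteq> 0}. c PQ * fr (fst PQ) (snd PQ) w)"
    unfolding psum_def by (intro exI[of _ ?d] conjI)
  from someI_ex[OF this] have p: "finite {PQ. pcoef a PQ \<noteq> 0}" "a = psum (pcoef a) {PQ. pcoef a PQ \<noteq> 0}"
    unfolding pcoef_def psum_def by blast+
  have "ecoef (hat a) PQ = pcoef a PQ" for PQ
    by (subst p(2), subst ecoef_hat_psum[OF p(1)]) simp
  then show eq: "pcoef a = ecoef (hat a)" by (simp add: fun_eq_iff)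
  show "finite {PQ. ecoef (hat a) PQ \<noteq> 0}" "a = psum (ecoef (hat a)) {PQ. ecoef (hat a) PQ \<noteq> 0}"
    using p unfolding eq .
qed

lemma summable_half_power:
  "(\<lambda>PQ::('n::finite \<Rightarrow> nat) \<times> ('n \<Rightarrow> nat). (1 / 2 :: real) ^ (mabs (fst PQ) + mabs (snd PQ))) summable_on UNIV"
proof -
  have "(\<lambda>m::'n + 'n \<Rightarrow> nat. (1 / 2 :: real) ^ mabs m) summable_on UNIV"
    by (rule summable_power_mabs) auto
  then have "(\<lambda>PQ::('n \<Rightarrow> nat) \<times> ('n \<Rightarrow> nat). (1 / 2 :: real) ^ mabs (jn PQ)) summable_on UNIV"
    by (subst summable_on_reindex_bij_betw[OF bij_jn, where f = "\<lambda>m. (1 / 2 :: real) ^ mabs m"])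
  then show ?thesis by (simp add: mabs_jn)
qed

text \<open>Cauchy's estimate at radius 2 \<open>\<rho>\<close> leaves a factor (1/2)^(|P|+|Q|),
  whose sum over all (P, Q) is finite. Adding 1 to that sum makes the constant visibly
  positive.\<close>

lemma normrho_le_semiK:
  assumes "0 < \<rho>"
  obtains C where "0 < C"
    "\<And>a :: complex^'n::finite \<Rightarrow> complex. a \<in> Pset \<Longrightarrow> normrho \<rho> a \<le> C * semiK (chart_torus (2 * \<rho>)) a"
proof -
  let ?h = "\<lambda>PQ::('n \<Rightarrow> nat) \<times> ('n \<Rightarrow> nat). (1 / 2 :: real) ^ (mabs (fst PQ) + mabs (snd PQ))"
  define C where "C = infsum ?h UNIV"
  have C0: "0 \<le> C" unfolding C_def by (rule infsum_nonneg) auto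
  have "normrho \<rho> a \<le> (C + 1) * semiK (chart_torus (2 * \<rho>)) a" if a: "a \<in> Pset" for a :: "complex^'n \<Rightarrow> complex"
  proof -
    let ?S = "{PQ. ecoef (hat a) PQ \<noteq> 0}" and ?s = "semiK (chart_torus (2 * \<rho>)) a"
    have A: "a \<in> Aset" using a Pset_subset_Aset by blast
    have s0: "0 \<le> ?s" using assms by (intro semiK_nonneg A chart_torus_compacts) simp
    have "normrho \<rho> a = (\<Sum>PQ\<in>?S. cmod (ecoef (hat a) PQ) * \<rho> ^ (mabs (fst PQ) + mabs (snd PQ)))"
      by (simp add: normrho_def pcoef_eq_ecoef(1)[OF a])
    also have "\<dots> \<le> (\<Sum>PQ\<in>?S. ?s * ?h PQ)"
    proof (rule sum_mono)
      fix PQ :: "('n \<Rightarrow> nat) \<times> ('n \<Rightarrow> nat)"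
      let ?N = "mabs (fst PQ) + mabs (snd PQ)"
      have "cmod (ecoef (hat a) PQ) * \<rho> ^ ?N \<le> ?s / (2 * \<rho>) ^ ?N * \<rho> ^ ?N"
        using norm_ecoef_hat_le[OF A, of "2 * \<rho>" PQ] assms by (intro mult_right_mono) auto
      also have "\<dots> = ?s * ?h PQ" using assms by (simp add: power_mult_distrib power_divide field_simps)
      finally show "cmod (ecoef (hat a) PQ) * \<rho> ^ ?N \<le> ?s * ?h PQ" .
    qed
    also have "\<dots> = ?s * sum ?h ?S" by (simp add: sum_distrib_left)
    also have "\<dots> \<le> ?s * C"
      unfolding C_def using pcoef_eq_ecoef(2)[OF a] summable_half_power s0
      by (intro mult_left_mono finite_sum_le_infsum) auto
    also have "\<dots> \<le> (C + 1) * ?s" using s0 by (simp add: algebra_simps)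
    finally show ?thesis .
  qed
  then show thesis using that[of "C + 1"] C0 by simp
qed

text \<open>The geometric rate of \<open>frh_bound\<close> serves as the radius of the norm, with
  constant 1.\<close>

lemma semiK_le_normrho:
  assumes K: "K \<in> compacts"
  obtains M where "0 < M"
    "\<And>a :: complex^'n::finite \<Rightarrow> complex. a \<in> Pset \<Longrightarrow> semiK K a \<le> normrho M a"
proof -
  have "compact K" using K by (simp add: compacts_def)
  from frh_bound[OF this] obtain M where M: "1 \<le> M" "\<And>P Q X. X \<in> K \<Longrightarrow> cmod (frh P Q X) \<le> M ^ (mabs P + mabs Q)"
    by blast
  have "semiK K a \<le> normrho M a" if a: "a \<in> Pset" for a
  proof (rule semiK_least[OF K])
    fix X assume X: "X \<in> K"
    let ?S = "{PQ. ecoef (hat a) PQ \<noteq> 0}"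
    have "hat a X = hat (psum (ecoef (hat a)) ?S) X" using pcoef_eq_ecoef(3)[OF a] by simp
    also have "\<dots> = (\<Sum>PQ\<in>?S. ecoef (hat a) PQ * frh (fst PQ) (snd PQ) X)"
      by (rule hat_psum[OF compacts_Zhat[OF K X]])
    finally have "cmod (hat a X) \<le> (\<Sum>PQ\<in>?S. cmod (ecoef (hat a) PQ) * cmod (frh (fst PQ) (snd PQ) X))"
      by (simp add: norm_mult[symmetric] norm_sum)
    also have "\<dots> \<le> normrho M a"
      unfolding normrho_def pcoef_eq_ecoef(1)[OF a] by (intro sum_mono mult_left_mono M(2) X) auto
    finally show "cmod (hat a X) \<le> normrho M a" .
  qed
  with M(1) show thesis by (intro that[of M]) auto
qed

section \<open>Comparison of the seminorm topologies and density\<close>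

lemma openin_seminorm_topology:
  "openin (seminorm_topology I p S) U \<longleftrightarrow> U \<subseteq> S \<and>
     (\<forall>x\<in>U. \<exists>F e. finite F \<and> F \<subseteq> I \<and> e > 0 \<and> {y\<in>S. \<forall>i\<in>F. p i (\<lambda>w. y w - x w) < e} \<subseteq> U)"
  (is "_ \<longleftrightarrow> ?P U")
proof -
  have "istopology ?P"
    unfolding istopology_def
  proof (intro conjI allI impI)
    fix U V assume U: "?P U" and V: "?P V"
    show "U \<inter> V \<subseteq> S" using U by blast
    show "\<forall>x\<in>U \<inter> V. \<exists>F e. finite F \<and> F \<subseteq> I \<and> 0 < e \<and> {y \<in> S. \<forall>i\<in>F. p i (\<lambda>w. y w - x w) < e} \<subseteq> U \<inter> V"
    proof
      fix x assume x: "x \<in> U \<inter> V"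
      from U x obtain F e where 1: "finite F" "F \<subseteq> I" "0 < e" "{y \<in> S. \<forall>i\<in>F. p i (\<lambda>w. y w - x w) < e} \<subseteq> U" by blast
      from V x obtain G d where 2: "finite G" "G \<subseteq> I" "0 < d" "{y \<in> S. \<forall>i\<in>G. p i (\<lambda>w. y w - x w) < d} \<subseteq> V" by blast
      show "\<exists>F e. finite F \<and> F \<subseteq> I \<and> 0 < e \<and> {y \<in> S. \<forall>i\<in>F. p i (\<lambda>w. y w - x w) < e} \<subseteq> U \<inter> V"
        using 1 2 by (intro exI[of _ "F \<union> G"] exI[of _ "min e d"]) auto
    qed
  next
    fix \<U> assume U: "\<forall>U\<in>\<U>. ?P U"
    then show "\<Union>\<U> \<subseteq> S" by blast
    show "\<forall>x\<in>\<Union>\<U>. \<exists>F e. finite F \<and> F \<subseteq> I \<and> 0 < e \<and> {y \<in> S. \<forall>i\<in>F. p i (\<lambda>w. y w - x w) < e} \<subseteq> \<Union>\<U>"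
    proof
      fix x assume "x \<in> \<Union>\<U>"
      then obtain V where V: "V \<in> \<U>" "x \<in> V" by blast
      with U obtain F e where "finite F" "F \<subseteq> I" "0 < e" "{y \<in> S. \<forall>i\<in>F. p i (\<lambda>w. y w - x w) < e} \<subseteq> V" by meson
      with V show "\<exists>F e. finite F \<and> F \<subseteq> I \<and> 0 < e \<and> {y \<in> S. \<forall>i\<in>F. p i (\<lambda>w. y w - x w) < e} \<subseteq> \<Union>\<U>"
        by (intro exI[of _ F] exI[of _ e]) auto
    qed
  qed
  then show ?thesis by (simp add: seminorm_topology_def topology_inverse')
qed

lemma topspace_seminorm_topology: "topspace (seminorm_topology I p S) = S"
proof
  show "topspace (seminorm_topology I p S) \<subseteq> S"
    using openin_topspace[of "seminorm_topology I p S"] unfolding openin_seminorm_topology by blast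
  have "openin (seminorm_topology I p S) S"
    unfolding openin_seminorm_topology by (auto intro!: exI[of _ "{}"] exI[of _ "1::real"])
  then show "S \<subseteq> topspace (seminorm_topology I p S)" by (rule openin_subset)
qed

lemma topspace_TA: "topspace TA = Aset"
  by (simp add: TA_def topspace_seminorm_topology)

lemma openin_TA_ball:
  assumes x: "x \<in> Aset" and K: "K \<in> compacts"
  shows "openin TA {y \<in> Aset. semiK K (\<lambda>w. y w - x w) < e}"
  unfolding TA_def openin_seminorm_topology
proof (intro conjI ballI)
  fix y assume y: "y \<in> {y \<in> Aset. semiK K (\<lambda>w. y w - x w) < e}"
  let ?d = "e - semiK K (\<lambda>w. y w - x w)"
  have "{z \<in> Aset. \<forall>i\<in>{K}. semiK i (\<lambda>w. z w - y w) < ?d} \<subseteq> {y \<in> Aset. semiK K (\<lambda>w. y w - x w) < e}"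
  proof
    fix z assume "z \<in> {z \<in> Aset. \<forall>i\<in>{K}. semiK i (\<lambda>w. z w - y w) < ?d}"
    then show "z \<in> {y \<in> Aset. semiK K (\<lambda>w. y w - x w) < e}"
      using semiK_triangle[of z y x K] x y K by auto
  qed
  then show "\<exists>F d. finite F \<and> F \<subseteq> compacts \<and> 0 < d \<and>
      {z \<in> Aset. \<forall>i\<in>F. semiK i (\<lambda>w. z w - y w) < d} \<subseteq> {y \<in> Aset. semiK K (\<lambda>w. y w - x w) < e}"
    using y K by (intro exI[of _ "{K}"] exI[of _ ?d]) auto
qed auto

lemma semiK_diff_self: "x \<in> Aset \<Longrightarrow> K \<in> compacts \<Longrightarrow> semiK K (\<lambda>w. x w - x w) \<le> 0"
  by (rule semiK_least) (auto simp: hat_zero compacts_Zhat)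

lemma subtopology_TA_Pset: "subtopology TA (Pset :: (complex^'n::finite \<Rightarrow> complex) set) = TP"
  unfolding topology_eq
proof (intro allI iffI)
  fix U :: "(complex^'n \<Rightarrow> complex) set"
  assume "openin (subtopology TA Pset) U"
  then obtain T where T: "openin TA T" "U = T \<inter> Pset" by (auto simp: openin_subtopology)
  show "openin TP U"
    unfolding TP_def openin_seminorm_topology
  proof (intro conjI ballI)
    show "U \<subseteq> Pset" using T by blast
    fix x assume x: "x \<in> U"
    then obtain F e where F: "finite F" "F \<subseteq> compacts" "0 < e" "{y \<in> Aset. \<forall>K\<in>F. semiK K (\<lambda>w. y w - x w) < e} \<subseteq> T"
      using T unfolding TA_def openin_seminorm_topology by blast
    have "\<forall>K\<in>F. \<exists>M>0. \<forall>a :: complex^'n \<Rightarrow> complex. a \<in> Pset \<longrightarrow> semiK K a \<le> normrho M a"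
      using F(2) by (meson semiK_le_normrho subsetD)
    then obtain M where M: "\<forall>K\<in>F. 0 < M K \<and> (\<forall>a :: complex^'n \<Rightarrow> complex. a \<in> Pset \<longrightarrow> semiK K a \<le> normrho (M K) a)"
      by metis
    have "{y \<in> Pset. \<forall>\<rho>\<in>M ` F. normrho \<rho> (\<lambda>w. y w - x w) < e} \<subseteq> U"
    proof
      fix y assume y: "y \<in> {y \<in> Pset. \<forall>\<rho>\<in>M ` F. normrho \<rho> (\<lambda>w. y w - x w) < e}"
      then have "(\<lambda>w. y w - x w) \<in> Pset" using x T by (intro Pset_diff) auto
      then have "\<forall>K\<in>F. semiK K (\<lambda>w. y w - x w) < e" using M y by fastforce
      then show "y \<in> U" using F(4) y T Pset_subset_Aset by blast
    qed
    then show "\<exists>F e. finite F \<and> F \<subseteq> {\<rho>. 0 < \<rho>} \<and> 0 < e \<and> {y \<in> Pset. \<forall>i\<in>F. normrho i (\<lambda>w. y w - x w) < e} \<subseteq> U"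
      using F M by (intro exI[of _ "M ` F"] exI[of _ e]) auto
  qed
next
  fix U :: "(complex^'n \<Rightarrow> complex) set"
  assume U: "openin TP U"
  \<comment> \<open>The largest open set of \<open>TA\<close> whose trace on \<open>Pset\<close>
    lies in \<open>U\<close>; it remains to see that it contains \<open>U\<close>.\<close>
  define T where "T = \<Union>{V. openin TA V \<and> V \<inter> Pset \<subseteq> U}"
  have "U \<subseteq> Pset" using U unfolding TP_def openin_seminorm_topology by blast
  have "x \<in> T" if x: "x \<in> U" for x
  proof -
    have xA: "x \<in> Aset" using x \<open>U \<subseteq> Pset\<close> Pset_subset_Aset by blast
    from x U obtain F e where F: "finite F" "F \<subseteq> {\<rho>. 0 < \<rho>}" "0 < e"
      "{y \<in> Pset. \<forall>\<rho>\<in>F. normrho \<rho> (\<lambda>w. y w - x w) < e} \<subseteq> U"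
      unfolding TP_def openin_seminorm_topology by blast
    have "\<forall>\<rho>\<in>F. \<exists>C>0. \<forall>a :: complex^'n \<Rightarrow> complex. a \<in> Pset \<longrightarrow> normrho \<rho> a \<le> C * semiK (chart_torus (2 * \<rho>)) a"
      using F(2) by (metis normrho_le_semiK mem_Collect_eq subsetD)
    then obtain C where C: "\<forall>\<rho>\<in>F. 0 < C \<rho> \<and> (\<forall>a :: complex^'n \<Rightarrow> complex. a \<in> Pset \<longrightarrow>
        normrho \<rho> a \<le> C \<rho> * semiK (chart_torus (2 * \<rho>)) a)"
      by metis
    let ?B = "\<lambda>\<rho>. {y \<in> Aset. semiK (chart_torus (2 * \<rho>)) (\<lambda>w. y w - x w) < e / C \<rho>}"
    \<comment> \<open>For empty \<open>F\<close> the intersection of the balls is everything;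
      intersecting with the whole space keeps the set open in \<open>TA\<close>.\<close>
    let ?V = "(\<Inter>\<rho>\<in>F. ?B \<rho>) \<inter> topspace TA"
    have K: "chart_torus (2 * \<rho>) \<in> compacts" if "\<rho> \<in> F" for \<rho>
      using that F(2) by (intro chart_torus_compacts) auto
    have "openin TA ?V"
      using F(1) K by (intro openin_INT openin_TA_ball xA) auto
    moreover have "x \<in> ?V"
    proof -
      have "semiK (chart_torus (2 * \<rho>)) (\<lambda>w. x w - x w) < e / C \<rho>" if "\<rho> \<in> F" for \<rho>
        using semiK_diff_self[OF xA K[OF that]] C F(3) that by (meson divide_pos_pos order_le_less_trans)
      then show ?thesis using xA by (simp add: topspace_TA)
    qed
    moreover have "?V \<inter> Pset \<subseteq> U"
    proof
      fix y assume y: "y \<in> ?V \<inter> Pset"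
      then have d: "(\<lambda>w. y w - x w) \<in> Pset" using x \<open>U \<subseteq> Pset\<close> by (intro Pset_diff) auto
      have "normrho \<rho> (\<lambda>w. y w - x w) < e" if \<rho>: "\<rho> \<in> F" for \<rho>
      proof -
        have "normrho \<rho> (\<lambda>w. y w - x w) \<le> C \<rho> * semiK (chart_torus (2 * \<rho>)) (\<lambda>w. y w - x w)"
          using C \<rho> d by blast
        also have "\<dots> < C \<rho> * (e / C \<rho>)"
          using C \<rho> y by (intro mult_strict_left_mono) auto
        also have "\<dots> = e" using C \<rho> by (metis nonzero_mult_div_cancel_left times_divide_eq_right less_irrefl)
        finally show ?thesis .
      qed
      then show "y \<in> U" using F(4) y by blast
    qed
    ultimately show ?thesis unfolding T_def by blast
  qed
  then have "U = T \<inter> Pset" using \<open>U \<subseteq> Pset\<close> by (auto simp: T_def)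
  moreover have "openin TA T" unfolding T_def by blast
  ultimately show "openin (subtopology TA Pset) U" by (auto simp: openin_subtopology)
qed

text \<open>Convergence in \<open>TA\<close> amounts to uniform convergence of the extensions on
  each of finitely many compact sets, and \<open>ecoef_infsum\<close> identifies the uniform limit
  with \<open>hat a\<close>.\<close>

lemma psum_limitin_TA:
  fixes a :: "complex^'n::finite \<Rightarrow> complex"
  assumes a: "a \<in> Aset"
  shows "limitin TA (psum (ecoef (hat a))) a (finite_subsets_at_top UNIV)"
  unfolding limitin_def
proof (intro conjI allI impI)
  show "a \<in> topspace TA" using a by (simp add: topspace_TA)
  fix U assume "openin TA U \<and> a \<in> U"
  then obtain F e where F: "finite F" "F \<subseteq> compacts" "0 < e" "{y \<in> Aset. \<forall>K\<in>F. semiK K (\<lambda>w. y w - a w) < e} \<subseteq> U"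
    unfolding TA_def openin_seminorm_topology by blast
  let ?s = "psum (ecoef (hat a))"
  have "\<forall>\<^sub>F I in finite_subsets_at_top UNIV. semiK K (\<lambda>w. ?s I w - a w) < e" if "K \<in> F" for K
  proof -
    have K: "K \<in> compacts" "compact K" using that F(2) by (auto simp: compacts_def)
    have "\<forall>\<^sub>F I in finite_subsets_at_top UNIV. \<forall>X\<in>K.
        dist (\<Sum>PQ\<in>I. ecoef (hat a) PQ * frh (fst PQ) (snd PQ) X) (\<Sum>\<^sub>\<infinity>PQ. ecoef (hat a) PQ * frh (fst PQ) (snd PQ) X) < e / 2"
      using uniform_limitD[OF ecoef_uniform_limit[OF AsetD(1)[OF a] K(2)], of "e / 2"] F(3) by simp
    then show ?thesis
    proof eventually_elim
      case (elim I)
      have "semiK K (\<lambda>w. ?s I w - a w) \<le> e / 2"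
      proof (rule semiK_least[OF K(1)])
        fix X assume X: "X \<in> K"
        then have Z: "X \<in> Zhat" by (rule compacts_Zhat[OF K(1)])
        show "cmod (hat (\<lambda>w. ?s I w - a w) X) \<le> e / 2"
          unfolding Aset_diff(2)[OF psum_Aset a Z] hat_psum[OF Z]
          using elim X unfolding ecoef_infsum[OF AsetD(1)[OF a] Z, symmetric] dist_norm by (auto intro: less_imp_le)
      qed
      then show ?case using F(3) by simp
    qed
  qed
  then have "\<forall>\<^sub>F I in finite_subsets_at_top UNIV. \<forall>K\<in>F. semiK K (\<lambda>w. ?s I w - a w) < e"
    by (simp add: eventually_ball_finite_distrib F(1))
  then show "\<forall>\<^sub>F I in finite_subsets_at_top UNIV. ?s I \<in> U"
    by eventually_elim (use F(4) psum_Aset in blast)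
qed

lemma closure_of_Pset: "TA closure_of (Pset :: (complex^'n::finite \<Rightarrow> complex) set) = Aset"
proof
  show "TA closure_of (Pset :: (complex^'n \<Rightarrow> complex) set) \<subseteq> Aset"
    using closure_of_subset_topspace topspace_TA by metis
  show "Aset \<subseteq> TA closure_of (Pset :: (complex^'n \<Rightarrow> complex) set)"
  proof
    fix a :: "complex^'n \<Rightarrow> complex" assume a: "a \<in> Aset"
    have "\<exists>y\<in>Pset. y \<in> T" if T: "a \<in> T" "openin TA T" for T
    proof -
      have "\<forall>\<^sub>F I in finite_subsets_at_top UNIV. psum (ecoef (hat a)) I \<in> T"
        using psum_limitin_TA[OF a] T by (auto simp: limitin_def)
      then obtain I where "finite I" "psum (ecoef (hat a)) I \<in> T"
        unfolding eventually_finite_subsets_at_top by blast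
      then show ?thesis using psum_Pset by blast
    qed
    then show "a \<in> TA closure_of Pset" using a by (auto simp: in_closure_of topspace_TA)
  qed
qed

section \<open>Continuous seminorms, absolute convergence and uniqueness\<close>

lemma cont_seminorm_bound:
  fixes p :: "(complex^'n::finite \<Rightarrow> complex) \<Rightarrow> real"
  assumes p: "cont_seminorm p"
  obtains C K where "0 < C" "K \<in> compacts" "\<And>a. a \<in> Aset \<Longrightarrow> 0 \<le> p a \<and> p a \<le> C * semiK K a"
proof -
  have sub: "p (\<lambda>w. a w + b w) \<le> p a + p b" if "a \<in> Aset" "b \<in> Aset" for a b
    using p that by (auto simp: cont_seminorm_def)
  have hom: "p (\<lambda>w. c * a w) = cmod c * p a" if "a \<in> Aset" for a c
    using p that by (auto simp: cont_seminorm_def)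
  have cont: "continuous_map TA euclideanreal p" using p by (auto simp: cont_seminorm_def)
  have p0: "p (\<lambda>w. 0) = 0" using hom[OF zero_Aset, of 0] by simp
  \<comment> \<open>0 = p(a + (-a)) <= p(a) + p(-a) = 2 p(a).\<close>
  have nonneg: "0 \<le> p a" if a: "a \<in> Aset" for a
    using sub[OF a Aset_cmult(1)[OF a, of "-1"]] hom[OF a, of "-1"] p0 by simp
  have "openin TA {a \<in> topspace TA. p a \<in> {..<1}}"
    by (rule openin_continuous_map_preimage[OF cont]) simp
  then have "\<exists>F e. finite F \<and> F \<subseteq> compacts \<and> e > 0 \<and>
      {y\<in>Aset. \<forall>i\<in>F. semiK i (\<lambda>w. y w - 0) < e} \<subseteq> {a \<in> topspace TA. p a \<in> {..<1}}"
    unfolding TA_def[symmetric] using zero_Aset p0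
    unfolding TA_def openin_seminorm_topology topspace_seminorm_topology by fastforce
  then obtain F e where F: "finite F" "F \<subseteq> compacts" "e > 0"
    "{y\<in>Aset. \<forall>i\<in>F. semiK i y < e} \<subseteq> {a \<in> topspace TA. p a \<in> {..<1}}"
    by auto
  \<comment> \<open>One compact set dominating all of \<open>F\<close>; the torus is added because
    \<open>F\<close> may be empty while members of \<open>compacts\<close> are not.\<close>
  define K where "K = chart_torus 1 \<union> \<Union>F"
  have "compact (\<Union>F)" using F by (intro compact_Union) (auto simp: compacts_def)
  then have K: "K \<in> compacts"
    using F(2) chart_torus_compacts[of 1] by (auto simp: compacts_def K_def intro!: compact_Un)
  have "p a \<le> semiK K a / e" if a: "a \<in> Aset" for a
  proof (rule field_le_epsilon)
    fix \<delta> :: real assume \<delta>: "0 < \<delta>"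
    \<comment> \<open>The added positive term makes rescaling by e / s possible even when
      \<open>semiK K a\<close> is 0; \<open>field_le_epsilon\<close> removes it.\<close>
    define s where "s = semiK K a + e * \<delta>"
    have s: "0 < s" "semiK K a < s" using semiK_nonneg[OF a K] mult_pos_pos[OF F(3) \<delta>] by (simp_all add: s_def)
    let ?b = "\<lambda>w. complex_of_real (e / s) * a w"
    have b: "?b \<in> Aset" by (rule Aset_cmult[OF a])
    have "semiK L ?b < e" if L: "L \<in> F" for L
    proof -
      have "semiK L ?b \<le> semiK K ?b"
        using L F(2) by (intro semiK_least semiK_upper b K) (auto simp: K_def)
      also have "\<dots> \<le> e / s * semiK K a"
        using semiK_cmult[OF a K, of "of_real (e / s)"] F(3) s by (simp add: norm_mult norm_divide)
      also have "\<dots> < e / s * s" using F(3) s by (intro mult_strict_left_mono) auto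
      finally show ?thesis using s by simp
    qed
    then have "p ?b < 1" using F(4) b by blast
    then have "e / s * p a < 1" using hom[OF a, of "of_real (e / s)"] F(3) s by (simp add: norm_divide)
    then show "p a \<le> semiK K a / e + \<delta>" using F(3) s by (simp add: s_def field_simps)
  qed
  then show thesis using F(3) K nonneg by (intro that[of "1 / e" K]) auto
qed

text \<open>A continuous seminorm is dominated by one compact set, on which the fundamental
  monomials grow at most geometrically; the coefficients are summable against every geometric
  rate.\<close>

lemma abs_expansion_ecoef:
  fixes a :: "complex^'n::finite \<Rightarrow> complex"
  assumes a: "a \<in> Aset"
  shows "abs_expansion (ecoef (hat a)) a"
  unfolding abs_expansion_def psum_def[symmetric]
proof (intro conjI allI impI psum_limitin_TA a)
  fix p :: "(complex^'n \<Rightarrow> complex) \<Rightarrow> real" assume "cont_seminorm p"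
  then obtain C K where C: "0 < C" "K \<in> compacts" "\<And>a. a \<in> Aset \<Longrightarrow> 0 \<le> p a \<and> p a \<le> C * semiK K a"
    using cont_seminorm_bound by blast
  have "compact K" using C(2) by (simp add: compacts_def)
  from frh_bound[OF this] obtain M where M: "1 \<le> M" "\<And>P Q X. X \<in> K \<Longrightarrow> cmod (frh P Q X) \<le> M ^ (mabs P + mabs Q)"
    by blast
  have le: "p (fr P Q) \<le> C * M ^ (mabs P + mabs Q)" for P Q
  proof -
    have "semiK K (fr P Q) \<le> M ^ (mabs P + mabs Q)"
      by (rule semiK_least[OF C(2)]) (simp add: hat_fr compacts_Zhat[OF C(2)] M(2))
    then show ?thesis using C(1,3) fr_Aset by (meson mult_left_mono order_trans less_imp_le)
  qed
  show "(\<lambda>PQ. cmod (ecoef (hat a) PQ) * p (fr (fst PQ) (snd PQ))) summable_on UNIV"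
  proof (rule summable_on_comparison_test)
    show "(\<lambda>PQ. cmod (ecoef (hat a) PQ) * M ^ (mabs (fst PQ) + mabs (snd PQ)) * C) summable_on UNIV"
      using M(1) by (intro summable_on_cmult_left ecoef_summable AsetD a) auto
    show "cmod (ecoef (hat a) PQ) * p (fr (fst PQ) (snd PQ)) \<le>
        cmod (ecoef (hat a) PQ) * M ^ (mabs (fst PQ) + mabs (snd PQ)) * C" for PQ
      using mult_left_mono[OF le[of "fst PQ" "snd PQ"] norm_ge_zero[of "ecoef (hat a) PQ"]] by (simp add: mult_ac)
    show "0 \<le> cmod (ecoef (hat a) PQ) * p (fr (fst PQ) (snd PQ))" for PQ
      using C(3)[OF fr_Aset] by (intro mult_nonneg_nonneg) auto
  qed
qed

text \<open>The coefficient functional is continuous, and on every partial sum whose index set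
  contains \<open>PQ\<close> its value is \<open>c PQ\<close>; hence \<open>c PQ\<close> is its
  value on the limit.\<close>

lemma abs_expansion_unique:
  fixes a :: "complex^'n::finite \<Rightarrow> complex"
  assumes a: "a \<in> Aset" and c: "abs_expansion c a"
  shows "c = ecoef (hat a)"
proof
  fix PQ :: "('n \<Rightarrow> nat) \<times> ('n \<Rightarrow> nat)"
  let ?K = "chart_torus 1 :: 'n hpt set"
  have K: "?K \<in> compacts" by (rule chart_torus_compacts) simp
  have "cmod (c PQ - ecoef (hat a) PQ) < e" if e: "0 < e" for e
  proof -
    let ?B = "{y \<in> Aset. semiK ?K (\<lambda>w. y w - a w) < e}"
    have "a \<in> ?B" using a semiK_diff_self[OF a K] e by simp
    then have B: "openin TA ?B \<and> a \<in> ?B" using openin_TA_ball[OF a K] by blast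
    have "limitin TA (psum c) a (finite_subsets_at_top UNIV)"
      using c unfolding abs_expansion_def psum_def[symmetric] by blast
    then have "\<forall>\<^sub>F I in finite_subsets_at_top UNIV. psum c I \<in> ?B"
      unfolding limitin_def using B by blast
    then obtain J where "finite J" "\<forall>I. finite I \<and> J \<subseteq> I \<and> I \<subseteq> UNIV \<longrightarrow> psum c I \<in> ?B"
      unfolding eventually_finite_subsets_at_top by (elim exE conjE)
    then have J: "finite J" "\<And>I. finite I \<Longrightarrow> J \<subseteq> I \<Longrightarrow> psum c I \<in> ?B" by simp_all
    \<comment> \<open>The neighbourhood is reached by every finite index set above \<open>J\<close>,
      so \<open>PQ\<close> can be forced into it.\<close>
    define I where "I = insert PQ J"
    have I: "finite I" "PQ \<in> I" using J(1) by (auto simp: I_def)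
    have IB: "psum c I \<in> ?B" by (rule J(2)[OF I(1)]) (auto simp: I_def)
    have "c PQ - ecoef (hat a) PQ = ecoef (hat (\<lambda>w. 1 * psum c I w + (- 1) * a w)) PQ"
      unfolding ecoef_hat_lincomb[OF psum_Aset a] ecoef_hat_psum[OF I(1)] using I(2) by simp
    also have "(\<lambda>w. 1 * psum c I w + (- 1) * a w) = (\<lambda>w. psum c I w - a w)" by simp
    finally have "cmod (c PQ - ecoef (hat a) PQ) \<le> semiK ?K (\<lambda>w. psum c I w - a w)"
      using norm_ecoef_hat_le[OF Aset_diff(1)[OF psum_Aset a], of 1] by simp
    also have "\<dots> < e" using IB by simp
    finally show ?thesis .
  qed
  then have "\<not> 0 < cmod (c PQ - ecoef (hat a) PQ)" by blast
  then show "c PQ = ecoef (hat a) PQ" by simp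
qed

theorem theorem3p16:
  fixes r :: real
  assumes "0 < r" and "r < 1 / sqrt (real CARD('n::finite))"
  shows "subtopology (TA :: (complex^'n \<Rightarrow> complex) topology) Pset = TP
    \<and> TA closure_of (Pset :: (complex^'n \<Rightarrow> complex) set) = Aset
    \<and> (\<forall>a\<in>(Aset :: (complex^'n \<Rightarrow> complex) set).
          abs_expansion (\<lambda>(P,Q). coef r a P Q) a
          \<and> (\<forall>c. abs_expansion c a \<longrightarrow> c = (\<lambda>(P,Q). coef r a P Q)))"
proof -
  have "r * sqrt (real CARD('n)) < 1" using assms(2) by (simp add: field_simps)
  then have "(r * sqrt (real CARD('n)))\<^sup>2 < 1"
    using assms(1) by (subst abs_square_less_1) (simp add: abs_mult)
  then have rho: "real CARD('n) * r\<^sup>2 < 1" by (simp add: power_mult_distrib mult.commute)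
  have "(\<lambda>(P, Q). coef r a P Q) = ecoef (hat a)" if "a \<in> Aset" for a :: "complex^'n \<Rightarrow> complex"
    using coef_eq_ecoef[OF assms(1) refl rho that] by auto
  then show ?thesis
    using subtopology_TA_Pset closure_of_Pset abs_expansion_ecoef abs_expansion_unique by metis
qed

end
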